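(* Let $C:F=0$ be a reduced curve in the complex projective plane $\mathbb{P}^2$ of degree $d\geq 3$, no irreducible component of which is a line, and let $H_C$ be its Hessian curve. Let $p\in C$ be a singular point of $C$ of multiplicity $m_p(C)=k$. Then $$(C,H_C)_p \geq 3k(k-1),$$ and equality holds if and only if $(C,p)$ is an ordinary simple $k$-multiple point.
   Context: Here $F\in\mathbb{C}[x,y,z]$ is a reduced homogeneous polynomial of degree $d$. The Hessian $H$ of $F$ is the determinant of the $3\times 3$ matrix of second order partial derivatives of $F$, and the Hessian curve is $H_C:H=0$. $(C,H_C)_p$ denotes the intersection multiplicity of $C$ and $H_C$ at $p$. The germ $(C,p)$ is an ordinary $k$-multiple point if it consists of $k$ smooth branches $C_1,\ldots,C_k$ at $p$ with pairwise distinct tangent lines $L_1,\ldots,L_k$. Setting $m_j=(C_j,L_j)_p\geq 2$ (local intersection multiplicity at $p$), such a point is called an ordinary simple $k$-multiple point if $m_j=2$ for all $j\in\{1,\ldots,k\}$. *)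

theory Defs
  imports
    "HOL-Analysis.Determinants"
    "HOL-Computational_Algebra.Computational_Algebra"
    "HOL-Library.Extended_Nat"
begin

text \<open>
  \<open>\<complex>[x,y,z]\<close> is the iterated polynomial ring \<open>complex poly poly poly\<close>, with \<open>x\<close> the outermost
  and \<open>z\<close> the innermost variable: the coefficient of \<open>x\<^sup>i y\<^sup>j z\<^sup>l\<close> in \<open>F\<close> is
  \<open>coeff (coeff (coeff F i) j) l\<close>. The coordinates \<open>1, 2, 3\<close> of type \<open>3\<close> stand for \<open>x, y, z\<close>,
  and a point of the projective plane is given by a nonzero vector \<open>p :: complex^3\<close> of
  homogeneous coordinates.
\<close>

type_synonym poly3 = "complex poly poly poly"

definition homogeneous :: "nat \<Rightarrow> poly3 \<Rightarrow> bool" where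
  "homogeneous d F \<longleftrightarrow>
     (\<forall>i j l. coeff (coeff (coeff F i) j) l \<noteq> 0 \<longrightarrow> i + j + l = d)"

definition partial :: "3 \<Rightarrow> poly3 \<Rightarrow> poly3" where
  "partial i F =
     (if i = 1 then pderiv F
      else if i = 2 then map_poly pderiv F
      else map_poly (map_poly pderiv) F)"

definition hessian :: "poly3 \<Rightarrow> poly3" where
  "hessian F = det ((\<chi> i j. partial i (partial j F)) :: poly3^3^3)"

text \<open>
  Substitution of a triple of elements of a commutative ring \<open>'a\<close> into \<open>F\<close>, where \<open>c\<close> is the
  structure map \<open>\<complex> \<rightarrow> 'a\<close>.
\<close>

definition peval :: "(complex \<Rightarrow> 'a::comm_ring_1) \<Rightarrow> poly3 \<Rightarrow> 'a^3 \<Rightarrow> 'a" where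
  "peval c F X =
     poly (map_poly (\<lambda>q. poly (map_poly (\<lambda>r. poly (map_poly c r) (X $ 3)) q) (X $ 2)) F) (X $ 1)"

definition singular_point :: "poly3 \<Rightarrow> complex^3 \<Rightarrow> bool" where
  "singular_point F p \<longleftrightarrow>
     p \<noteq> 0 \<and> peval id F p = 0 \<and> (\<forall>i. peval id (partial i F) p = 0)"


text \<open>
  Germs of plane curves. The local ring \<open>\<complex>{u,v}\<close> is the set \<open>conv_series\<close> of convergent power
  series inside \<open>complex fps fps\<close>; the coefficient of \<open>u\<^sup>i v\<^sup>j\<close> in \<open>f\<close> is
  \<open>fps_nth (fps_nth f i) j\<close>.
\<close>

type_synonym series2 = "complex fps fps"

abbreviation coeff2 :: "series2 \<Rightarrow> nat \<Rightarrow> nat \<Rightarrow> complex" where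
  "coeff2 f i j \<equiv> fps_nth (fps_nth f i) j"

definition const2 :: "complex \<Rightarrow> series2" where
  "const2 c = fps_const (fps_const c)"

definition var_u :: series2 where
  "var_u = fps_X"

definition var_v :: series2 where
  "var_v = fps_const fps_X"

definition conv_series :: "series2 set" where
  "conv_series = {f. \<exists>r>0. \<exists>M. \<forall>i j. norm (coeff2 f i j) * r ^ (i + j) \<le> M}"

definition unit_germ :: "series2 \<Rightarrow> bool" where
  "unit_germ f \<longleftrightarrow> f \<in> conv_series \<and> coeff2 f 0 0 \<noteq> 0"

definition germ_mult :: "series2 \<Rightarrow> nat" where
  "germ_mult f = (LEAST n. \<exists>i j. i + j = n \<and> coeff2 f i j \<noteq> 0)"

text \<open>\<open>codim W\<close> is the (possibly infinite) dimension of the complex vector space \<open>\<complex>{u,v} / W\<close>.\<close>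

definition independent_mod :: "series2 set \<Rightarrow> series2 set \<Rightarrow> bool" where
  "independent_mod W B \<longleftrightarrow>
     (\<forall>c. (\<Sum>b\<in>B. const2 (c b) * b) \<in> W \<longrightarrow> (\<forall>b\<in>B. c b = 0))"

definition codim :: "series2 set \<Rightarrow> enat" where
  "codim W = (SUP B\<in>{B. finite B \<and> B \<subseteq> conv_series \<and> independent_mod W B}. enat (card B))"

definition germ_ideal :: "series2 \<Rightarrow> series2 \<Rightarrow> series2 set" where
  "germ_ideal f g = {a * f + b * g | a b. a \<in> conv_series \<and> b \<in> conv_series}"

definition germ_int_mult :: "series2 \<Rightarrow> series2 \<Rightarrow> enat" where
  "germ_int_mult f g = codim (germ_ideal f g)"


text \<open>
  A germ with nonzero linear part is irreducible in \<open>\<complex>{u,v}\<close>, so \<open>smooth_germ\<close> needs no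
  separate irreducibility clause to describe a smooth branch. Its tangent line is the zero set of
  its linear part.
\<close>

definition smooth_germ :: "series2 \<Rightarrow> bool" where
  "smooth_germ g \<longleftrightarrow>
     g \<in> conv_series \<and> coeff2 g 0 0 = 0 \<and> (coeff2 g 1 0 \<noteq> 0 \<or> coeff2 g 0 1 \<noteq> 0)"

definition tangent_line :: "series2 \<Rightarrow> series2" where
  "tangent_line g = const2 (coeff2 g 1 0) * var_u + const2 (coeff2 g 0 1) * var_v"

definition same_tangent :: "series2 \<Rightarrow> series2 \<Rightarrow> bool" where
  "same_tangent g h \<longleftrightarrow> coeff2 g 1 0 * coeff2 h 0 1 = coeff2 g 0 1 * coeff2 h 1 0"

definition ordinary_branches :: "nat \<Rightarrow> series2 \<Rightarrow> (nat \<Rightarrow> series2) \<Rightarrow> bool" where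
  "ordinary_branches k f g \<longleftrightarrow>
     (\<forall>j<k. smooth_germ (g j)) \<and>
     (\<exists>e. unit_germ e \<and> f = e * (\<Prod>j<k. g j)) \<and>
     (\<forall>i<k. \<forall>j<k. i \<noteq> j \<longrightarrow> \<not> same_tangent (g i) (g j))"

definition ordinary_simple_germ :: "nat \<Rightarrow> series2 \<Rightarrow> bool" where
  "ordinary_simple_germ k f \<longleftrightarrow>
     (\<exists>g. ordinary_branches k f g \<and>
          (\<forall>j<k. germ_int_mult (g j) (tangent_line (g j)) = 2))"


text \<open>
  The local equation of \<open>F = 0\<close> at \<open>p\<close>: if \<open>a, b\<close> are two coordinate vectors completing \<open>p\<close> to a
  basis of \<open>\<complex>\<^sup>3\<close>, then \<open>(u,v) \<mapsto> [p + u a + v b]\<close> is an affine chart of the plane centred at \<open>p\<close>,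
  and it maps affine lines to projective lines.
\<close>

definition chart_dirs :: "complex^3 \<Rightarrow> (complex^3) \<times> (complex^3)" where
  "chart_dirs p =
     (if p $ 3 \<noteq> 0 then (axis 1 1, axis 2 1)
      else if p $ 2 \<noteq> 0 then (axis 1 1, axis 3 1)
      else (axis 2 1, axis 3 1))"

definition germ_at :: "poly3 \<Rightarrow> complex^3 \<Rightarrow> series2" where
  "germ_at F p =
     (case chart_dirs p of (a, b) \<Rightarrow>
        peval const2 F (\<chi> i. const2 (p $ i) + const2 (a $ i) * var_u + const2 (b $ i) * var_v))"

definition mult_at :: "poly3 \<Rightarrow> complex^3 \<Rightarrow> nat" where
  "mult_at F p = germ_mult (germ_at F p)"

definition int_mult_at :: "poly3 \<Rightarrow> poly3 \<Rightarrow> complex^3 \<Rightarrow> enat" where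
  "int_mult_at F G p = germ_int_mult (germ_at F p) (germ_at G p)"

definition ordinary_simple_point :: "nat \<Rightarrow> poly3 \<Rightarrow> complex^3 \<Rightarrow> bool" where
  "ordinary_simple_point k F p \<longleftrightarrow> ordinary_simple_germ k (germ_at F p)"

end

theory Submission
  imports Defs
begin

text \<open>
  In an affine chart let \<open>f\<close> be the local equation, of order \<open>k\<close>, with homogeneous parts
  \<open>f\<^sub>k + f\<^sub>k\<^sub>+\<^sub>1 + \<dots>\<close>. By Euler's relations the Hessian equals, up to a unit and modulo \<open>f\<close>, the
  form \<open>h = f\<^sub>u\<^sup>2 f\<^sub>v\<^sub>v - 2 f\<^sub>u f\<^sub>v f\<^sub>u\<^sub>v + f\<^sub>v\<^sup>2 f\<^sub>u\<^sub>u\<close>, whose part of degree \<open>3k - 4\<close> is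
  \<open>k/(k - 1)\<close> times \<open>f\<^sub>k\<close> times the Hessian of \<open>f\<^sub>k\<close>. Subtracting \<open>k/(k - 1) f Hess(f)\<close> gives an
  element of order at least \<open>3k - 3\<close> in the same class modulo \<open>f\<close>, so the intersection multiplicity
  is at least \<open>k(3k - 3)\<close>, with equality iff its part \<open>g\<close> of degree \<open>3k - 3\<close> has no common zero with
  \<open>f\<^sub>k\<close> on the projective line. At a zero \<open>(x, y)\<close> of \<open>f\<^sub>k\<close> with gradient \<open>\<mu> (y, -x)\<close> one finds
  \<open>g = 2 \<mu>\<^sup>2 f\<^sub>k\<^sub>+\<^sub>1\<close>. Hence equality holds iff all tangents are simple, which by Hensel's lemma means that
  \<open>f\<close> splits into \<open>k\<close> transversal smooth branches, and \<open>f\<^sub>k\<^sub>+\<^sub>1\<close> vanishes on none of them, which means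
  that each branch meets its tangent with multiplicity two.

  A power series is convergent iff its homogeneous parts grow at most geometrically in the
  \<open>\<ell>\<^sup>1\<close> norm of their coefficients, and the division and factorization statements are solved degree
  by degree with a quadratic majorant.
\<close>

section \<open>Homogeneous parts of bivariate power series\<close>

unbundle no vec_syntax
unbundle fps_syntax

text \<open>Since the codimension is a supremum over finite independent families, both bounds come
  down to counting vectors modulo order \<open>s + t\<close>, where \<open>s\<close> and
  \<open>t\<close> are the orders of the two germs. Truncated there, the ideal is spanned by the
  multiples of \<open>f\<close> by monomials of degree less than \<open>t\<close> and of
  \<open>g\<close> by monomials of degree less than \<open>s\<close>. These number
  \<open>s * t\<close> fewer than the monomials of degree less than \<open>s + t\<close>, and they
  are independent when the leading forms are coprime.

  The lower bound does not see convergence. The upper bound does: a germ of order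
  \<open>s + t\<close> must be a combination of \<open>f\<close> and \<open>g\<close> with
  convergent coefficients. Solving degree by degree leaves a choice in every degree, and careless
  choices may grow too fast. The choice is therefore made once, on finitely many monomials, and
  extended by shifts and linearity to operators whose norm does not depend on the degree. Hensel's
  lemma differs from division only by a product of the two unknowns, whence one solver with a switch
  \<open>e\<close> in {0, 1}.\<close>

locale ring_hom_map =
  fixes \<phi> :: "'a::comm_ring_1 \<Rightarrow> 'b::comm_ring_1"
  assumes hom_add: "\<phi> (x + y) = \<phi> x + \<phi> y"
    and hom_mult: "\<phi> (x * y) = \<phi> x * \<phi> y"
    and hom_one: "\<phi> 1 = 1"
begin

lemma hom_zero: "\<phi> 0 = 0"
  using hom_add[of 0 0] by simp

lemma hom_uminus: "\<phi> (- x) = - \<phi> x"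
  using hom_add[of x "- x"] by (simp add: hom_zero eq_neg_iff_add_eq_0 add.commute)

lemma hom_diff: "\<phi> (x - y) = \<phi> x - \<phi> y"
  using hom_add[of x "- y"] by (simp add: hom_uminus)

lemma hom_power: "\<phi> (x ^ n) = \<phi> x ^ n"
  by (induction n) (simp_all add: hom_one hom_mult)

lemma hom_sum: "\<phi> (sum f A) = (\<Sum>i\<in>A. \<phi> (f i))"
  by (induction A rule: infinite_finite_induct) (simp_all add: hom_zero hom_add)

lemma hom_prod: "\<phi> (prod f A) = (\<Prod>i\<in>A. \<phi> (f i))"
  by (induction A rule: infinite_finite_induct) (simp_all add: hom_one hom_mult)

lemma hom_of_nat: "\<phi> (of_nat n) = of_nat n"
  by (induction n) (simp_all add: hom_zero hom_add hom_one)

lemmas hom_simps = hom_zero hom_one hom_add hom_mult hom_uminus hom_diff hom_power hom_sum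
  hom_prod hom_of_nat

end

lemma poly_map_poly_hom:
  assumes "ring_hom_map \<phi>"
  shows "ring_hom_map (\<lambda>p. poly (map_poly \<phi> p) x)"
proof -
  interpret ring_hom_map \<phi> by fact
  have add: "poly (map_poly \<phi> (p + q)) x = poly (map_poly \<phi> p) x + poly (map_poly \<phi> q) x" for p q
    by (induction p q rule: poly_induct2) (simp_all add: map_poly_pCons hom_simps algebra_simps)
  have smult: "poly (map_poly \<phi> (smult a q)) x = \<phi> a * poly (map_poly \<phi> q) x" for a q
    by (induction q) (simp_all add: map_poly_pCons hom_simps algebra_simps)
  have mult: "poly (map_poly \<phi> (p * q)) x = poly (map_poly \<phi> p) x * poly (map_poly \<phi> q) x" for p q
    by (induction p) (simp_all add: map_poly_pCons hom_simps add smult algebra_simps)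
  show ?thesis
    by unfold_locales (auto simp: add mult hom_simps)
qed

lemma peval_hom:
  assumes "ring_hom_map c"
  shows "ring_hom_map (\<lambda>F. peval c F X)"
  unfolding peval_def by (intro poly_map_poly_hom assms)

lemma ring_hom_map_const2: "ring_hom_map const2"
  by unfold_locales (auto simp: const2_def)

interpretation const2: ring_hom_map const2
  by (rule ring_hom_map_const2)

lemma const2_eq_0_iff [simp]: "const2 c = 0 \<longleftrightarrow> c = 0"
  by (simp add: const2_def)

lemma coeff2_const2_mult [simp]: "coeff2 (const2 c * f) i j = c * coeff2 f i j"
  by (simp add: const2_def)

lemma coeff2_const2: "coeff2 (const2 c) i j = (if i = 0 \<and> j = 0 then c else 0)"
  by (simp add: const2_def)

lemma coeff2_sum: "coeff2 (sum f A) i j = (\<Sum>a\<in>A. coeff2 (f a) i j)"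
  by (simp add: fps_sum_nth)

lemma coeff2_mult:
  "coeff2 (f * g) i j = (\<Sum>a\<le>i. \<Sum>b\<le>j. coeff2 f a b * coeff2 g (i - a) (j - b))"
  by (simp add: fps_mult_nth fps_sum_nth atLeast0AtMost)

lemma series2_eqI: "(\<And>i j. coeff2 f i j = coeff2 g i j) \<Longrightarrow> f = g"
  by (simp add: fps_eq_iff)

text \<open>\<open>restr c x y f\<close> is \<open>f(xT, yT)\<close>. For \<open>x = 1\<close> and \<open>y\<close> a polynomial variable this is the
  blow-up substitution, which encodes the homogeneous part of degree \<open>n\<close> by a polynomial of degree
  at most \<open>n\<close>.\<close>

definition restr :: "(complex \<Rightarrow> 'a::comm_ring_1) \<Rightarrow> 'a \<Rightarrow> 'a \<Rightarrow> series2 \<Rightarrow> 'a fps" where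
  "restr c x y f = Abs_fps (\<lambda>n. \<Sum>j\<le>n. c (coeff2 f (n - j) j) * x ^ (n - j) * y ^ j)"

text \<open>Both sides run over the pairs of monomials of total degree \<open>n\<close>. The left
  side groups them by the total exponent \<open>j\<close> of the second variable, as a coefficient
  of a product of series does; the right side groups them by the total degree \<open>m\<close> of
  the first factor, as the Cauchy product of the restrictions does.\<close>

lemma sum_triangle_split:
  fixes h :: "nat \<Rightarrow> nat \<Rightarrow> nat \<Rightarrow> nat \<Rightarrow> 'a::comm_monoid_add"
  shows "(\<Sum>j\<le>n. \<Sum>a\<le>n - j. \<Sum>b\<le>j. h a b (n - j - a) (j - b)) =
         (\<Sum>m\<le>n. \<Sum>b\<le>m. \<Sum>e\<le>n - m. h (m - b) b (n - m - e) e)"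
proof -
  have "(\<Sum>j\<le>n. \<Sum>a\<le>n - j. \<Sum>b\<le>j. h a b (n - j - a) (j - b)) =
    (\<Sum>(j,a,b)\<in>Sigma {..n} (\<lambda>j. {..n-j} \<times> {..j}). h a b (n - j - a) (j - b))"
    by (simp add: sum.Sigma sum.cartesian_product)
  also have "\<dots> = (\<Sum>(m,b,e)\<in>Sigma {..n} (\<lambda>m. {..m} \<times> {..n-m}). h (m - b) b (n - m - e) e)"
    by (rule sum.reindex_bij_witness[where i = "\<lambda>(m,b,e). (b + e, m - b, b)"
          and j = "\<lambda>(j,a,b). (a + b, b, j - b)"]) (auto simp: diff_diff_left add.commute)
  also have "\<dots> = (\<Sum>m\<le>n. \<Sum>b\<le>m. \<Sum>e\<le>n - m. h (m - b) b (n - m - e) e)"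
    by (simp add: sum.Sigma sum.cartesian_product)
  finally show ?thesis .
qed

lemma restr_hom:
  assumes "ring_hom_map c"
  shows "ring_hom_map (restr c x y)"
proof -
  interpret ring_hom_map c by fact
  show ?thesis
  proof
    fix f g
    show "restr c x y (f + g) = restr c x y f + restr c x y g"
      by (simp add: restr_def fps_eq_iff hom_simps algebra_simps sum.distrib)
    show "restr c x y (f * g) = restr c x y f * restr c x y g"
    proof (rule fps_ext)
      fix n
      have "restr c x y (f * g) $ n = (\<Sum>j\<le>n. \<Sum>a\<le>n - j. \<Sum>b\<le>j.
          (c (coeff2 f a b) * x ^ a * y ^ b) * (c (coeff2 g (n - j - a) (j - b)) * x ^ (n - j - a) * y ^ (j - b)))"
        unfolding restr_def coeff2_mult fps_nth_Abs_fps hom_simps sum_distrib_right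
      proof (intro sum.cong refl)
        fix j a b assume "j \<in> {..n}" "a \<in> {..n - j}" "b \<in> {..j}"
        then have "x ^ (n - j) = x ^ a * x ^ (n - j - a)" "y ^ j = y ^ b * y ^ (j - b)"
          by (simp_all flip: power_add)
        then show "c (coeff2 f a b) * c (coeff2 g (n - j - a) (j - b)) * x ^ (n - j) * y ^ j =
           c (coeff2 f a b) * x ^ a * y ^ b * (c (coeff2 g (n - j - a) (j - b)) * x ^ (n - j - a) * y ^ (j - b))"
          by (simp add: algebra_simps)
      qed
      also have "\<dots> = (\<Sum>m\<le>n. \<Sum>b\<le>m. \<Sum>e\<le>n - m.
          (c (coeff2 f (m - b) b) * x ^ (m - b) * y ^ b) * (c (coeff2 g (n - m - e) e) * x ^ (n - m - e) * y ^ e))"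
        by (rule sum_triangle_split)
      also have "\<dots> = (restr c x y f * restr c x y g) $ n"
        by (simp add: restr_def fps_mult_nth sum_product atLeast0AtMost)
      finally show "restr c x y (f * g) $ n = (restr c x y f * restr c x y g) $ n" .
    qed
    show "restr c x y 1 = 1"
    proof (rule fps_ext)
      fix n
      show "restr c x y 1 $ n = 1 $ n"
        by (cases n) (auto simp: restr_def hom_simps intro!: sum.neutral)
    qed
  qed
qed

section \<open>Restriction to lines through the origin and the blow-up chart\<close>

abbreviation line :: "complex \<Rightarrow> complex \<Rightarrow> series2 \<Rightarrow> complex fps" where
  "line x y \<equiv> restr (\<lambda>c. c) x y"

abbreviation blow :: "series2 \<Rightarrow> complex poly fps" where
  "blow \<equiv> restr (\<lambda>c. [:c:]) 1 [:0, 1:]"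

lemma ring_hom_map_ident: "ring_hom_map (\<lambda>c. c)"
  by unfold_locales auto

lemma ring_hom_map_const_poly: "ring_hom_map (\<lambda>c::complex. [:c:])"
  by unfold_locales (auto simp: one_pCons)

interpretation line: ring_hom_map "line x y" for x y
  by (intro restr_hom ring_hom_map_ident)

interpretation blow: ring_hom_map blow
  by (intro restr_hom ring_hom_map_const_poly)

lemma coeff_sum_monom': "coeff (\<Sum>j\<le>n. monom (f j) j) i = (if i \<le> n then f i else 0)"
  by (simp add: coeff_sum)

lemma blow_nth: "blow f $ n = (\<Sum>j\<le>n. monom (coeff2 f (n - j) j) j)"
proof -
  have "[:0, 1::complex:] ^ j = monom 1 j" for j
    by (simp add: monom_altdef)
  then show ?thesis by (simp add: restr_def smult_monom)
qed

lemma coeff_blow: "coeff (blow f $ n) j = (if j \<le> n then coeff2 f (n - j) j else 0)"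
  unfolding blow_nth by (rule coeff_sum_monom')

lemma degree_blow: "degree (blow f $ n) \<le> n"
  by (rule degree_le) (simp add: coeff_blow)

lemma coeff2_eq_coeff_blow: "coeff2 f i j = coeff (blow f $ (i + j)) j"
  by (simp add: coeff_blow)

lemma blow_inject: "blow f = blow g \<Longrightarrow> f = g"
  by (rule series2_eqI) (simp add: coeff2_eq_coeff_blow)

text \<open>Together with \<open>degree_blow\<close> this characterizes the image of
  \<open>blow\<close>. It is the reason why degree bounds accompany every series that is built later
  from its homogeneous parts.\<close>

lemma blow_surj:
  assumes "\<And>n. degree (P $ n) \<le> n"
  obtains f where "blow f = P"
proof
  show "blow (Abs_fps (\<lambda>i. Abs_fps (\<lambda>j. coeff (P $ (i + j)) j))) = P"
  proof (intro fps_ext poly_eqI)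
    fix n j
    show "coeff (blow (Abs_fps (\<lambda>i. Abs_fps (\<lambda>j. coeff (P $ (i + j)) j))) $ n) j = coeff (P $ n) j"
      using assms[of n] by (simp add: coeff_blow coeff_eq_0)
  qed
qed

lemma line_nth: "line x y f $ n = (\<Sum>j\<le>n. coeff2 f (n - j) j * x ^ (n - j) * y ^ j)"
  by (simp add: restr_def)

lemma line_const2 [simp]: "line x y (const2 c) = fps_const c"
proof (rule fps_ext)
  fix n show "line x y (const2 c) $ n = fps_const c $ n"
    by (cases n) (auto simp: line_nth const2_def intro!: sum.neutral)
qed

lemma poly_blow: "poly (blow f $ n) t = line 1 t f $ n"
  by (simp add: blow_nth line_nth poly_sum poly_monom)

lemma line_scale: "line (s * x) (s * y) f $ n = s ^ n * line x y f $ n"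
  unfolding line_nth sum_distrib_left
proof (intro sum.cong refl)
  fix j assume "j \<in> {..n}"
  then have "s ^ n = s ^ (n - j) * s ^ j" by (simp flip: power_add)
  then show "coeff2 f (n - j) j * (s * x) ^ (n - j) * (s * y) ^ j =
      s ^ n * (coeff2 f (n - j) j * x ^ (n - j) * y ^ j)"
    by (simp add: power_mult_distrib)
qed

lemma line_eq_poly: "x \<noteq> 0 \<Longrightarrow> line x y f $ n = x ^ n * poly (blow f $ n) (y / x)"
  using line_scale[of x 1 "y / x" f n] by (simp add: poly_blow)

text \<open>The direction \<open>(0, 1)\<close> is not a root of the polynomial
  \<open>blow f $ n\<close>: it is the point at infinity, and the form vanishes there when the
  coefficient of degree \<open>n\<close> does, that is, when the degree drops.\<close>

lemma line_eq_coeff: "line 0 y f $ n = y ^ n * coeff (blow f $ n) n"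
proof -
  have "line 0 y f $ n = (\<Sum>j\<in>{n}. coeff2 f (n - j) j * 0 ^ (n - j) * y ^ j)"
    unfolding line_nth by (intro sum.mono_neutral_right) auto
  then show ?thesis by (simp add: coeff_blow)
qed

section \<open>The filtration by order\<close>

definition order_ge :: "nat \<Rightarrow> series2 \<Rightarrow> bool" where
  "order_ge n f \<longleftrightarrow> (\<forall>i j. i + j < n \<longrightarrow> coeff2 f i j = 0)"

lemma order_ge_iff_blow: "order_ge n f \<longleftrightarrow> (\<forall>m<n. blow f $ m = 0)"
proof
  assume "order_ge n f"
  then show "\<forall>m<n. blow f $ m = 0"
    by (auto simp: order_ge_def poly_eq_iff coeff_blow)
next
  assume *: "\<forall>m<n. blow f $ m = 0"
  show "order_ge n f"
    unfolding order_ge_def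
  proof (intro allI impI)
    fix i j assume "i + j < n"
    then have "blow f $ (i + j) = 0" using * by blast
    then show "coeff2 f i j = 0" by (simp only: coeff2_eq_coeff_blow coeff_0)
  qed
qed

lemma order_ge_line: "order_ge n f \<Longrightarrow> m < n \<Longrightarrow> line x y f $ m = 0"
  by (auto simp: order_ge_def line_nth intro!: sum.neutral)

lemma blow_eq_0_iff_line: "blow f $ m = 0 \<longleftrightarrow> (\<forall>t. line 1 t f $ m = 0)"
  unfolding poly_blow[symmetric] by (simp add: poly_all_0_iff_0)

lemma order_ge_0 [simp]: "order_ge 0 f"
  by (simp add: order_ge_def)

lemma order_ge_mono: "order_ge n f \<Longrightarrow> m \<le> n \<Longrightarrow> order_ge m f"
  by (auto simp: order_ge_def)

lemma order_ge_add: "order_ge n f \<Longrightarrow> order_ge n g \<Longrightarrow> order_ge n (f + g)"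
  by (auto simp: order_ge_def)

lemma order_ge_diff: "order_ge n f \<Longrightarrow> order_ge n g \<Longrightarrow> order_ge n (f - g)"
  by (auto simp: order_ge_def)

lemma fps_eq_X_power_mult:
  fixes P :: "'a::comm_ring_1 fps"
  assumes "\<And>m. m < n \<Longrightarrow> P $ m = 0"
  shows "P = fps_X ^ n * Abs_fps (\<lambda>m. P $ (m + n))"
  using assms by (intro fps_ext) (auto simp: fps_X_power_mult_nth)

lemma order_ge_mult:
  assumes "order_ge m f" "order_ge n g"
  shows "order_ge (m + n) (f * g)"
  unfolding order_ge_iff_blow blow.hom_mult fps_mult_nth
proof (intro allI impI sum.neutral ballI)
  fix l i assume "l < m + n" "i \<in> {0..l}"
  then have "i < m \<or> l - i < n" by auto
  with assms show "blow f $ i * blow g $ (l - i) = 0"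
    by (auto simp: order_ge_iff_blow)
qed

section \<open>Convergence in terms of homogeneous parts\<close>

text \<open>Among the coefficient norms this one is submultiplicative, so that estimates for
  products of homogeneous parts carry no factor that depends on the degree.\<close>

definition l1 :: "complex poly \<Rightarrow> real" where
  "l1 p = (\<Sum>a\<leftarrow>coeffs p. norm a)"

lemma l1_0 [simp]: "l1 0 = 0"
  by (simp add: l1_def)

lemma l1_pCons [simp]: "l1 (pCons a p) = norm a + l1 p"
  by (cases "a = 0 \<and> p = 0") (auto simp: l1_def cCons_def)

lemma l1_nonneg [simp]: "0 \<le> l1 p"
  by (induction p) auto

lemma l1_add: "l1 (p + q) \<le> l1 p + l1 q"
proof (induction p q rule: poly_induct2)
  case (pCons a p b q)
  then show ?case using norm_triangle_ineq[of a b] by simp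
qed auto

lemma l1_smult [simp]: "l1 (smult c p) = norm c * l1 p"
  by (induction p) (auto simp: norm_mult algebra_simps)

lemma l1_uminus [simp]: "l1 (- p) = l1 p"
  by (induction p) auto

lemma l1_diff: "l1 (p - q) \<le> l1 p + l1 q"
  using l1_add[of p "- q"] by simp

lemma l1_mult: "l1 (p * q) \<le> l1 p * l1 q"
proof (induction p)
  case (pCons a p)
  have "l1 (pCons a p * q) \<le> l1 (smult a q) + l1 (pCons 0 (p * q))"
    by (simp only: mult_pCons_left l1_add)
  also have "\<dots> \<le> l1 (pCons a p) * l1 q"
    using pCons by (simp add: algebra_simps)
  finally show ?case .
qed auto

lemma l1_sum: "l1 (sum f A) \<le> (\<Sum>i\<in>A. l1 (f i))"
proof (induction A rule: infinite_finite_induct)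
  case (insert x F)
  then show ?case using l1_add[of "f x" "sum f F"] by simp
qed auto

lemma l1_monom [simp]: "l1 (monom c n) = norm c"
  by (induction n) (auto simp: monom_0 monom_Suc)

lemma norm_coeff_le_l1: "norm (coeff p i) \<le> l1 p"
proof (induction p arbitrary: i)
  case (pCons a p)
  then show ?case
    by (cases i) (auto intro: add_increasing)
qed auto

lemma l1_of_nat: "l1 (of_nat n) = real n"
  by (simp add: of_nat_poly)

lemma real_Suc_le_two_power: "real (n + 1) \<le> 2 ^ n"
  by (induction n) auto

section \<open>Series with geometrically bounded homogeneous parts\<close>

definition geometric :: "complex poly fps \<Rightarrow> bool" where
  "geometric P \<longleftrightarrow> (\<exists>M\<ge>0. \<exists>R\<ge>1. \<forall>n. l1 (P $ n) \<le> M * R ^ n)"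

lemma geometricI:
  assumes "\<And>n. l1 (P $ n) \<le> M * R ^ n" "R > 0"
  shows "geometric P"
proof -
  have "M \<ge> 0" using assms(1)[of 0] order_trans[OF l1_nonneg] by fastforce
  have "M * R ^ n \<le> M * max 1 R ^ n" for n
    using assms(2) \<open>M \<ge> 0\<close> by (intro mult_left_mono power_mono) auto
  then have "\<forall>n. l1 (P $ n) \<le> M * max 1 R ^ n"
    using assms(1) order_trans by blast
  with \<open>M \<ge> 0\<close> show ?thesis unfolding geometric_def by (metis max.cobounded1)
qed

lemma geometric_common:
  assumes "geometric P" "geometric Q"
  obtains M R where "M \<ge> 0" "R \<ge> 1" "\<And>n. l1 (P $ n) \<le> M * R ^ n" "\<And>n. l1 (Q $ n) \<le> M * R ^ n"
proof -
  obtain M1 R1 M2 R2 where *: "M1 \<ge> 0" "R1 \<ge> 1" "\<And>n. l1 (P $ n) \<le> M1 * R1 ^ n"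
    "M2 \<ge> 0" "R2 \<ge> 1" "\<And>n. l1 (Q $ n) \<le> M2 * R2 ^ n"
    using assms unfolding geometric_def by metis
  have "M1 * R1 ^ n \<le> max M1 M2 * max R1 R2 ^ n" "M2 * R2 ^ n \<le> max M1 M2 * max R1 R2 ^ n" for n
    using * by (intro mult_mono power_mono; auto)+
  then have "l1 (P $ n) \<le> max M1 M2 * max R1 R2 ^ n" "l1 (Q $ n) \<le> max M1 M2 * max R1 R2 ^ n" for n
    using *(3,6) order_trans by blast+
  with * show ?thesis
    by (intro that[of "max M1 M2" "max R1 R2"]) auto
qed

lemma geometric_add:
  assumes "geometric P" "geometric Q"
  shows "geometric (P + Q)"
proof -
  obtain M R where *: "M \<ge> 0" "R \<ge> 1" "\<And>n. l1 (P $ n) \<le> M * R ^ n" "\<And>n. l1 (Q $ n) \<le> M * R ^ n"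
    using geometric_common[OF assms] by metis
  have "l1 ((P + Q) $ n) \<le> (2 * M) * R ^ n" for n
    using l1_add[of "P $ n" "Q $ n"] *(3,4)[of n] by simp
  with * show ?thesis by (intro geometricI[of _ "2 * M" R]) auto
qed

lemma geometric_mult:
  assumes "geometric P" "geometric Q"
  shows "geometric (P * Q)"
proof -
  obtain M R where *: "M \<ge> 0" "R \<ge> 1" "\<And>n. l1 (P $ n) \<le> M * R ^ n" "\<And>n. l1 (Q $ n) \<le> M * R ^ n"
    using geometric_common[OF assms] by metis
  have "l1 ((P * Q) $ n) \<le> (M * M) * (2 * R) ^ n" for n
  proof -
    have "l1 ((P * Q) $ n) \<le> (\<Sum>i=0..n. l1 (P $ i * Q $ (n - i)))"
      unfolding fps_mult_nth by (rule l1_sum)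
    also have "\<dots> \<le> (\<Sum>i=0..n. (M * R ^ i) * (M * R ^ (n - i)))"
      using * by (intro sum_mono order_trans[OF l1_mult] mult_mono) auto
    also have "\<dots> = (\<Sum>i=0..n. M * M * R ^ n)"
      by (intro sum.cong refl) (simp add: algebra_simps flip: power_add)
    also have "\<dots> = real (n + 1) * (M * M * R ^ n)"
      by simp
    also have "real (n + 1) \<le> 2 ^ n"
      by (rule real_Suc_le_two_power)
    then have "real (n + 1) * (M * M * R ^ n) \<le> 2 ^ n * (M * M * R ^ n)"
      using * by (intro mult_right_mono) auto
    finally show ?thesis by (simp add: power_mult_distrib algebra_simps)
  qed
  with * show ?thesis by (intro geometricI[of _ "M * M" "2 * R"]) auto
qed

text \<open>A homogeneous part of degree \<open>n\<close> has \<open>n + 1\<close> coefficients, and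
  the factor \<open>n + 1 \<le> 2 ^ n\<close> is absorbed by halving the radius. Conversely every
  coefficient is bounded by the norm of its homogeneous part.\<close>

lemma conv_series_iff_geometric: "f \<in> conv_series \<longleftrightarrow> geometric (blow f)"
proof
  assume "f \<in> conv_series"
  then obtain r M where r: "r > 0" and M: "\<And>i j. norm (coeff2 f i j) * r ^ (i + j) \<le> M"
    unfolding conv_series_def by blast
  have M0: "M \<ge> 0" using M[of 0 0] order_trans[OF norm_ge_zero] by fastforce
  have c: "norm (coeff2 f i j) \<le> M * (1 / r) ^ (i + j)" for i j
    using M[of i j] r by (simp add: field_simps power_divide)
  have "l1 (blow f $ n) \<le> M * (2 / r) ^ n" for n
  proof -
    have "l1 (blow f $ n) \<le> (\<Sum>j\<le>n. norm (coeff2 f (n - j) j))"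
      unfolding blow_nth by (rule order_trans[OF l1_sum]) simp
    also have "\<dots> \<le> (\<Sum>j\<le>n. M * (1 / r) ^ n)"
      using c by (intro sum_mono) (metis atMost_iff le_add_diff_inverse2)
    also have "\<dots> = real (n + 1) * (M * (1 / r) ^ n)" by simp
    also have "real (n + 1) \<le> 2 ^ n"
      by (rule real_Suc_le_two_power)
    then have "real (n + 1) * (M * (1 / r) ^ n) \<le> 2 ^ n * (M * (1 / r) ^ n)"
      using M0 r by (intro mult_right_mono) auto
    finally show ?thesis by (simp add: power_divide mult.commute)
  qed
  with r show "geometric (blow f)" by (intro geometricI[of _ M "2 / r"]) auto
next
  assume "geometric (blow f)"
  then obtain M R where *: "M \<ge> 0" "R \<ge> 1" "\<And>n. l1 (blow f $ n) \<le> M * R ^ n"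
    unfolding geometric_def by blast
  have "norm (coeff2 f i j) * (1 / R) ^ (i + j) \<le> M" for i j
  proof -
    have "norm (coeff2 f i j) \<le> M * R ^ (i + j)"
      unfolding coeff2_eq_coeff_blow by (rule order_trans[OF norm_coeff_le_l1 *(3)])
    then show ?thesis using *(2) by (simp add: field_simps power_divide)
  qed
  with *(2) show "f \<in> conv_series"
    unfolding conv_series_def mem_Collect_eq
    by (intro exI[of _ "1 / R"] conjI exI[of _ M] allI) auto
qed

section \<open>Closure properties of the ring of convergent series\<close>

lemma conv_series_add: "f \<in> conv_series \<Longrightarrow> g \<in> conv_series \<Longrightarrow> f + g \<in> conv_series"
  by (simp add: conv_series_iff_geometric blow.hom_add geometric_add)

lemma conv_series_mult: "f \<in> conv_series \<Longrightarrow> g \<in> conv_series \<Longrightarrow> f * g \<in> conv_series"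
  by (simp add: conv_series_iff_geometric blow.hom_mult geometric_mult)

lemma conv_series_finite:
  assumes "\<And>i j. i + j \<ge> n \<Longrightarrow> coeff2 f i j = 0"
  shows "f \<in> conv_series"
proof -
  define S where "S = (\<lambda>(i,j). norm (coeff2 f i j)) ` ({..n} \<times> {..n})"
  define M where "M = Max S"
  have "finite S" by (simp add: S_def)
  then have M: "x \<le> M" if "x \<in> S" for x
    using that by (simp add: M_def)
  have "norm (coeff2 f 0 0) \<le> M" by (rule M) (force simp: S_def)
  then have "M \<ge> 0" using norm_ge_zero order_trans by blast
  have "norm (coeff2 f i j) \<le> M" for i j
  proof (cases "i + j \<ge> n")
    case False
    then show ?thesis by (intro M) (force simp: S_def)
  qed (use assms \<open>M \<ge> 0\<close> in auto)
  then show ?thesis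
    unfolding conv_series_def mem_Collect_eq
    by (intro exI[of _ 1] conjI exI[of _ M] allI) auto
qed

lemma conv_series_const2 [simp]: "const2 c \<in> conv_series"
  by (rule conv_series_finite[of 1]) (auto simp: coeff2_const2)

lemma coeff2_var_u: "coeff2 var_u i j = (if i = 1 \<and> j = 0 then 1 else 0)"
  by (simp add: var_u_def fps_X_nth)

lemma coeff2_var_v: "coeff2 var_v i j = (if i = 0 \<and> j = 1 then 1 else 0)"
  by (simp add: var_v_def fps_X_nth)

lemma conv_series_var_u [simp]: "var_u \<in> conv_series"
  by (rule conv_series_finite[of 2]) (auto simp: coeff2_var_u)

lemma conv_series_var_v [simp]: "var_v \<in> conv_series"
  by (rule conv_series_finite[of 2]) (auto simp: coeff2_var_v)

lemma conv_series_0 [simp]: "0 \<in> conv_series" and conv_series_1 [simp]: "1 \<in> conv_series"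
  using conv_series_const2[of 0] conv_series_const2[of 1] by (simp_all add: const2.hom_simps del: conv_series_const2)

lemma conv_series_uminus: "f \<in> conv_series \<Longrightarrow> - f \<in> conv_series"
  using conv_series_mult[OF conv_series_const2[of "-1"], of f] by (simp add: const2.hom_simps)

lemma conv_series_diff: "f \<in> conv_series \<Longrightarrow> g \<in> conv_series \<Longrightarrow> f - g \<in> conv_series"
  using conv_series_add[OF _ conv_series_uminus, of f g] by simp

lemma conv_series_power: "f \<in> conv_series \<Longrightarrow> f ^ n \<in> conv_series"
  by (induction n) (auto intro: conv_series_mult)

lemma conv_series_sum: "(\<And>i. i \<in> A \<Longrightarrow> f i \<in> conv_series) \<Longrightarrow> sum f A \<in> conv_series"
  by (induction A rule: infinite_finite_induct) (auto intro: conv_series_add)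

lemmas conv_series_intros = conv_series_add conv_series_mult conv_series_diff conv_series_uminus
  conv_series_power conv_series_sum conv_series_const2 conv_series_var_u conv_series_var_v
  conv_series_0 conv_series_1

section \<open>Lower bounds for the intersection multiplicity\<close>

text \<open>The usual bound on independent subsets of a span, for indexed families: different
  indices may carry the same vector, as happens for truncations, and such a coincidence has to count
  as a relation.\<close>

lemma (in vector_space) family_dependent:
  assumes "finite I" "finite T" "card T < card I" "\<And>i. i \<in> I \<Longrightarrow> v i \<in> span T"
  obtains c where "(\<Sum>i\<in>I. scale (c i) (v i)) = 0" "\<exists>i\<in>I. c i \<noteq> 0"
proof (cases "inj_on v I")
  case True
  have "dependent (v ` I)"
  proof (rule ccontr)
    assume "\<not> dependent (v ` I)"
    with assms have "card (v ` I) \<le> card T"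
      using independent_span_bound[of T "v ` I"] by auto
    with True assms show False by (simp add: card_image)
  qed
  then obtain u where "(\<Sum>x\<in>v ` I. scale (u x) x) = 0" "\<exists>x\<in>v ` I. u x \<noteq> 0"
    using assms(1) by (auto simp: dependent_finite)
  with True show ?thesis
    by (intro that[of "u \<circ> v"]) (auto simp: sum.reindex)
next
  case False
  then obtain i j where ij: "i \<in> I" "j \<in> I" "i \<noteq> j" "v i = v j"
    by (auto simp: inj_on_def)
  define c :: "_ \<Rightarrow> 'a" where "c k = (if k = i then 1 else if k = j then - 1 else 0)" for k
  have "(\<Sum>k\<in>I. scale (c k) (v k)) = (\<Sum>k\<in>{i,j}. scale (c k) (v k))"
    using assms(1) ij by (intro sum.mono_neutral_right) (auto simp: c_def)
  also have "\<dots> = 0" using ij by (simp add: c_def)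
  finally show ?thesis using ij by (intro that[of c]) (auto simp: c_def)
qed

text \<open>Adjoining to a basis of \<open>span S\<close> enough elements of \<open>T\<close> gives a complement.\<close>

lemma (in vector_space) complement_in:
  assumes "finite S" "finite T" "independent T"
  obtains B where "B \<subseteq> T" "card T \<le> card B + card S"
    "\<And>c. (\<Sum>b\<in>B. scale (c b) b) \<in> span S \<Longrightarrow> \<forall>b\<in>B. c b = 0"
proof -
  obtain S0 where S0: "S0 \<subseteq> S" "independent S0" "span S0 = span S"
    by (metis maximal_independent_subset[of S] span_superset span_subspace subspace_span span_mono subset_antisym span_minimal)
  obtain C where C: "S0 \<subseteq> C" "C \<subseteq> S0 \<union> T" "independent C" "S0 \<union> T \<subseteq> span C"
    using maximal_independent_subset_extend[of S0 "S0 \<union> T"] S0 by auto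
  have fin: "finite S0"
    by (rule finite_subset[OF S0(1) assms(1)])
  then have fin: "finite S0" "finite C"
    using finite_subset[OF C(2)] assms(2) by simp_all
  have "card T \<le> card C"
    using independent_span_bound[of C T] assms C fin by auto
  also have "\<dots> \<le> card (C - S0) + card S0"
    using fin C(1) by (simp add: card_Diff_subset card_mono)
  also have "\<dots> \<le> card (C - S0) + card S"
    using S0 assms card_mono by auto
  finally have card: "card T \<le> card (C - S0) + card S" .
  have ind: "\<forall>b\<in>C - S0. c b = 0" if "(\<Sum>b\<in>C - S0. scale (c b) b) \<in> span S" for c
  proof -
    have "(\<Sum>b\<in>C - S0. scale (c b) b) \<in> range (\<lambda>u. \<Sum>v\<in>S0. scale (u v) v)"
      using that S0(3) span_finite[OF fin(1)] by simp
    then obtain e where e: "(\<Sum>b\<in>C - S0. scale (c b) b) = (\<Sum>b\<in>S0. scale (e b) b)"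
      by blast
    define h where "h b = (if b \<in> S0 then - e b else c b)" for b
    have "(\<Sum>b\<in>C. scale (h b) b) = (\<Sum>b\<in>C - S0. scale (h b) b) + (\<Sum>b\<in>S0. scale (h b) b)"
      using fin C(1) by (metis sum.subset_diff)
    also have "(\<Sum>b\<in>C - S0. scale (h b) b) = (\<Sum>b\<in>C - S0. scale (c b) b)"
      by (intro sum.cong) (auto simp: h_def)
    also have "(\<Sum>b\<in>S0. scale (h b) b) = - (\<Sum>b\<in>S0. scale (e b) b)"
      unfolding sum_negf[symmetric] by (intro sum.cong) (auto simp: h_def)
    finally have "(\<Sum>b\<in>C. scale (h b) b) = 0" using e by simp
    with C(3) fin have "\<forall>b\<in>C. h b = 0"
      by (auto simp: dependent_finite)
    then show ?thesis by (auto simp: h_def)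
  qed
  show ?thesis
    using C(2) card ind by (intro that[of "C - S0"]) auto
qed

interpretation series: vector_space "\<lambda>c f. const2 c * f"
  by unfold_locales (auto simp: const2.hom_simps algebra_simps)

interpretation cpoly: vector_space "smult :: complex \<Rightarrow> _"
  by unfold_locales (auto simp: smult_add_right smult_add_left)

section \<open>Monomials and truncation\<close>

definition mono2 :: "nat \<times> nat \<Rightarrow> series2" where
  "mono2 = (\<lambda>(i, j). var_u ^ i * var_v ^ j)"

definition below :: "nat \<Rightarrow> (nat \<times> nat) set" where
  "below n = {(i, j). i + j < n}"

definition trunc :: "nat \<Rightarrow> series2 \<Rightarrow> series2" where
  "trunc n f = Abs_fps (\<lambda>i. Abs_fps (\<lambda>j. if i + j < n then coeff2 f i j else 0))"

lemma coeff2_mono2: "coeff2 (mono2 (a, b)) i j = (if i = a \<and> j = b then 1 else 0)"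
proof -
  have "var_v ^ b = fps_const (fps_X ^ b)"
    by (simp add: var_v_def fps_const_power)
  then show ?thesis
    by (simp add: mono2_def var_u_def fps_X_power_nth)
qed

lemma mono2_conv [simp]: "mono2 p \<in> conv_series"
  by (cases p) (auto simp: mono2_def intro!: conv_series_intros)

lemma inj_mono2: "inj mono2"
proof (rule injI)
  fix p q assume "mono2 p = mono2 q"
  moreover obtain a b where "p = (a, b)" by force
  moreover obtain c d where "q = (c, d)" by force
  ultimately show "p = q"
    using coeff2_mono2[of a b a b] coeff2_mono2[of c d a b] by (simp split: if_splits)
qed

lemma finite_below [simp]: "finite (below n)"
  by (rule finite_subset[of _ "{..n} \<times> {..n}"]) (auto simp: below_def)

lemma card_below_Suc: "card (below (Suc n)) = card (below n) + Suc n"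
proof -
  have "below (Suc n) = below n \<union> (\<lambda>i. (i, n - i)) ` {..n}"
    by (force simp: below_def image_iff)
  moreover have "below n \<inter> (\<lambda>i. (i, n - i)) ` {..n} = {}"
    by (auto simp: below_def)
  moreover have "card ((\<lambda>i. (i, n - i)) ` {..n}) = Suc n"
    by (subst card_image) (auto simp: inj_on_def)
  ultimately show ?thesis by (simp add: card_Un_disjoint)
qed

text \<open>This is where the product of the orders comes from: the triangle of size
  \<open>s + t\<close> splits into triangles of sizes \<open>s\<close> and \<open>t\<close> and an
  \<open>s\<close> by \<open>t\<close> rectangle.\<close>

lemma card_below_add: "card (below (s + t)) = card (below s) + card (below t) + s * t"
proof (induction t)
  case 0
  then show ?case by (simp add: below_def)
next
  case (Suc t)
  then show ?case by (simp add: card_below_Suc)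
qed

lemma coeff2_lincomb_mono2:
  assumes "finite A"
  shows "coeff2 (\<Sum>p\<in>A. const2 (c p) * mono2 p) i j = (if (i, j) \<in> A then c (i, j) else 0)"
proof -
  have "coeff2 (\<Sum>p\<in>A. const2 (c p) * mono2 p) i j = (\<Sum>p\<in>A. if p = (i, j) then c p else 0)"
    unfolding coeff2_sum coeff2_const2_mult
    by (intro sum.cong refl) (auto simp: coeff2_mono2 split: prod.splits if_splits)
  with assms show ?thesis by simp
qed

lemma trunc_eq_lincomb: "trunc n f = (\<Sum>p\<in>below n. const2 (coeff2 f (fst p) (snd p)) * mono2 p)"
  by (rule series2_eqI) (simp add: coeff2_lincomb_mono2, simp add: trunc_def below_def)

lemma trunc_conv [simp]: "trunc n f \<in> conv_series"
  unfolding trunc_eq_lincomb by (intro conv_series_intros mono2_conv)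

lemma coeff2_trunc: "coeff2 (trunc n f) i j = (if i + j < n then coeff2 f i j else 0)"
  by (simp add: trunc_def)

lemma trunc_add: "trunc n (f + g) = trunc n f + trunc n g"
  by (rule series2_eqI) (simp add: coeff2_trunc)

lemma trunc_const2_mult: "trunc n (const2 c * f) = const2 c * trunc n f"
  by (rule series2_eqI) (simp add: coeff2_trunc)

lemma trunc_sum: "trunc n (sum f A) = (\<Sum>a\<in>A. trunc n (f a))"
  by (rule series2_eqI) (simp add: coeff2_trunc coeff2_sum)

lemma trunc_eq_0_iff: "trunc n f = 0 \<longleftrightarrow> order_ge n f"
proof
  assume *: "trunc n f = 0"
  show "order_ge n f"
    unfolding order_ge_def using * coeff2_trunc[of n f] by (metis fps_zero_nth)
qed (auto intro!: series2_eqI simp: coeff2_trunc order_ge_def)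

lemma order_ge_diff_trunc: "order_ge n (f - trunc n f)"
  by (auto simp: order_ge_def coeff2_trunc)

lemma trunc_cong: "order_ge n (f - g) \<Longrightarrow> trunc n f = trunc n g"
  by (rule series2_eqI) (simp add: coeff2_trunc order_ge_def)

lemma trunc_mono2: "p \<in> below n \<Longrightarrow> trunc n (mono2 p) = mono2 p"
  by (cases p, rule series2_eqI) (auto simp: coeff2_trunc coeff2_mono2 below_def)

lemma independent_mono2: "finite A \<Longrightarrow> series.independent (mono2 ` A)"
proof -
  assume fin: "finite A"
  have "u p = 0" if "(\<Sum>x\<in>mono2 ` A. const2 (u x) * x) = 0" "x \<in> mono2 ` A" "p = x" for u x p
  proof -
    from that obtain i j where ij: "(i, j) \<in> A" "x = mono2 (i, j)" by force
    have "(\<Sum>p\<in>A. const2 (u (mono2 p)) * mono2 p) = 0"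
      using that(1) inj_on_subset[OF inj_mono2] by (simp add: sum.reindex)
    then have "coeff2 (\<Sum>p\<in>A. const2 (u (mono2 p)) * mono2 p) i j = 0" by simp
    with fin ij that show ?thesis by (simp add: coeff2_lincomb_mono2)
  qed
  with fin show ?thesis by (subst series.dependent_finite) auto
qed

lemma trunc_in_span: "trunc n f \<in> series.span (mono2 ` below n)"
  unfolding trunc_eq_lincomb
  by (intro series.span_sum series.span_scale series.span_base imageI)

text \<open>A combination of monomials of degree less than \<open>n\<close> is its own truncation,
  so if it lies in \<open>W\<close>, it lies in the span of \<open>S\<close>. Monomials that span a
  complement of \<open>S\<close> are therefore independent modulo \<open>W\<close>.\<close>

lemma codim_ge:
  assumes "trunc n ` W \<subseteq> series.span S" "finite S"
  shows "enat (card (below n) - card S) \<le> codim W"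
proof -
  have inj: "inj_on mono2 A" for A using inj_mono2 inj_on_subset by blast
  obtain B where B: "B \<subseteq> mono2 ` below n" "card (mono2 ` below n) \<le> card B + card S"
    "\<And>c. (\<Sum>b\<in>B. const2 (c b) * b) \<in> series.span S \<Longrightarrow> \<forall>b\<in>B. c b = 0"
    using series.complement_in[OF assms(2) _ independent_mono2[OF finite_below[of n]]] by auto
  have "finite B" by (rule finite_subset[OF B(1)]) simp
  moreover have "B \<subseteq> conv_series" using B(1) by auto
  moreover have "independent_mod W B"
    unfolding independent_mod_def
  proof (intro allI impI)
    fix c assume "(\<Sum>b\<in>B. const2 (c b) * b) \<in> W"
    then have "trunc n (\<Sum>b\<in>B. const2 (c b) * b) \<in> series.span S" using assms(1) by blast
    also have "trunc n (\<Sum>b\<in>B. const2 (c b) * b) = (\<Sum>b\<in>B. const2 (c b) * b)"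
      unfolding trunc_sum trunc_const2_mult using B(1) trunc_mono2
      by (intro sum.cong refl) auto
    finally show "\<forall>b\<in>B. c b = 0" by (rule B(3))
  qed
  ultimately have "enat (card B) \<le> codim W"
    unfolding codim_def by (intro SUP_upper) auto
  moreover have "card (below n) - card S \<le> card B"
    using B(2) card_image[OF inj] by simp
  ultimately show ?thesis using order_trans by (metis enat_ord_simps(1))
qed

text \<open>A binary form of degree \<open>n - 1\<close>, dehomogenized. Stated through coefficients
  and not through the degree, the condition forces \<open>p = 0\<close> for \<open>n = 0\<close>,
  which is what the dimension count needs.\<close>

definition forms_below :: "nat \<Rightarrow> complex poly \<Rightarrow> bool" where
  "forms_below n p \<longleftrightarrow> (\<forall>i\<ge>n. coeff p i = 0)"

text \<open>Injectivity of the Sylvester map of two forms of degrees \<open>s\<close> and \<open>t\<close>.\<close>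

definition coprime_forms :: "nat \<Rightarrow> nat \<Rightarrow> complex poly \<Rightarrow> complex poly \<Rightarrow> bool" where
  "coprime_forms s t A B \<longleftrightarrow>
     (\<forall>a b. forms_below t a \<and> forms_below s b \<and> A * a + B * b = 0 \<longrightarrow> a = 0 \<and> b = 0)"

text \<open>The left summand of the index set multiplies \<open>f\<close>, the right one
  \<open>g\<close>. The vectors are kept as a family, so that coinciding truncations are still seen
  as a linear relation.\<close>

definition multiples :: "nat \<Rightarrow> nat \<Rightarrow> series2 \<Rightarrow> series2 \<Rightarrow> (nat \<times> nat) + (nat \<times> nat) \<Rightarrow> series2" where
  "multiples s t f g = case_sum (\<lambda>p. trunc (s + t) (mono2 p * f)) (\<lambda>p. trunc (s + t) (mono2 p * g))"

abbreviation mult_index :: "nat \<Rightarrow> nat \<Rightarrow> ((nat \<times> nat) + (nat \<times> nat)) set" where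
  "mult_index s t \<equiv> below t <+> below s"

lemma trunc_lincomb_mult:
  "trunc n (trunc m a * f) = (\<Sum>p\<in>below m. const2 (coeff2 a (fst p) (snd p)) * trunc n (mono2 p * f))"
  unfolding trunc_eq_lincomb[of m] sum_distrib_right trunc_sum
  by (simp add: mult.assoc trunc_const2_mult)

text \<open>As \<open>f\<close> has order \<open>s\<close>, its coefficient in the ideal matters
  only modulo order \<open>t\<close>; likewise that of \<open>g\<close> only modulo order
  \<open>s\<close>. So the polynomial multiples suffice.\<close>

lemma trunc_germ_ideal:
  assumes "order_ge s f" "order_ge t g"
  shows "trunc (s + t) ` germ_ideal f g \<subseteq> series.span (multiples s t f g ` mult_index s t)"
proof
  fix x assume "x \<in> trunc (s + t) ` germ_ideal f g"
  then obtain a b where x: "x = trunc (s + t) (a * f + b * g)"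
    by (auto simp: germ_ideal_def)
  have "order_ge (t + s) ((a - trunc t a) * f)" "order_ge (s + t) ((b - trunc s b) * g)"
    using assms by (intro order_ge_mult order_ge_diff_trunc; simp)+
  then have "order_ge (s + t) ((a - trunc t a) * f + (b - trunc s b) * g)"
    by (intro order_ge_add) (simp_all add: add.commute)
  then have "order_ge (s + t) ((a * f + b * g) - (trunc t a * f + trunc s b * g))"
    by (simp add: algebra_simps)
  then have "x = trunc (s + t) (trunc t a * f) + trunc (s + t) (trunc s b * g)"
    unfolding x trunc_add[symmetric] by (rule trunc_cong)
  also have "\<dots> \<in> series.span (multiples s t f g ` mult_index s t)"
    unfolding trunc_lincomb_mult
  proof (intro series.span_add series.span_sum series.span_scale series.span_base)
    show "trunc (s + t) (mono2 p * f) \<in> multiples s t f g ` mult_index s t" if "p \<in> below t" for p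
      using that by (intro image_eqI[of _ _ "Inl p"]) (auto simp: multiples_def)
    show "trunc (s + t) (mono2 p * g) \<in> multiples s t f g ` mult_index s t" if "p \<in> below s" for p
      using that by (intro image_eqI[of _ _ "Inr p"]) (auto simp: multiples_def)
  qed
  finally show "x \<in> series.span (multiples s t f g ` mult_index s t)" .
qed

lemma card_mult_index: "card (below (s + t)) = card (mult_index s t) + s * t"
  by (simp add: card_below_add card_Plus)

lemma int_mult_ge:
  assumes "order_ge s f" "order_ge t g"
  shows "enat (s * t) \<le> germ_int_mult f g"
proof -
  have "card (multiples s t f g ` mult_index s t) \<le> card (mult_index s t)"
    by (rule card_image_le) simp
  then have "s * t \<le> card (below (s + t)) - card (multiples s t f g ` mult_index s t)"
    using card_mult_index[of s t] by linarith
  then show ?thesis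
    unfolding germ_int_mult_def
    using codim_ge[OF trunc_germ_ideal[OF assms]] order_trans by (metis enat_ord_simps(1) finite_Plus finite_below finite_imageI)
qed

lemma form_series:
  assumes "forms_below n p"
  obtains f where "f \<in> conv_series" "f = trunc n f" "\<And>m. blow f $ m = (if Suc m = n then p else 0)"
proof -
  have "degree ((fps_const p * fps_X ^ (n - 1)) $ m) \<le> m" for m
    using assms by (auto simp: forms_below_def fps_X_power_nth intro!: degree_le)
  then obtain f where f: "blow f = fps_const p * fps_X ^ (n - 1)"
    using blow_surj[of "fps_const p * fps_X ^ (n - 1)"] by blast
  \<comment> \<open>For \<open>n = 0\<close> the exponent \<open>n - 1\<close> above is truncated to
    0; this is harmless since then \<open>p\<close> vanishes.\<close>
  have p0: "n = 0 \<Longrightarrow> p = 0"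
    using assms by (auto simp: forms_below_def poly_eq_iff)
  have b: "blow f $ m = (if Suc m = n then p else 0)" for m
    using p0 by (cases n) (auto simp: f)
  have "coeff2 f i j = 0" if "i + j \<ge> n" for i j
    using that b[of "i + j"] by (simp only: coeff2_eq_coeff_blow) simp
  then have "f = trunc n f" by (intro series2_eqI) (simp add: coeff2_trunc)
  then show ?thesis using that b trunc_conv[of n f] by metis
qed

text \<open>A common factor of the leading forms yields a linear relation between the truncated multiples,
  which raises the codimension by one.\<close>

lemma int_mult_gt:
  assumes "order_ge s f" "order_ge t g" "\<not> coprime_forms s t (blow f $ s) (blow g $ t)"
  shows "enat (s * t + 1) \<le> germ_int_mult f g"
proof -
  obtain a b where ab: "forms_below t a" "forms_below s b" "blow f $ s * a + blow g $ t * b = 0"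
    "a \<noteq> 0 \<or> b \<noteq> 0"
    using assms(3) by (auto simp: coprime_forms_def)
  obtain \<alpha> where \<alpha>: "\<alpha> = trunc t \<alpha>" "\<And>m. blow \<alpha> $ m = (if Suc m = t then a else 0)"
    using form_series[OF ab(1)] by metis
  obtain \<beta> where \<beta>: "\<beta> = trunc s \<beta>" "\<And>m. blow \<beta> $ m = (if Suc m = s then b else 0)"
    using form_series[OF ab(2)] by metis
  have f0: "blow f $ m = 0" if "m < s" for m using that assms(1) by (simp add: order_ge_iff_blow)
  have g0: "blow g $ m = 0" if "m < t" for m using that assms(2) by (simp add: order_ge_iff_blow)
  \<comment> \<open>Here \<open>\<alpha>\<close> and \<open>\<beta>\<close> are homogeneous of
    degrees \<open>t - 1\<close> and \<open>s - 1\<close>. Below degree \<open>s + t - 1\<close>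
    both products vanish by the orders of \<open>f\<close> and \<open>g\<close>, and in that degree
    they cancel by the relation between \<open>a\<close> and \<open>b\<close>.\<close>
  have "order_ge (s + t) (\<alpha> * f + \<beta> * g)"
    unfolding order_ge_iff_blow
  proof (intro allI impI)
    fix m assume m: "m < s + t"
    have "(blow \<alpha> * blow f) $ m = (if Suc m = s + t then blow f $ s * a else 0)"
    proof -
      have "(blow \<alpha> * blow f) $ m = (\<Sum>i=0..m. if i = t - 1 \<and> t > 0 then a * blow f $ (m - i) else 0)"
        unfolding fps_mult_nth by (intro sum.cong) (auto simp: \<alpha>(2))
      also have "\<dots> = (if Suc m = s + t then blow f $ s * a else 0)"
      proof (cases "t > 0")
        case True
        then show ?thesis using m by (auto simp: sum.delta f0 mult.commute)
      next
        case False
        then have "a = 0" using ab(1) by (auto simp: forms_below_def poly_eq_iff)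
        then show ?thesis by (auto intro!: sum.neutral)
      qed
      finally show ?thesis .
    qed
    moreover have "(blow \<beta> * blow g) $ m = (if Suc m = s + t then blow g $ t * b else 0)"
    proof -
      have "(blow \<beta> * blow g) $ m = (\<Sum>i=0..m. if i = s - 1 \<and> s > 0 then b * blow g $ (m - i) else 0)"
        unfolding fps_mult_nth by (intro sum.cong) (auto simp: \<beta>(2))
      also have "\<dots> = (if Suc m = s + t then blow g $ t * b else 0)"
      proof (cases "s > 0")
        case True
        then show ?thesis using m by (auto simp: sum.delta g0 mult.commute)
      next
        case False
        then have "b = 0" using ab(2) by (auto simp: forms_below_def poly_eq_iff)
        then show ?thesis by (auto intro!: sum.neutral)
      qed
      finally show ?thesis .
    qed
    ultimately show "blow (\<alpha> * f + \<beta> * g) $ m = 0"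
      using ab(3) by (simp add: blow.hom_simps)
  qed
  then have "trunc (s + t) (trunc t \<alpha> * f) + trunc (s + t) (trunc s \<beta> * g) = 0"
    using \<alpha>(1) \<beta>(1) by (metis trunc_add trunc_eq_0_iff)
  then have rel: "(\<Sum>i\<in>mult_index s t. const2 (case_sum (\<lambda>p. coeff2 \<alpha> (fst p) (snd p))
      (\<lambda>p. coeff2 \<beta> (fst p) (snd p)) i) * multiples s t f g i) = 0"
    by (simp add: trunc_lincomb_mult sum.Plus multiples_def)
  define c where "c = case_sum (\<lambda>p. coeff2 \<alpha> (fst p) (snd p)) (\<lambda>p. coeff2 \<beta> (fst p) (snd p))"
  have "\<exists>i\<in>mult_index s t. c i \<noteq> 0"
  proof (rule ccontr)
    assume "\<not> (\<exists>i\<in>mult_index s t. c i \<noteq> 0)"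
    then have *: "\<forall>i\<in>mult_index s t. c i = 0" by simp
    have "c (Inl p) = 0" if "p \<in> below t" for p
      by (rule bspec[OF * InlI[OF that]])
    then have "coeff2 \<alpha> (fst p) (snd p) = 0" if "p \<in> below t" for p
      using that by (simp add: c_def)
    moreover have "c (Inr p) = 0" if "p \<in> below s" for p
      by (rule bspec[OF * InrI[OF that]])
    then have "coeff2 \<beta> (fst p) (snd p) = 0" if "p \<in> below s" for p
      using that by (simp add: c_def)
    ultimately have "\<alpha> = 0" "\<beta> = 0"
      using \<alpha>(1) \<beta>(1) trunc_eq_lincomb[of t \<alpha>] trunc_eq_lincomb[of s \<beta>] by (simp_all add: const2.hom_zero)
    then have "blow \<alpha> $ (t - 1) = 0" "blow \<beta> $ (s - 1) = 0" by (simp_all add: blow.hom_zero)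
    moreover have "t = 0 \<Longrightarrow> a = 0" "s = 0 \<Longrightarrow> b = 0"
      using ab(1,2) by (auto simp: forms_below_def poly_eq_iff)
    ultimately have "a = 0" "b = 0" using \<alpha>(2) \<beta>(2) by (auto split: if_splits)
    with ab(4) show False by simp
  qed
  then obtain i where i: "i \<in> mult_index s t" "c i \<noteq> 0" by blast
  define J where "J = mult_index s t - {i}"
  let ?v = "multiples s t f g"
  have "const2 (c i) * ?v i + (\<Sum>j\<in>J. const2 (c j) * ?v j) = 0"
    using rel i(1) unfolding c_def[symmetric] J_def by (subst (asm) sum.remove[of _ i]) auto
  then have neg: "const2 (c i) * ?v i = - (\<Sum>j\<in>J. const2 (c j) * ?v j)"
    by (simp only: eq_neg_iff_add_eq_0)
  have "?v i = const2 (inverse (c i)) * (const2 (c i) * ?v i)"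
    using i(2) by (simp add: const2.hom_one)
  also have "\<dots> = const2 (inverse (c i)) * - (\<Sum>j\<in>J. const2 (c j) * ?v j)"
    by (simp only: neg)
  also have "\<dots> \<in> series.span (?v ` J)"
    by (intro series.span_scale series.span_neg series.span_sum series.span_base imageI)
  finally have vi: "?v i \<in> series.span (?v ` J)" .
  have "?v ` mult_index s t \<subseteq> series.span (?v ` J)"
  proof (rule image_subsetI)
    fix j assume j: "j \<in> mult_index s t"
    show "?v j \<in> series.span (?v ` J)"
    proof (cases "j = i")
      case False
      with j have "j \<in> J" by (simp add: J_def)
      then show ?thesis by (intro series.span_base imageI)
    qed (simp only: vi)
  qed
  then have "series.span (?v ` mult_index s t) \<subseteq> series.span (?v ` J)"
    by (intro series.span_minimal series.subspace_span)
  then have "trunc (s + t) ` germ_ideal f g \<subseteq> series.span (?v ` J)"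
    using trunc_germ_ideal[OF assms(1,2)] by blast
  moreover have fin: "finite (?v ` J)" by (simp add: J_def)
  ultimately have "enat (card (below (s + t)) - card (?v ` J)) \<le> germ_int_mult f g"
    unfolding germ_int_mult_def by (rule codim_ge)
  moreover have "s * t + 1 \<le> card (below (s + t)) - card (?v ` J)"
  proof -
    have "card (?v ` J) \<le> card J" by (rule card_image_le) (simp add: J_def)
    moreover have "card (mult_index s t) = Suc (card J)"
      unfolding J_def using i(1) by (subst card_Suc_Diff1) auto
    ultimately show ?thesis using card_mult_index[of s t] by linarith
  qed
  ultimately show ?thesis using order_trans by (metis enat_ord_simps(1))
qed

section \<open>Division by coprime forms\<close>

text \<open>The Sylvester map is injective between spaces of dimension \<open>s + t\<close>, hence
  surjective. Concretely, \<open>p\<close> and the \<open>s + t\<close> shifted copies of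
  \<open>A\<close> and \<open>B\<close> are one vector too many, and injectivity prevents the
  coefficient of \<open>p\<close> in the resulting relation from being 0.\<close>

lemma coprime_forms_bezout:
  assumes "coprime_forms s t A B" "degree A \<le> s" "degree B \<le> t" "forms_below (s + t) p"
  obtains a b where "forms_below t a" "forms_below s b" "A * a + B * b = p"
proof -
  define I where "I = insert None (Some ` ({..<t} <+> {..<s}))"
  define v where "v = case_option p (case_sum (\<lambda>i. A * monom 1 i) (\<lambda>i. B * monom 1 i))"
  have inspan: "q \<in> cpoly.span (monom 1 ` {..<s + t})" if "forms_below (s + t) q" for q
  proof -
    have "q = (\<Sum>i<s + t. smult (coeff q i) (monom 1 i))"
      using that by (intro poly_eqI) (auto simp: coeff_sum forms_below_def smult_monom not_less)
    also have "\<dots> \<in> cpoly.span (monom 1 ` {..<s + t})"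
      by (intro cpoly.span_sum cpoly.span_scale cpoly.span_base imageI)
    finally show ?thesis .
  qed
  have fb: "forms_below (s + t) (q * monom 1 i)" if "degree q + i < s + t" for q :: "complex poly" and i
    unfolding forms_below_def
  proof (intro allI impI coeff_eq_0)
    fix j assume "s + t \<le> j"
    moreover have "degree (q * monom 1 i) \<le> degree q + i"
      using degree_mult_le[of q "monom 1 i"] degree_monom_le[of "1::complex" i] by linarith
    ultimately show "degree (q * monom 1 i) < j" using that by linarith
  qed
  have "v i \<in> cpoly.span (monom 1 ` {..<s + t})" if "i \<in> I" for i
  proof (cases i)
    case None
    then show ?thesis using assms(4) by (simp add: v_def inspan)
  next
    case (Some k)
    then show ?thesis using that assms(2,3)
      by (cases k) (auto simp: I_def v_def intro!: inspan fb)
  qed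
  moreover have "card (monom (1::complex) ` {..<s + t}) < card I"
  proof -
    have "card (monom (1::complex) ` {..<s + t}) \<le> card {..<s + t}" by (rule card_image_le) simp
    moreover have "card I = Suc (t + s)"
      by (simp add: I_def card_image card_Plus)
    ultimately show ?thesis by simp
  qed
  moreover have "finite I" by (simp add: I_def)
  ultimately obtain c where c: "(\<Sum>i\<in>I. smult (c i) (v i)) = 0" "\<exists>i\<in>I. c i \<noteq> 0"
    using cpoly.family_dependent[of I "monom 1 ` {..<s + t}" v] by auto
  define a where "a = (\<Sum>i<t. monom (c (Some (Inl i))) i)"
  define b where "b = (\<Sum>i<s. monom (c (Some (Inr i))) i)"
  have ca: "coeff a i = (if i < t then c (Some (Inl i)) else 0)" for i
    by (simp add: a_def coeff_sum)
  have cb: "coeff b i = (if i < s then c (Some (Inr i)) else 0)" for i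
    by (simp add: b_def coeff_sum)
  have fab: "forms_below t a" "forms_below s b"
    by (simp_all add: forms_below_def ca cb)
  have m: "smult c (q * monom 1 i) = q * monom c i" for c :: complex and q i
    by (simp flip: mult_smult_right add: smult_monom)
  have "(\<Sum>i\<in>I. smult (c i) (v i)) = smult (c None) p + (A * a + B * b)"
    by (simp add: I_def v_def a_def b_def sum.reindex sum.Plus m sum_distrib_left)
  with c(1) have rel: "smult (c None) p + (A * a + B * b) = 0" by simp
  have "c None \<noteq> 0"
  proof
    assume *: "c None = 0"
    with rel have "A * a + B * b = 0" by simp
    then have "a = 0" "b = 0"
      using assms(1)[unfolded coprime_forms_def, rule_format, of a b] fab by auto
    then have "c (Some (Inl i)) = 0" if "i < t" for i using ca[of i] that by simp
    moreover have "c (Some (Inr i)) = 0" if "i < s" for i using cb[of i] that \<open>b = 0\<close> by simp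
    ultimately have "\<forall>i\<in>I. c i = 0" using * by (auto simp: I_def)
    with c(2) show False by simp
  qed
  show ?thesis
  proof (rule that)
    let ?k = "- inverse (c None)"
    show "forms_below t (smult ?k a)" "forms_below s (smult ?k b)"
      using fab by (simp_all add: forms_below_def)
    have "A * smult ?k a + B * smult ?k b = smult ?k (A * a + B * b)"
      by (simp add: smult_add_right)
    also have "A * a + B * b = - smult (c None) p"
      using rel by (simp add: eq_neg_iff_add_eq_0 add.commute)
    also have "smult ?k (- smult (c None) p) = p"
      using \<open>c None \<noteq> 0\<close> by simp
    finally show "A * smult ?k a + B * smult ?k b = p" .
  qed
qed

lemma forms_below_degree: "forms_below n p \<Longrightarrow> p = 0 \<or> degree p < n"
  unfolding forms_below_def by (metis leading_coeff_0_iff not_le)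

text \<open>Only the exponents below \<open>s + t\<close> are solved by Bezout. Every larger
  exponent reuses the solution for \<open>s + t - 1\<close>, multiplied by a monomial; this does not
  increase the \<open>l1\<close> norm, so a single \<open>K\<close> serves all degrees.\<close>

lemma coprime_forms_solve_monom:
  assumes "coprime_forms s t A B" "degree A \<le> s" "degree B \<le> t" "s + t > 0"
  obtains w1 w2 K where
    "\<And>j. A * w1 j + B * w2 j = monom 1 j"
    "\<And>j. degree (w1 j) \<le> t + (j - (s + t))" "\<And>j. degree (w2 j) \<le> s + (j - (s + t))"
    "\<And>j. l1 (w1 j) \<le> K" "\<And>j. l1 (w2 j) \<le> K"
proof -
  have "\<exists>a b. forms_below t a \<and> forms_below s b \<and> A * a + B * b = monom 1 j" if "j < s + t" for j
  proof -
    have "forms_below (s + t) (monom (1::complex) j)"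
      using that by (auto simp: forms_below_def)
    from coprime_forms_bezout[OF assms(1-3) this] show ?thesis by metis
  qed
  then obtain a b where ab: "\<And>j. j < s + t \<Longrightarrow> forms_below t (a j)"
    "\<And>j. j < s + t \<Longrightarrow> forms_below s (b j)" "\<And>j. j < s + t \<Longrightarrow> A * a j + B * b j = monom 1 j"
    by metis
  define q where "q = s + t - 1"
  have qlt: "min j q < s + t" for j using assms(4) unfolding q_def by linarith
  define K where "K = (\<Sum>j<s + t. l1 (a j) + l1 (b j))"
  have K: "l1 (a j) + l1 (b j) \<le> K" if "j < s + t" for j
    unfolding K_def using that by (intro member_le_sum) auto
  define w1 where "w1 j = monom 1 (j - q) * a (min j q)" for j
  define w2 where "w2 j = monom 1 (j - q) * b (min j q)" for j
  have l1m: "l1 (monom 1 n * p) \<le> l1 p" for n p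
    using l1_mult[of "monom 1 n" p] by simp
  have deg: "degree (monom 1 (j - q) * p) \<le> n + (j - (s + t))"
    if "forms_below n p" for n p j
  proof (cases "p = 0")
    case False
    then have "degree p < n" using forms_below_degree[OF that] by simp
    moreover have "degree (monom 1 (j - q) * p) \<le> (j - q) + degree p"
      using degree_mult_le[of "monom 1 (j - q)" p] degree_monom_le[of "1::complex" "j - q"] by linarith
    ultimately show ?thesis unfolding q_def by linarith
  qed simp
  show ?thesis
  proof (rule that)
    fix j
    have "A * w1 j + B * w2 j = monom 1 (j - q) * (A * a (min j q) + B * b (min j q))"
      by (simp add: w1_def w2_def algebra_simps)
    also have "\<dots> = monom 1 j"
    proof -
      have "j - q + min j q = j" by linarith
      then show ?thesis by (simp add: ab(3)[OF qlt] mult_monom)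
    qed
    finally show "A * w1 j + B * w2 j = monom 1 j" .
    show "degree (w1 j) \<le> t + (j - (s + t))"
      unfolding w1_def by (rule deg[OF ab(1)[OF qlt]])
    show "degree (w2 j) \<le> s + (j - (s + t))"
      unfolding w2_def by (rule deg[OF ab(2)[OF qlt]])
    show "l1 (w1 j) \<le> K"
      using K[OF qlt, of j] l1m[of "j - q" "a (min j q)"] l1_nonneg[of "b (min j q)"] unfolding w1_def by linarith
    show "l1 (w2 j) \<le> K"
      using K[OF qlt, of j] l1m[of "j - q" "b (min j q)"] l1_nonneg[of "a (min j q)"] unfolding w2_def by linarith
  qed
qed

text \<open>Extending the monomial solutions linearly preserves the constant \<open>K\<close>,
  because \<open>l1\<close> is the sum of the norms of the coefficients. The result is a pair of
  division operators bounded uniformly in the degree.\<close>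

lemma coprime_forms_solve:
  assumes "coprime_forms s t A B" "degree A \<le> s" "degree B \<le> t" "s + t > 0"
  obtains S1 S2 K where
    "\<And>p. A * S1 p + B * S2 p = p"
    "\<And>p m. degree p \<le> s + t + m \<Longrightarrow> degree (S1 p) \<le> t + m"
    "\<And>p m. degree p \<le> s + t + m \<Longrightarrow> degree (S2 p) \<le> s + m"
    "\<And>p. l1 (S1 p) \<le> K * l1 p" "\<And>p. l1 (S2 p) \<le> K * l1 p" "K \<ge> 0"
proof -
  obtain w1 w2 K where w: "\<And>j. A * w1 j + B * w2 j = monom 1 j"
    "\<And>j. degree (w1 j) \<le> t + (j - (s + t))" "\<And>j. degree (w2 j) \<le> s + (j - (s + t))"
    "\<And>j. l1 (w1 j) \<le> K" "\<And>j. l1 (w2 j) \<le> K"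
    using coprime_forms_solve_monom[OF assms] by metis
  define S where "S w p = (\<Sum>j\<le>degree p. smult (coeff p j) (w j))"
    for w :: "nat \<Rightarrow> complex poly" and p
  have deg: "degree (S w p) \<le> n + m"
    if "\<And>j. degree (w j) \<le> n + (j - (s + t))" "degree p \<le> s + t + m" for w p n m
    unfolding S_def
  proof (intro degree_sum_le finite_atMost)
    fix j assume "j \<in> {..degree p}"
    then have "degree (w j) \<le> n + m" using that(1)[of j] that(2) by simp
    then show "degree (smult (coeff p j) (w j)) \<le> n + m"
      using degree_smult_le[of "coeff p j" "w j"] by linarith
  qed
  have norm: "l1 (S w p) \<le> K * l1 p" if "\<And>j. l1 (w j) \<le> K" for w p
  proof -
    have "l1 (S w p) \<le> (\<Sum>j\<le>degree p. norm (coeff p j) * l1 (w j))"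
      unfolding S_def using l1_sum[of "\<lambda>j. smult (coeff p j) (w j)" "{..degree p}"] by simp
    also have "\<dots> \<le> (\<Sum>j\<le>degree p. norm (coeff p j) * K)"
      using that by (intro sum_mono mult_left_mono) auto
    also have "\<dots> = K * (\<Sum>j\<le>degree p. norm (coeff p j))"
      by (simp add: sum_distrib_left mult.commute)
    also have "(\<Sum>j\<le>degree p. norm (coeff p j)) = l1 p"
    proof (cases "p = 0")
      case False
      then show ?thesis
        by (simp add: l1_def coeffs_def comp_def sum_set_upt_conv_sum_list_nat[symmetric] atLeast0LessThan lessThan_Suc_atMost del: upt_Suc)
    qed simp
    finally show ?thesis .
  qed
  have "A * S w1 p + B * S w2 p = p" for p
  proof -
    have "A * S w1 p + B * S w2 p = (\<Sum>j\<le>degree p. smult (coeff p j) (A * w1 j + B * w2 j))"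
      by (simp add: S_def sum_distrib_left smult_add_right sum.distrib)
    also have "\<dots> = p"
      unfolding w(1) by (simp add: smult_monom poly_as_sum_of_monoms)
    finally show ?thesis .
  qed
  moreover have "K \<ge> 0" using w(4)[of 0] l1_nonneg order_trans by blast
  ultimately show ?thesis
    using w deg[of w1 t] deg[of w2 s] norm[of w1] norm[of w2] by (intro that[of "S w1" "S w2" K]) auto
qed

context
  fixes f g F :: "complex poly fps" and S1 S2 :: "complex poly \<Rightarrow> complex poly" and e :: nat
begin

text \<open>In degree \<open>m\<close> the equation \<open>f * a + g * b + e * X * a * b = F\<close>
  prescribes \<open>f $ 0 * a $ m + g $ 0 * b $ m\<close> in terms of earlier coefficients, and
  \<open>rhs m\<close> is that prescribed value; the unknowns are read off as
  \<open>S1 (rhs m)\<close> and \<open>S2 (rhs m)\<close>. The index \<open>m - 1 - i\<close> is due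
  to the factor \<open>X\<close> of the quadratic term.\<close>

fun rhs :: "nat \<Rightarrow> complex poly" where
  "rhs m = F $ m - (\<Sum>i<m. f $ (m - i) * S1 (rhs i) + g $ (m - i) * S2 (rhs i))
             - of_nat e * (\<Sum>i<m. S1 (rhs i) * S2 (rhs (m - 1 - i)))"

declare rhs.simps [simp del]

end

lemma sum_triangle_le:
  fixes x y :: "nat \<Rightarrow> real"
  assumes "\<And>i. x i \<ge> 0" "\<And>i. y i \<ge> 0"
  shows "(\<Sum>m\<le>n. \<Sum>i\<le>m. x i * y (m - i)) \<le> (\<Sum>i\<le>n. x i) * (\<Sum>i\<le>n. y i)"
proof -
  have "(\<Sum>m\<le>n. \<Sum>i\<le>m. x i * y (m - i)) = (\<Sum>(m,i)\<in>Sigma {..n} (\<lambda>m. {..m}). x i * y (m - i))"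
    by (simp add: sum.Sigma)
  also have "\<dots> = (\<Sum>(i,j)\<in>{(i,j). i + j \<le> n}. x i * y j)"
    by (rule sum.reindex_bij_witness[where i = "\<lambda>(i,j). (i + j, i)" and j = "\<lambda>(m,i). (i, m - i)"]) auto
  also have "\<dots> \<le> (\<Sum>(i,j)\<in>{..n} \<times> {..n}. x i * y j)"
    using assms by (intro sum_mono2) auto
  also have "\<dots> = (\<Sum>i\<le>n. x i) * (\<Sum>i\<le>n. y i)"
    by (simp add: sum_product sum.cartesian_product)
  finally show ?thesis .
qed

text \<open>The partial sums \<open>X n = \<Sum>m\<le>n. c m * r ^ m\<close> satisfy
  \<open>X (n + 1) \<le> 2 M + r (2 N R X n + Q X n\<^sup>2)\<close>, so for small \<open>r\<close> they never exceed \<open>2 M + 1\<close>.\<close>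

lemma quadratic_majorant:
  fixes c :: "nat \<Rightarrow> real"
  assumes nn: "\<And>m. c m \<ge> 0" "M \<ge> 0" "N \<ge> 0" "R \<ge> 1" "Q \<ge> 0"
    and rec: "\<And>m. c m \<le> M * R ^ m + N * (\<Sum>i<m. R ^ (m - i) * c i) + Q * (\<Sum>i<m. c i * c (m - 1 - i))"
  obtains Y R' where "R' \<ge> 1" "\<And>m. c m \<le> Y * R' ^ m"
proof -
  define Y where "Y = 2 * M + 1"
  \<comment> \<open>The summand \<open>2 * R\<close> gives \<open>R * r \<le> 1 / 2\<close>, so that
    the geometric sums stay below 2; the other summand makes the contribution of the recursive terms
    at most 1, which is the slack in \<open>Y = 2 * M + 1\<close>.\<close>
  define D where "D = 2 * R + (2 * N * R + Q * Y) * Y"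
  define r where "r = 1 / D"
  have Y: "Y \<ge> 1" using nn by (simp add: Y_def)
  have pos: "(2 * N * R + Q * Y) * Y \<ge> 0"
    using nn Y by simp
  then have DR: "D \<ge> 2 * R" "D \<ge> (2 * N * R + Q * Y) * Y" "D \<ge> 2"
    using nn(4) unfolding D_def by linarith+
  then have r: "r > 0" "R * r \<le> 1 / 2" "r * ((2 * N * R + Q * Y) * Y) \<le> 1"
    using nn(4) by (auto simp: r_def field_simps)
  have geo: "(\<Sum>m\<le>n. (R * r) ^ m) \<le> 2" for n
  proof -
    have "(\<Sum>m\<le>n. (R * r) ^ m) \<le> (\<Sum>m\<le>n. (1 / 2) ^ m)"
      using r nn by (intro sum_mono power_mono) auto
    also have "\<dots> \<le> (\<Sum>m. (1 / 2) ^ m)"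
      by (intro sum_le_suminf) (auto intro: summable_geometric)
    also have "\<dots> = 2" by (subst suminf_geometric) auto
    finally show ?thesis .
  qed
  define x where "x i = c i * r ^ i" for i
  have x0: "x i \<ge> 0" for i using nn r by (simp add: x_def)
  have X: "(\<Sum>m\<le>n. x m) \<le> Y" for n
  proof (induction n)
    case 0
    then show ?case using rec[of 0] nn(2) by (simp add: x_def Y_def)
  next
    case (Suc n)
    let ?X = "\<Sum>m\<le>n. x m"
    have X0: "?X \<ge> 0" by (intro sum_nonneg x0)
    \<comment> \<open>The inner sums are empty for \<open>m = 0\<close>. Shifting \<open>m\<close>
      releases the factor \<open>r\<close> that keeps the recursive terms small.\<close>
    have split: "(\<Sum>m\<le>Suc n. \<Sum>i<m. h m i) = (\<Sum>m\<le>n. \<Sum>i\<le>m. h (Suc m) i)" for h :: "nat \<Rightarrow> nat \<Rightarrow> real"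
      unfolding sum.atMost_Suc_shift by (simp add: lessThan_Suc_atMost)
    have "(\<Sum>m\<le>Suc n. x m) \<le> (\<Sum>m\<le>Suc n. (M * R ^ m + N * (\<Sum>i<m. R ^ (m - i) * c i) + Q * (\<Sum>i<m. c i * c (m - 1 - i))) * r ^ m)"
      unfolding x_def using r by (intro sum_mono mult_right_mono rec) auto
    also have "\<dots> = M * (\<Sum>m\<le>Suc n. (R * r) ^ m) + N * (\<Sum>m\<le>Suc n. \<Sum>i<m. R ^ (m - i) * c i * r ^ m)
        + Q * (\<Sum>m\<le>Suc n. \<Sum>i<m. c i * c (m - 1 - i) * r ^ m)"
      by (simp only: sum.distrib sum_distrib_left sum_distrib_right distrib_right distrib_left power_mult_distrib mult.assoc)
    also have "(\<Sum>m\<le>Suc n. \<Sum>i<m. R ^ (m - i) * c i * r ^ m) = R * r * (\<Sum>m\<le>n. \<Sum>i\<le>m. x i * (R * r) ^ (m - i))"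
      unfolding split sum_distrib_left
    proof (intro sum.cong refl)
      fix m i :: nat assume "i \<in> {..m}"
      then have "r ^ m = r ^ i * r ^ (m - i)" "Suc m - i = Suc (m - i)" by (auto simp flip: power_add)
      then show "R ^ (Suc m - i) * c i * r ^ Suc m = R * r * (x i * (R * r) ^ (m - i))"
        by (simp add: x_def power_mult_distrib)
    qed
    also have "(\<Sum>m\<le>Suc n. \<Sum>i<m. c i * c (m - 1 - i) * r ^ m) = r * (\<Sum>m\<le>n. \<Sum>i\<le>m. x i * x (m - i))"
      unfolding split sum_distrib_left
    proof (intro sum.cong refl)
      fix m i :: nat assume "i \<in> {..m}"
      then have "r ^ m = r ^ i * r ^ (m - i)" by (auto simp flip: power_add)
      then show "c i * c (Suc m - 1 - i) * r ^ Suc m = r * (x i * x (m - i))"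
        by (simp add: x_def)
    qed
    also have "M * (\<Sum>m\<le>Suc n. (R * r) ^ m) + N * (R * r * (\<Sum>m\<le>n. \<Sum>i\<le>m. x i * (R * r) ^ (m - i)))
        + Q * (r * (\<Sum>m\<le>n. \<Sum>i\<le>m. x i * x (m - i))) \<le> M * 2 + N * (R * r * (?X * 2)) + Q * (r * (?X * ?X))"
    proof (intro add_mono mult_left_mono geo)
      have "(\<Sum>m\<le>n. \<Sum>i\<le>m. x i * (R * r) ^ (m - i)) \<le> ?X * (\<Sum>m\<le>n. (R * r) ^ m)"
        using x0 nn r by (intro sum_triangle_le) auto
      also have "\<dots> \<le> ?X * 2" using X0 geo by (intro mult_left_mono)
      finally show "(\<Sum>m\<le>n. \<Sum>i\<le>m. x i * (R * r) ^ (m - i)) \<le> ?X * 2" .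
      show "(\<Sum>m\<le>n. \<Sum>i\<le>m. x i * x (m - i)) \<le> ?X * ?X"
        using x0 by (intro sum_triangle_le)
    qed (use nn r in auto)
    also have "\<dots> \<le> M * 2 + N * (R * r * (Y * 2)) + Q * (r * (Y * Y))"
      using Suc.IH X0 Y nn r by (intro add_mono mult_left_mono mult_mono) auto
    also have "\<dots> = 2 * M + r * ((2 * N * R + Q * Y) * Y)" by (simp add: algebra_simps)
    also have "\<dots> \<le> Y" using r by (simp add: Y_def)
    finally show ?case .
  qed
  have "c m \<le> Y * D ^ m" for m
  proof -
    have "x m \<le> (\<Sum>m\<le>m. x m)" by (intro member_le_sum x0) auto
    with X[of m] have "c m * r ^ m \<le> Y" by (simp add: x_def)
    then show ?thesis using r DR by (simp add: r_def field_simps power_divide)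
  qed
  with DR show ?thesis by (intro that[of D Y]) auto
qed

section \<open>Equality in the lower bound\<close>

lemma geometric_shift: "geometric P \<Longrightarrow> geometric (Abs_fps (\<lambda>m. P $ (m + n)))"
proof -
  assume "geometric P"
  then obtain M R where *: "R \<ge> 1" "\<And>m. l1 (P $ m) \<le> M * R ^ m"
    unfolding geometric_def by blast
  have "l1 (P $ (m + n)) \<le> M * R ^ n * R ^ m" for m
    using *(2)[of "m + n"] by (simp add: power_add mult_ac)
  with * show ?thesis
    by (intro geometricI[of _ "M * R ^ n" R]) auto
qed

lemma geometric_X_power: "geometric (fps_X ^ n)"
  by (rule geometricI[of _ 1 1]) (auto simp: fps_X_power_nth one_pCons)

text \<open>The data are blow-ups from which the powers of \<open>fps_X\<close> given by the orders
  have been removed. The unknowns lose \<open>fps_X ^ (t + e)\<close> and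
  \<open>fps_X ^ (s + e)\<close>, so their product keeps one factor \<open>fps_X ^ e\<close> more
  than the other terms. The degree bounds guarantee that the solution is again in the image of
  \<open>blow\<close>.\<close>

lemma geometric_solver:
  fixes f g F :: "complex poly fps"
  assumes cop: "coprime_forms s t (f $ 0) (g $ 0)" and st: "s + t > 0" and e: "e \<le> 1"
    and geo: "geometric f" "geometric g" "geometric F"
    and deg: "\<And>m. degree (f $ m) \<le> s + m" "\<And>m. degree (g $ m) \<le> t + m"
      "\<And>m. degree (F $ m) \<le> s + t + e + m"
  obtains a b where "geometric a" "geometric b" "f * a + g * b + of_nat e * fps_X * a * b = F"
    "\<And>m. degree (a $ m) \<le> t + e + m" "\<And>m. degree (b $ m) \<le> s + e + m"
proof -
  have deg0: "degree (f $ 0) \<le> s" "degree (g $ 0) \<le> t" using deg(1,2)[of 0] by simp_all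
  obtain S1 S2 K where S: "\<And>p. f $ 0 * S1 p + g $ 0 * S2 p = p"
    "\<And>p m. degree p \<le> s + t + m \<Longrightarrow> degree (S1 p) \<le> t + m"
    "\<And>p m. degree p \<le> s + t + m \<Longrightarrow> degree (S2 p) \<le> s + m"
    "\<And>p. l1 (S1 p) \<le> K * l1 p" "\<And>p. l1 (S2 p) \<le> K * l1 p" "K \<ge> 0"
    using coprime_forms_solve[OF cop deg0 st] by metis
  define w where "w = rhs f g F S1 S2 e"
  have w: "w m = F $ m - (\<Sum>i<m. f $ (m - i) * S1 (w i) + g $ (m - i) * S2 (w i))
      - of_nat e * (\<Sum>i<m. S1 (w i) * S2 (w (m - 1 - i)))" for m
    unfolding w_def by (rule rhs.simps)
  have degw: "degree (w m) \<le> s + t + (e + m)" for m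
  proof (induction m rule: less_induct)
    case (less m)
    have S1: "degree (S1 (w i)) \<le> t + (e + i)" and S2: "degree (S2 (w i)) \<le> s + (e + i)" if "i < m" for i
      using S(2,3)[OF less.IH[OF that]] by auto
    have "degree (f $ (m - i) * S1 (w i) + g $ (m - i) * S2 (w i)) \<le> s + t + (e + m)" if "i < m" for i
    proof (intro degree_add_le)
      show "degree (f $ (m - i) * S1 (w i)) \<le> s + t + (e + m)"
        using degree_mult_le[of "f $ (m - i)" "S1 (w i)"] deg(1)[of "m - i"] S1[OF that] that by linarith
      show "degree (g $ (m - i) * S2 (w i)) \<le> s + t + (e + m)"
        using degree_mult_le[of "g $ (m - i)" "S2 (w i)"] deg(2)[of "m - i"] S2[OF that] that by linarith
    qed
    then have 1: "degree (\<Sum>i<m. f $ (m - i) * S1 (w i) + g $ (m - i) * S2 (w i)) \<le> s + t + (e + m)"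
      by (intro degree_sum_le) auto
    \<comment> \<open>The two bounds add up to \<open>s + t + 2 * e + m - 1\<close>, which stays
      within \<open>s + t + e + m\<close> because \<open>e \<le> 1\<close>.\<close>
    have "degree (S1 (w i) * S2 (w (m - 1 - i))) \<le> s + t + (e + m)" if "i < m" for i
      using degree_mult_le[of "S1 (w i)" "S2 (w (m - 1 - i))"] S1[OF that] S2[of "m - 1 - i"] that e
      by linarith
    then have "degree (\<Sum>i<m. S1 (w i) * S2 (w (m - 1 - i))) \<le> s + t + (e + m)"
      by (intro degree_sum_le) auto
    then have 2: "degree (of_nat e * (\<Sum>i<m. S1 (w i) * S2 (w (m - 1 - i)))) \<le> s + t + (e + m)"
      using e by (cases e) auto
    show ?case
      unfolding w[of m] using deg(3)[of m] 1 2 by (intro degree_diff_le) (auto simp: add.assoc)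
  qed
  define a where "a = Abs_fps (\<lambda>m. S1 (w m))"
  define b where "b = Abs_fps (\<lambda>m. S2 (w m))"
  have eq: "f * a + g * b + of_nat e * fps_X * a * b = F"
  proof (rule fps_ext)
    fix m
    have conv: "(h * c) $ m = h $ 0 * c $ m + (\<Sum>i<m. h $ (m - i) * c $ i)" for h c :: "complex poly fps"
    proof -
      have "(h * c) $ m = (c * h) $ m" by (simp add: mult.commute)
      also have "\<dots> = (\<Sum>i\<le>m. c $ i * h $ (m - i))"
        by (simp add: fps_mult_nth atLeast0AtMost)
      also have "\<dots> = h $ 0 * c $ m + (\<Sum>i<m. h $ (m - i) * c $ i)"
        by (simp add: lessThan_Suc_atMost[symmetric] mult.commute add.commute)
      finally show ?thesis .
    qed
    have quad: "(of_nat e * fps_X * a * b) $ m = of_nat e * (\<Sum>i<m. S1 (w i) * S2 (w (m - 1 - i)))"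
    proof -
      have "of_nat e * fps_X * a * b = fps_const (of_nat e) * (fps_X * (a * b))"
        by (simp add: fps_of_nat mult.assoc)
      then have "(of_nat e * fps_X * a * b) $ m = of_nat e * (fps_X * (a * b)) $ m"
        by (simp only: fps_mult_left_const_nth)
      also have "(fps_X * (a * b)) $ m = (\<Sum>i<m. S1 (w i) * S2 (w (m - 1 - i)))"
      proof (cases m)
        case (Suc n)
        have "(fps_X * (a * b)) $ Suc n = (a * b) $ n" by simp
        show ?thesis
          unfolding Suc \<open>(fps_X * (a * b)) $ Suc n = (a * b) $ n\<close>
          by (simp add: fps_mult_nth a_def b_def atLeast0AtMost lessThan_Suc_atMost)
      qed simp
      finally show ?thesis .
    qed
    have "(f * a + g * b + of_nat e * fps_X * a * b) $ m =
      (f $ 0 * S1 (w m) + g $ 0 * S2 (w m)) + (\<Sum>i<m. f $ (m - i) * S1 (w i) + g $ (m - i) * S2 (w i))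
        + of_nat e * (\<Sum>i<m. S1 (w i) * S2 (w (m - 1 - i)))"
      unfolding fps_add_nth conv[of f a] conv[of g b] quad by (simp add: a_def b_def sum.distrib)
    also have "f $ 0 * S1 (w m) + g $ 0 * S2 (w m) = w m" by (rule S(1))
    finally show "(f * a + g * b + of_nat e * fps_X * a * b) $ m = F $ m"
      by (simp add: w[of m])
  qed
  obtain M1 R1 where 1: "M1 \<ge> 0" "R1 \<ge> 1" "\<And>n. l1 (f $ n) \<le> M1 * R1 ^ n" "\<And>n. l1 (g $ n) \<le> M1 * R1 ^ n"
    using geometric_common[OF geo(1,2)] by metis
  obtain M2 R2 where 2: "M2 \<ge> 0" "R2 \<ge> 1" "\<And>n. l1 (F $ n) \<le> M2 * R2 ^ n"
    using geo(3) unfolding geometric_def by blast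
  define M where "M = max M1 M2"
  define R where "R = max R1 R2"
  have M0: "M \<ge> 0" and R1: "R \<ge> 1" using 1 2 by (auto simp: M_def R_def)
  have le1: "M1 * R1 ^ n \<le> M * R ^ n" and le2: "M2 * R2 ^ n \<le> M * R ^ n" for n
    unfolding M_def R_def using 1 2 by (intro mult_mono power_mono; auto)+
  have lf: "l1 (f $ n) \<le> M * R ^ n" and lg: "l1 (g $ n) \<le> M * R ^ n" and lF: "l1 (F $ n) \<le> M * R ^ n" for n
    using order_trans[OF 1(3) le1] order_trans[OF 1(4) le1] order_trans[OF 2(3) le2] by auto
  have "l1 (w m) \<le> M * R ^ m + (2 * M * K) * (\<Sum>i<m. R ^ (m - i) * l1 (w i))
      + (e * K\<^sup>2) * (\<Sum>i<m. l1 (w i) * l1 (w (m - 1 - i)))" for m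
  proof -
    have "l1 (w m) \<le> l1 (F $ m - (\<Sum>i<m. f $ (m - i) * S1 (w i) + g $ (m - i) * S2 (w i)))
        + l1 (of_nat e * (\<Sum>i<m. S1 (w i) * S2 (w (m - 1 - i))))"
      by (subst w) (rule l1_diff)
    also have "\<dots> \<le> (l1 (F $ m) + l1 (\<Sum>i<m. f $ (m - i) * S1 (w i) + g $ (m - i) * S2 (w i)))
        + e * l1 (\<Sum>i<m. S1 (w i) * S2 (w (m - 1 - i)))"
      using l1_mult[of "of_nat e"] by (intro add_mono l1_diff) (simp add: l1_of_nat)
    also have "\<dots> \<le> (M * R ^ m + (\<Sum>i<m. 2 * M * K * (R ^ (m - i) * l1 (w i))))
        + e * (\<Sum>i<m. K\<^sup>2 * (l1 (w i) * l1 (w (m - 1 - i))))"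
    proof (intro add_mono mult_left_mono lF order_trans[OF l1_sum] sum_mono)
      fix i
      have "l1 (f $ (m - i) * S1 (w i)) \<le> (M * R ^ (m - i)) * (K * l1 (w i))"
        using M0 R1 by (intro order_trans[OF l1_mult] mult_mono lf S) auto
      moreover have "l1 (g $ (m - i) * S2 (w i)) \<le> (M * R ^ (m - i)) * (K * l1 (w i))"
        using M0 R1 by (intro order_trans[OF l1_mult] mult_mono lg S) auto
      ultimately show "l1 (f $ (m - i) * S1 (w i) + g $ (m - i) * S2 (w i)) \<le> 2 * M * K * (R ^ (m - i) * l1 (w i))"
        using l1_add[of "f $ (m - i) * S1 (w i)" "g $ (m - i) * S2 (w i)"] by (simp add: mult_ac)
      have "l1 (S1 (w i) * S2 (w (m - 1 - i))) \<le> (K * l1 (w i)) * (K * l1 (w (m - 1 - i)))"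
        using S(6) by (intro order_trans[OF l1_mult] mult_mono S) auto
      then show "l1 (S1 (w i) * S2 (w (m - 1 - i))) \<le> K\<^sup>2 * (l1 (w i) * l1 (w (m - 1 - i)))"
        by (simp add: power2_eq_square mult_ac)
    qed auto
    finally show ?thesis by (simp add: sum_distrib_left mult.assoc)
  qed
  then obtain Y R' where Y: "R' \<ge> 1" "\<And>m. l1 (w m) \<le> Y * R' ^ m"
    using quadratic_majorant[of "\<lambda>m. l1 (w m)" M "2 * M * K" R "e * K\<^sup>2"] M0 R1 S(6)
    by (metis (no_types, lifting) l1_nonneg mult_nonneg_nonneg of_nat_0_le_iff zero_le_numeral zero_le_power2)
  have bound: "l1 (Q (w m)) \<le> (K * Y) * R' ^ m" if "\<And>p. l1 (Q p) \<le> K * l1 p" for Q m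
  proof -
    have "l1 (Q (w m)) \<le> K * l1 (w m)" by (rule that)
    also have "\<dots> \<le> K * (Y * R' ^ m)" using Y(2) S(6) by (intro mult_left_mono)
    finally show ?thesis by (simp add: mult.assoc)
  qed
  show ?thesis
  proof (rule that[OF _ _ eq])
    show "geometric a" "geometric b"
      using bound[of S1, OF S(4)] bound[of S2, OF S(5)] Y(1)
      by (intro geometricI[of _ "K * Y" R']; simp add: a_def b_def)+
    show "degree (a $ m) \<le> t + e + m" "degree (b $ m) \<le> s + e + m" for m
      using S(2,3)[OF degw[of m]] by (simp_all add: a_def b_def add.assoc)
  qed
qed

text \<open>For \<open>e = 0\<close> this is division by \<open>f, g\<close> without remainder, for \<open>e = 1\<close> it is Hensel's lemma:
  \<open>(f + \<beta>) * (g + \<alpha>) = f * g + F\<close>.\<close>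

lemma graded_division:
  assumes conv: "f \<in> conv_series" "g \<in> conv_series" "F \<in> conv_series"
    and ord: "order_ge s f" "order_ge t g" "order_ge (s + t + e) F"
    and cop: "coprime_forms s t (blow f $ s) (blow g $ t)" and st: "s + t > 0" and e: "e \<le> 1"
  obtains \<alpha> \<beta> where "\<alpha> \<in> conv_series" "\<beta> \<in> conv_series" "order_ge (t + e) \<alpha>" "order_ge (s + e) \<beta>"
    "f * \<alpha> + g * \<beta> + of_nat e * \<alpha> * \<beta> = F"
proof -
  define sh where "sh n P = Abs_fps (\<lambda>m. P $ (m + n))" for n and P :: "complex poly fps"
  have sh: "blow h = fps_X ^ n * sh n (blow h)" if "order_ge n h" for h n
    unfolding sh_def using that by (intro fps_eq_X_power_mult) (simp add: order_ge_iff_blow)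
  have deg: "degree (sh n (blow h) $ m) \<le> n + m" for h n m
    using degree_blow[of h "m + n"] by (simp add: sh_def add.commute)
  have geo: "geometric (sh n (blow h))" if "h \<in> conv_series" for h n
    unfolding sh_def using that by (intro geometric_shift) (simp add: conv_series_iff_geometric)
  have cop': "coprime_forms s t (sh s (blow f) $ 0) (sh t (blow g) $ 0)"
    using cop by (simp add: sh_def)
  obtain a b where ab: "geometric a" "geometric b"
    "sh s (blow f) * a + sh t (blow g) * b + of_nat e * fps_X * a * b = sh (s + t + e) (blow F)"
    "\<And>m. degree (a $ m) \<le> t + e + m" "\<And>m. degree (b $ m) \<le> s + e + m"
    using geometric_solver[OF cop' st e geo[OF conv(1)] geo[OF conv(2)] geo[OF conv(3)] deg deg deg] by metis
  have ex: "\<exists>h. blow h = fps_X ^ n * c" if "\<And>m. degree (c $ m) \<le> n + m" for n c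
  proof -
    have "degree ((fps_X ^ n * c) $ m) \<le> m" for m
      using that[of "m - n"] by (auto simp: fps_X_power_mult_nth)
    then show ?thesis using blow_surj by metis
  qed
  obtain \<alpha> \<beta> where \<alpha>: "blow \<alpha> = fps_X ^ (t + e) * a" and \<beta>: "blow \<beta> = fps_X ^ (s + e) * b"
    using ex ab(4,5) by metis
  show ?thesis
  proof (rule that)
    show "\<alpha> \<in> conv_series" "\<beta> \<in> conv_series"
      unfolding conv_series_iff_geometric \<alpha> \<beta> by (intro geometric_mult geometric_X_power ab)+
    show "order_ge (t + e) \<alpha>" "order_ge (s + e) \<beta>"
      by (simp_all add: order_ge_iff_blow \<alpha> \<beta> fps_X_power_mult_nth)
    \<comment> \<open>For \<open>e = 0\<close> both sides vanish, and for \<open>e = 1\<close> the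
      exponent is 1.\<close>
    have eX: "of_nat e * fps_X ^ e = (of_nat e * fps_X :: complex poly fps)"
      using e by (cases e) auto
    have "blow (f * \<alpha> + g * \<beta> + of_nat e * \<alpha> * \<beta>) =
      (fps_X ^ s * sh s (blow f)) * (fps_X ^ (t + e) * a) + (fps_X ^ t * sh t (blow g)) * (fps_X ^ (s + e) * b)
      + of_nat e * (fps_X ^ (t + e) * a) * (fps_X ^ (s + e) * b)"
      by (simp only: blow.hom_simps \<alpha> \<beta> sh[OF ord(1), symmetric] sh[OF ord(2), symmetric])
    also have "\<dots> = fps_X ^ (s + t + e) * (sh s (blow f) * a + sh t (blow g) * b + (of_nat e * fps_X ^ e) * a * b)"
      by (simp add: power_add algebra_simps)
    also have "\<dots> = blow F"
      unfolding eX ab(3) by (rule sh[OF ord(3), symmetric])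
    finally show "f * \<alpha> + g * \<beta> + of_nat e * \<alpha> * \<beta> = F" by (rule blow_inject)
  qed
qed

text \<open>Induction on the degree \<open>m\<close> of the combination. Once the lower parts of
  \<open>\<alpha>\<close> and \<open>\<beta>\<close> are known to vanish, the part of degree
  \<open>m\<close> involves only the leading forms of \<open>f\<close> and \<open>g\<close>, and
  \<open>m < s + t\<close> puts the cofactors into the range where coprimality forces them to be
  0.\<close>

lemma leading_forms_independent:
  assumes ord: "order_ge s f" "order_ge t g" and cop: "coprime_forms s t (blow f $ s) (blow g $ t)"
    and tr: "trunc t \<alpha> = \<alpha>" "trunc s \<beta> = \<beta>" and van: "order_ge (s + t) (\<alpha> * f + \<beta> * g)"
  shows "\<alpha> = 0 \<and> \<beta> = 0"
proof -
  have high: "blow h $ j = 0" if "trunc n h = h" "j \<ge> n" for h n j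
  proof (rule poly_eqI)
    fix i
    have "coeff2 h (j - i) i = 0" if "i \<le> j"
      using that \<open>j \<ge> n\<close> \<open>trunc n h = h\<close> coeff2_trunc[of n h "j - i" i] by simp
    then show "coeff (blow h $ j) i = coeff 0 i" by (simp add: coeff_blow)
  qed
  have coeff_mult: "(blow a * blow h) $ m = (if n \<le> m then blow h $ n * blow a $ (m - n) else 0)"
    if "order_ge n h" "\<And>j. j + n < m \<Longrightarrow> blow a $ j = 0" for a h n m
  proof -
    have "(blow a * blow h) $ m = (\<Sum>j\<in>{0..m}. if j + n = m then blow h $ n * blow a $ j else 0)"
      unfolding fps_mult_nth
    proof (intro sum.cong refl)
      fix j assume "j \<in> {0..m}"
      then consider "j + n < m" | "j + n = m" | "m - j < n" by force
      then show "blow a $ j * blow h $ (m - j) = (if j + n = m then blow h $ n * blow a $ j else 0)"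
        using that \<open>j \<in> {0..m}\<close> by cases (auto simp: order_ge_iff_blow mult.commute)
    qed
    also have "\<dots> = (if n \<le> m then blow h $ n * blow a $ (m - n) else 0)"
    proof (cases "n \<le> m")
      case True
      then have "j + n = m \<longleftrightarrow> j = m - n" for j by auto
      then show ?thesis using True by simp
    next
      case False
      then show ?thesis by (auto intro!: sum.neutral)
    qed
    finally show ?thesis .
  qed
  have "(\<forall>j. j + s = m \<longrightarrow> blow \<alpha> $ j = 0) \<and> (\<forall>j. j + t = m \<longrightarrow> blow \<beta> $ j = 0)" if "m < s + t" for m
    using that
  proof (induction m rule: less_induct)
    case (less m)
    define a where "a = (if s \<le> m then blow \<alpha> $ (m - s) else 0)"
    define b where "b = (if t \<le> m then blow \<beta> $ (m - t) else 0)"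
    have "blow (\<alpha> * f + \<beta> * g) $ m = 0"
      using van less.prems by (simp add: order_ge_iff_blow)
    moreover have "(blow \<alpha> * blow f) $ m = blow f $ s * a"
      using less.IH less.prems by (subst coeff_mult[OF ord(1)]) (auto simp: a_def)
    moreover have "(blow \<beta> * blow g) $ m = blow g $ t * b"
      using less.IH less.prems by (subst coeff_mult[OF ord(2)]) (auto simp: b_def)
    ultimately have "blow f $ s * a + blow g $ t * b = 0" by (simp add: blow.hom_simps)
    moreover have "forms_below t a" "forms_below s b"
      using less.prems by (auto simp: forms_below_def a_def b_def coeff_blow)
    ultimately have "a = 0" "b = 0"
      using cop[unfolded coprime_forms_def, rule_format, of a b] by auto
    then show ?case by (auto simp: a_def b_def)
  qed
  then have "blow \<alpha> $ j = 0" "blow \<beta> $ j = 0" for j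
    using high[OF tr(1), of j] high[OF tr(2), of j] by (metis add.commute add_less_cancel_left not_le)+
  then have "blow \<alpha> = blow 0" "blow \<beta> = blow 0"
    by (simp_all add: blow.hom_zero fps_eq_iff)
  then show ?thesis using blow_inject by blast
qed

section \<open>The upper bound for the intersection multiplicity\<close>

lemma germ_idealI: "a \<in> conv_series \<Longrightarrow> b \<in> conv_series \<Longrightarrow> a * f + b * g \<in> germ_ideal f g"
  by (auto simp: germ_ideal_def)

text \<open>More than \<open>s * t\<close> germs, together with the multiples of \<open>f\<close>
  and \<open>g\<close>, outnumber the monomials of degree less than \<open>s + t\<close>. A relation
  between the truncations is an element of order \<open>s + t\<close>, which lies in the ideal by
  division. So the combination of the germs lies in the ideal and its coefficients vanish; the
  remaining ones vanish by independence of the multiples.\<close>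

lemma int_mult_le:
  assumes conv: "f \<in> conv_series" "g \<in> conv_series"
    and ord: "order_ge s f" "order_ge t g"
    and cop: "coprime_forms s t (blow f $ s) (blow g $ t)" and st: "s + t > 0"
  shows "germ_int_mult f g \<le> enat (s * t)"
  unfolding germ_int_mult_def codim_def
proof (rule SUP_least)
  fix B assume "B \<in> {B. finite B \<and> B \<subseteq> conv_series \<and> independent_mod (germ_ideal f g) B}"
  then have B: "finite B" "B \<subseteq> conv_series" "independent_mod (germ_ideal f g) B" by auto
  let ?N = "s + t"
  show "enat (card B) \<le> enat (s * t)"
  proof (rule ccontr)
    assume "\<not> enat (card B) \<le> enat (s * t)"
    then have card: "s * t < card B" by simp
    define I where "I = B <+> mult_index s t"
    define v where "v = case_sum (trunc ?N) (multiples s t f g)"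
    have "card (mono2 ` below ?N) \<le> card (below ?N)" by (rule card_image_le) simp
    also have "\<dots> < card I"
      using card card_mult_index[of s t] B(1) by (simp add: I_def card_Plus)
    finally have "card (mono2 ` below ?N) < card I" .
    moreover have "v i \<in> series.span (mono2 ` below ?N)" if "i \<in> I" for i
      using that trunc_in_span by (auto simp: I_def v_def multiples_def split: sum.splits)
    moreover have "finite I" using B(1) by (simp add: I_def)
    ultimately obtain c where c: "(\<Sum>i\<in>I. const2 (c i) * v i) = 0" "\<exists>i\<in>I. c i \<noteq> 0"
      using series.family_dependent[of I "mono2 ` below ?N" v] by auto
    define \<alpha> where "\<alpha> = (\<Sum>p\<in>below t. const2 (c (Inr (Inl p))) * mono2 p)"
    define \<beta> where "\<beta> = (\<Sum>p\<in>below s. const2 (c (Inr (Inr p))) * mono2 p)"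
    define x where "x = (\<Sum>b\<in>B. const2 (c (Inl b)) * b)"
    have \<alpha>c: "coeff2 \<alpha> i j = (if (i, j) \<in> below t then c (Inr (Inl (i, j))) else 0)" for i j
      unfolding \<alpha>_def by (simp add: coeff2_lincomb_mono2)
    have \<beta>c: "coeff2 \<beta> i j = (if (i, j) \<in> below s then c (Inr (Inr (i, j))) else 0)" for i j
      unfolding \<beta>_def by (simp add: coeff2_lincomb_mono2)
    have tr: "trunc t \<alpha> = \<alpha>" "trunc s \<beta> = \<beta>"
      by (rule series2_eqI; simp add: coeff2_trunc \<alpha>c \<beta>c below_def)+
    have conv\<alpha>\<beta>: "\<alpha> \<in> conv_series" "\<beta> \<in> conv_series"
      using trunc_conv[of t \<alpha>] trunc_conv[of s \<beta>] tr by auto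
    have convx: "x \<in> conv_series"
      unfolding x_def using B(2) by (intro conv_series_intros) auto
    have sumf: "(\<Sum>p\<in>below t. const2 (c (Inr (Inl p))) * trunc ?N (mono2 p * f)) = trunc ?N (\<alpha> * f)"
      unfolding \<alpha>_def sum_distrib_right trunc_sum by (simp only: mult.assoc trunc_const2_mult)
    have sumg: "(\<Sum>p\<in>below s. const2 (c (Inr (Inr p))) * trunc ?N (mono2 p * g)) = trunc ?N (\<beta> * g)"
      unfolding \<beta>_def sum_distrib_right trunc_sum by (simp only: mult.assoc trunc_const2_mult)
    have sumx: "(\<Sum>b\<in>B. const2 (c (Inl b)) * trunc ?N b) = trunc ?N x"
      unfolding x_def trunc_sum by (simp only: trunc_const2_mult)
    have "trunc ?N x + (trunc ?N (\<alpha> * f) + trunc ?N (\<beta> * g)) = 0"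
      using c(1) B(1) unfolding I_def v_def multiples_def
      by (simp add: sum.Plus sumf sumg sumx)
    \<comment> \<open>The summand 0 is the switch \<open>e\<close> of
      \<open>graded_division\<close>, set to division without a quadratic term.\<close>
    then have ordx: "order_ge (?N + 0) (x + (\<alpha> * f + \<beta> * g))"
      by (simp add: trunc_add flip: trunc_eq_0_iff)
    have "x + (\<alpha> * f + \<beta> * g) \<in> conv_series"
      using convx conv\<alpha>\<beta> conv by (intro conv_series_intros)
    then obtain \<alpha>' \<beta>' where "\<alpha>' \<in> conv_series" "\<beta>' \<in> conv_series"
      "f * \<alpha>' + g * \<beta>' + of_nat 0 * \<alpha>' * \<beta>' = x + (\<alpha> * f + \<beta> * g)"
      using graded_division[OF conv _ ord ordx cop st zero_le_one] by metis
    then have "x = (\<alpha>' - \<alpha>) * f + (\<beta>' - \<beta>) * g" "\<alpha>' - \<alpha> \<in> conv_series" "\<beta>' - \<beta> \<in> conv_series"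
      using conv\<alpha>\<beta> by (auto simp: algebra_simps intro: conv_series_intros)
    then have "x \<in> germ_ideal f g" using germ_idealI by metis
    then have cB: "\<forall>b\<in>B. c (Inl b) = 0"
      using B(3) unfolding independent_mod_def x_def by (metis (no_types))
    then have "x = 0" by (simp add: x_def const2.hom_zero)
    then have "order_ge ?N (\<alpha> * f + \<beta> * g)"
      using ordx by simp
    then have z: "\<alpha> = 0" "\<beta> = 0"
      using leading_forms_independent[OF ord cop tr] by auto
    have "c i = 0" if "i \<in> I" for i
    proof -
      consider b where "i = Inl b" "b \<in> B" | p where "i = Inr (Inl p)" "p \<in> below t"
        | p where "i = Inr (Inr p)" "p \<in> below s"
        using \<open>i \<in> I\<close> by (auto simp: I_def)
      then show ?thesis
      proof cases
        case (2 p)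
        then show ?thesis using \<alpha>c[of "fst p" "snd p"] z by simp
      next
        case (3 p)
        then show ?thesis using \<beta>c[of "fst p" "snd p"] z by simp
      qed (use cB in simp)
    qed
    with c(2) show False by blast
  qed
qed

text \<open>Over the complex numbers \<open>A\<close> can be stripped of one root at a time; each
  such root must be a root of \<open>b\<close>, since it is none of \<open>B\<close>.\<close>

lemma dvd_mult_no_common_root:
  fixes A B b :: "complex poly"
  assumes "A \<noteq> 0" "\<And>z. poly A z = 0 \<Longrightarrow> poly B z \<noteq> 0" "A dvd B * b"
  shows "A dvd b"
  using assms
proof (induction "degree A" arbitrary: A b)
  case 0
  then have "is_unit A" by (simp add: is_unit_iff_degree)
  then show ?case by (rule unit_imp_dvd)
next
  case (Suc n)
  then obtain z where z: "poly A z = 0"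
    by (metis alg_closed_imp_poly_has_root zero_less_Suc)
  then obtain A' where A: "A = [:- z, 1:] * A'" by (metis dvdE poly_eq_0_iff_dvd)
  have "poly (B * b) z = 0" using Suc.prems(3) z by (metis dvdE mult_zero_left poly_mult)
  then have "poly b z = 0" using Suc.prems(2)[OF z] by simp
  then obtain b' where b: "b = [:- z, 1:] * b'" by (metis dvdE poly_eq_0_iff_dvd)
  have A0: "A' \<noteq> 0" using A Suc.prems(1) by auto
  have "Suc n = 1 + degree A'"
    using Suc.hyps(2) A0 unfolding A by (subst (asm) degree_mult_eq) auto
  then have deg: "n = degree A'" by simp
  have root: "poly A' w = 0 \<Longrightarrow> poly B w \<noteq> 0" for w using Suc.prems(2)[of w] by (simp add: A)
  have "[:- z, 1:] * A' dvd [:- z, 1:] * (B * b')"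
    using Suc.prems(3) unfolding A b by (simp only: mult.left_commute)
  then have "A' dvd B * b'" by (subst (asm) dvd_mult_cancel_left) simp
  then have "A' dvd b'" using Suc.hyps(1)[OF deg A0 root] by blast
  then show ?case unfolding A b by (rule mult_dvd_mono[OF dvd_refl])
qed

text \<open>The last conjunct is the common zero at infinity. A common linear factor yields the
  Sylvester relation between the two cofactors, a common zero at infinity the relation between
  \<open>A\<close> and \<open>B\<close> themselves. Conversely, if \<open>b\<close> is nonzero, then
  \<open>A\<close> divides it and has degree below \<open>s\<close>; so \<open>B\<close> does not
  vanish at infinity and is too large to divide a nonzero \<open>a\<close>.\<close>

lemma coprime_forms_iff_no_common_root:
  assumes "degree A \<le> s" "degree B \<le> t" "A \<noteq> 0" "s > 0"
  shows "coprime_forms s t A B \<longleftrightarrow>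
     \<not> (\<exists>z. poly A z = 0 \<and> poly B z = 0) \<and> \<not> (coeff A s = 0 \<and> coeff B t = 0)"
proof (intro iffI conjI notI)
  assume cop: "coprime_forms s t A B"
  {
    assume "\<exists>z. poly A z = 0 \<and> poly B z = 0"
    then obtain z a b where ab: "A = [:- z, 1:] * a" "B = [:- z, 1:] * b"
      by (metis dvdE poly_eq_0_iff_dvd)
    have *: "forms_below n p" if "degree ([:- z, 1:] * p) \<le> n" for n p
    proof (cases "p = 0")
      case False
      then have "degree ([:- z, 1:] * p) = 1 + degree p" by (subst degree_mult_eq) auto
      then show ?thesis using that by (auto simp: forms_below_def intro!: coeff_eq_0)
    qed (simp add: forms_below_def)
    have "A * b + B * (- a) = 0" by (simp add: ab algebra_simps)
    moreover have "forms_below t b" "forms_below s (- a)"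
      using assms(1,2) *[of b t] *[of a s] by (auto simp: ab forms_below_def)
    ultimately have "a = 0"
      using cop[unfolded coprime_forms_def, rule_format, of b "- a"] by auto
    then show False using assms(3) ab by simp
  }
  {
    assume *: "coeff A s = 0 \<and> coeff B t = 0"
    have fb: "forms_below n p" if "degree p \<le> n" "coeff p n = 0" for n and p :: "complex poly"
      using that unfolding forms_below_def by (metis coeff_eq_0 le_antisym le_trans not_le)
    have "A * B + B * (- A) = 0" by simp
    moreover have "forms_below t B" "forms_below s A" using * fb assms by auto
    then have "forms_below t B" "forms_below s (- A)" by (auto simp: forms_below_def)
    ultimately have "- A = 0"
      using cop[unfolded coprime_forms_def, rule_format, of B "- A"] by auto
    then show False using assms(3) by simp
  }
next
  assume *: "\<not> (\<exists>z. poly A z = 0 \<and> poly B z = 0) \<and> \<not> (coeff A s = 0 \<and> coeff B t = 0)"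
  show "coprime_forms s t A B"
    unfolding coprime_forms_def
  proof (intro allI impI)
    fix a b assume ab: "forms_below t a \<and> forms_below s b \<and> A * a + B * b = 0"
    then have eq: "B * b = - (A * a)" by (simp add: eq_neg_iff_add_eq_0 add.commute)
    have "A dvd B * b" unfolding eq by simp
    then have Ab: "A dvd b" using * assms(3) by (intro dvd_mult_no_common_root[of A B b]) auto
    have "B dvd A * a" using eq by (metis dvd_minus_iff dvd_triv_left)
    then have Ba: "B dvd a" if "B \<noteq> 0" using * that by (intro dvd_mult_no_common_root[of B A a]) auto
    have "b = 0"
    proof (rule ccontr)
      assume b: "b \<noteq> 0"
      have "degree A < s" using dvd_imp_degree_le[OF Ab b] forms_below_degree[of s b] ab b by auto
      then have "coeff A s = 0" by (rule coeff_eq_0)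
      with * have Bt: "coeff B t \<noteq> 0" by blast
      have "a = 0"
      proof (rule ccontr)
        assume a: "a \<noteq> 0"
        have "B \<noteq> 0" using Bt by auto
        have "degree B < t" using dvd_imp_degree_le[OF Ba[OF \<open>B \<noteq> 0\<close>] a] forms_below_degree[of t a] ab a by auto
        with Bt show False by (simp add: coeff_eq_0)
      qed
      with eq b have "B = 0" by simp
      with Bt show False by simp
    qed
    with ab assms(3) show "a = 0 \<and> b = 0" by simp
  qed
qed

text \<open>The degrees are free parameters since the notion serves both for leading forms of two
  germs and for two consecutive homogeneous parts of a single germ.\<close>

definition common_zero :: "nat \<Rightarrow> series2 \<Rightarrow> nat \<Rightarrow> series2 \<Rightarrow> bool" where
  "common_zero s f t g \<longleftrightarrow> (\<exists>x y. (x \<noteq> 0 \<or> y \<noteq> 0) \<and> line x y f $ s = 0 \<and> line x y g $ t = 0)"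

lemma coprime_forms_iff_common_zero:
  assumes "blow f $ s \<noteq> 0" "s > 0"
  shows "coprime_forms s t (blow f $ s) (blow g $ t) \<longleftrightarrow> \<not> common_zero s f t g"
proof -
  have "common_zero s f t g \<longleftrightarrow> (\<exists>z. poly (blow f $ s) z = 0 \<and> poly (blow g $ t) z = 0)
      \<or> (coeff (blow f $ s) s = 0 \<and> coeff (blow g $ t) t = 0)" (is "?L \<longleftrightarrow> ?R")
  proof
    assume ?L
    then obtain x y where xy: "x \<noteq> 0 \<or> y \<noteq> 0" "line x y f $ s = 0" "line x y g $ t = 0"
      by (auto simp: common_zero_def)
    show ?R
    proof (cases "x = 0")
      case True
      then show ?thesis using xy by (simp add: line_eq_coeff)
    next
      case False
      then show ?thesis using xy by (auto simp: line_eq_poly)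
    qed
  next
    assume ?R
    then show ?L
    proof
      assume "\<exists>z. poly (blow f $ s) z = 0 \<and> poly (blow g $ t) z = 0"
      then obtain z where "line 1 z f $ s = 0" "line 1 z g $ t = 0" by (auto simp: poly_blow)
      then show ?thesis unfolding common_zero_def by (intro exI[of _ 1] exI[of _ z]) simp
    next
      assume "coeff (blow f $ s) s = 0 \<and> coeff (blow g $ t) t = 0"
      then have "line 0 1 f $ s = 0" "line 0 1 g $ t = 0" by (simp_all add: line_eq_coeff)
      then show ?thesis unfolding common_zero_def by (intro exI[of _ 0] exI[of _ 1]) simp
    qed
  qed
  with coprime_forms_iff_no_common_root[OF degree_blow degree_blow assms] show ?thesis by blast
qed

theorem int_mult_eq_iff:
  assumes "f \<in> conv_series" "g \<in> conv_series" "order_ge s f" "order_ge t g" "blow f $ s \<noteq> 0" "s > 0"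
  shows "germ_int_mult f g = enat (s * t) \<longleftrightarrow> \<not> common_zero s f t g"
proof (cases "coprime_forms s t (blow f $ s) (blow g $ t)")
  case True
  then have "germ_int_mult f g = enat (s * t)"
    using assms by (intro antisym int_mult_le int_mult_ge) auto
  then show ?thesis using True coprime_forms_iff_common_zero[OF assms(5,6)] by simp
next
  case False
  have "enat (s * t + 1) \<le> germ_int_mult f g"
    using assms False by (intro int_mult_gt)
  then have "germ_int_mult f g \<noteq> enat (s * t)" by auto
  then show ?thesis using False coprime_forms_iff_common_zero[OF assms(5,6)] by simp
qed

section \<open>Smooth branches\<close>

text \<open>The outer variable of \<open>series2\<close> is \<open>u\<close>, so
  \<open>fps_deriv\<close> is already the derivative in \<open>u\<close>, and the derivative in
  \<open>v\<close> has to act on the coefficients.\<close>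

definition deriv_v :: "series2 \<Rightarrow> series2" where
  "deriv_v f = Abs_fps (\<lambda>i. fps_deriv (f $ i))"

lemma coeff2_deriv_u: "coeff2 (fps_deriv f) i j = of_nat (Suc i) * coeff2 f (Suc i) j"
proof -
  have "fps_nth (of_nat n * g) j = of_nat n * fps_nth g j" for n and g :: "complex fps"
    by (simp add: fps_of_nat[symmetric])
  then show ?thesis by (simp del: of_nat_Suc)
qed

lemma coeff2_deriv_v: "coeff2 (deriv_v f) i j = of_nat (Suc j) * coeff2 f i (Suc j)"
  by (simp add: deriv_v_def)

lemma deriv_v_add: "deriv_v (f + g) = deriv_v f + deriv_v g"
  by (simp add: deriv_v_def fps_eq_iff algebra_simps)

lemma deriv_v_mult: "deriv_v (f * g) = f * deriv_v g + deriv_v f * g"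
proof (rule fps_ext)
  fix n
  have "deriv_v (f * g) $ n = (\<Sum>i=0..n. f $ i * fps_deriv (g $ (n - i)) + fps_deriv (f $ i) * g $ (n - i))"
    by (simp add: deriv_v_def fps_mult_nth fps_deriv_sum)
  also have "\<dots> = (f * deriv_v g + deriv_v f * g) $ n"
    by (simp add: deriv_v_def fps_mult_nth sum.distrib)
  finally show "deriv_v (f * g) $ n = (f * deriv_v g + deriv_v f * g) $ n" .
qed

lemma deriv_u_deriv_v: "fps_deriv (deriv_v f) = deriv_v (fps_deriv f)"
  by (rule series2_eqI) (simp add: coeff2_deriv_u coeff2_deriv_v del: fps_deriv_nth of_nat_Suc)

lemma order_ge_deriv_u: "order_ge (Suc n) f \<Longrightarrow> order_ge n (fps_deriv f)"
  by (simp add: order_ge_def coeff2_deriv_u del: fps_deriv_nth)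

lemma order_ge_deriv_v: "order_ge (Suc n) f \<Longrightarrow> order_ge n (deriv_v f)"
  by (simp add: order_ge_def coeff2_deriv_v)

lemma line_euler:
  "x * line x y (fps_deriv f) $ n + y * line x y (deriv_v f) $ n = of_nat (Suc n) * line x y f $ Suc n"
proof -
  define T where "T j = coeff2 f (Suc n - j) j * x ^ (Suc n - j) * y ^ j" for j
  have "x * line x y (fps_deriv f) $ n = (\<Sum>j\<le>n. of_nat (Suc n - j) * T j)"
    unfolding line_nth sum_distrib_left
  proof (intro sum.cong refl)
    fix j assume "j \<in> {..n}"
    then have "Suc n - j = Suc (n - j)" by auto
    then show "x * (coeff2 (fps_deriv f) (n - j) j * x ^ (n - j) * y ^ j) = of_nat (Suc n - j) * T j"
      by (simp add: coeff2_deriv_u T_def algebra_simps del: of_nat_Suc fps_deriv_nth)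
  qed
  also have "\<dots> = (\<Sum>j\<le>Suc n. of_nat (Suc n - j) * T j)" by simp
  finally have 1: "x * line x y (fps_deriv f) $ n = (\<Sum>j\<le>Suc n. of_nat (Suc n - j) * T j)" .
  have "y * line x y (deriv_v f) $ n = (\<Sum>j\<le>n. of_nat (Suc j) * T (Suc j))"
    unfolding line_nth sum_distrib_left
    by (intro sum.cong refl) (simp add: coeff2_deriv_v T_def algebra_simps del: of_nat_Suc)
  also have "\<dots> = (\<Sum>j\<le>Suc n. of_nat j * T j)"
    by (subst sum.atMost_Suc_shift) simp
  finally have 2: "y * line x y (deriv_v f) $ n = (\<Sum>j\<le>Suc n. of_nat j * T j)" .
  have "x * line x y (fps_deriv f) $ n + y * line x y (deriv_v f) $ n = (\<Sum>j\<le>Suc n. of_nat (Suc n) * T j)"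
    unfolding 1 2 sum.distrib[symmetric]
  proof (intro sum.cong refl)
    fix j assume "j \<in> {..Suc n}"
    then have "of_nat (Suc n - j) + of_nat j = (of_nat (Suc n) :: complex)"
      by (metis atMost_iff le_add_diff_inverse2 of_nat_add)
    then show "of_nat (Suc n - j) * T j + of_nat j * T j = of_nat (Suc n) * T j"
      by (metis distrib_right)
  qed
  also have "\<dots> = of_nat (Suc n) * line x y f $ Suc n"
    unfolding line_nth sum_distrib_left T_def ..
  finally show ?thesis .
qed

section \<open>Leading parts of products\<close>

lemma fps_mult_nth_leading:
  fixes P Q :: "'a::comm_ring_1 fps"
  assumes "\<And>i. i < m \<Longrightarrow> P $ i = 0" "\<And>i. i < n \<Longrightarrow> Q $ i = 0"
  shows "(P * Q) $ (m + n) = P $ m * Q $ n"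
    and "(P * Q) $ Suc (m + n) = P $ m * Q $ Suc n + P $ Suc m * Q $ n"
proof -
  define P' where "P' = Abs_fps (\<lambda>i. P $ (i + m))"
  define Q' where "Q' = Abs_fps (\<lambda>i. Q $ (i + n))"
  have "P = fps_X ^ m * P'" "Q = fps_X ^ n * Q'"
    unfolding P'_def Q'_def using assms by (intro fps_eq_X_power_mult; simp)+
  then have PQ: "P * Q = fps_X ^ (m + n) * (P' * Q')"
    by (simp add: power_add mult_ac)
  show "(P * Q) $ (m + n) = P $ m * Q $ n"
    unfolding PQ by (simp add: fps_X_power_mult_nth P'_def Q'_def)
  show "(P * Q) $ Suc (m + n) = P $ m * Q $ Suc n + P $ Suc m * Q $ n"
    unfolding PQ fps_X_power_mult_nth by (simp add: P'_def Q'_def fps_mult_nth add.commute)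
qed

lemma line_mult_leading:
  assumes "order_ge m f" "order_ge n g"
  shows "line x y (f * g) $ (m + n) = line x y f $ m * line x y g $ n"
    and "line x y (f * g) $ Suc (m + n) = line x y f $ m * line x y g $ Suc n + line x y f $ Suc m * line x y g $ n"
  unfolding line.hom_mult
  by (rule fps_mult_nth_leading; simp add: order_ge_line[OF assms(1)] order_ge_line[OF assms(2)])+

lemma line_nth_0 [simp]: "line x y f $ 0 = coeff2 f 0 0"
  by (simp add: line_nth)

lemma line_nth_1: "line x y f $ Suc 0 = coeff2 f 1 0 * x + coeff2 f 0 1 * y"
  by (simp add: line_nth)

lemma smooth_germ_order: "smooth_germ g \<Longrightarrow> order_ge 1 g"
  by (auto simp: smooth_germ_def order_ge_def)

text \<open>Either the dehomogenized form has a root, or its degree is below \<open>s\<close> and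
  the zero lies at infinity.\<close>

lemma form_has_zero:
  assumes "s > 0"
  shows "\<exists>x y. (x \<noteq> 0 \<or> y \<noteq> 0) \<and> line x y f $ s = 0"
proof (cases "degree (blow f $ s) > 0 \<and> coeff (blow f $ s) s \<noteq> 0")
  case True
  then obtain z where "poly (blow f $ s) z = 0" by (metis alg_closed_imp_poly_has_root)
  then show ?thesis by (intro exI[of _ 1] exI[of _ z]) (simp add: poly_blow)
next
  case False
  then have "coeff (blow f $ s) s = 0" using assms by (auto simp: coeff_eq_0)
  then show ?thesis by (intro exI[of _ 0] exI[of _ 1]) (simp add: line_eq_coeff)
qed

text \<open>Subtracting the tangent replaces the generators of orders 1 and 1 by generators of
  orders 1 and 2 of the same ideal. The general criterion then applies with product 2: the quadratic
  part of \<open>g\<close> must not vanish in the tangent direction.\<close>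

lemma tangent_line_int_mult:
  assumes "smooth_germ g"
  shows "germ_int_mult g (tangent_line g) = 2 \<longleftrightarrow> \<not> common_zero 1 g 2 g"
proof -
  let ?l = "tangent_line g"
  have gc: "g \<in> conv_series" using assms by (simp add: smooth_germ_def)
  have cl: "coeff2 ?l i j = (if i = 1 \<and> j = 0 then coeff2 g 1 0 else if i = 0 \<and> j = 1 then coeff2 g 0 1 else 0)" for i j
    by (auto simp: tangent_line_def coeff2_var_u coeff2_var_v)
  have lc: "?l \<in> conv_series"
    unfolding tangent_line_def by (intro conv_series_intros)
  have "germ_ideal g ?l = germ_ideal ?l (g - ?l)"
  proof (intro set_eqI iffI)
    fix x assume "x \<in> germ_ideal g ?l"
    then obtain a b where "x = a * g + b * ?l" "a \<in> conv_series" "b \<in> conv_series" by (auto simp: germ_ideal_def)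
    then have "x = (a + b) * ?l + a * (g - ?l)" "a + b \<in> conv_series" "a \<in> conv_series"
      by (auto simp: algebra_simps intro: conv_series_intros)
    then show "x \<in> germ_ideal ?l (g - ?l)" using germ_idealI by metis
  next
    fix x assume "x \<in> germ_ideal ?l (g - ?l)"
    then obtain a b where "x = a * ?l + b * (g - ?l)" "a \<in> conv_series" "b \<in> conv_series" by (auto simp: germ_ideal_def)
    then have "x = b * g + (a - b) * ?l" "b \<in> conv_series" "a - b \<in> conv_series"
      by (auto simp: algebra_simps intro: conv_series_intros)
    then show "x \<in> germ_ideal g ?l" using germ_idealI by metis
  qed
  then have eq: "germ_int_mult g ?l = germ_int_mult ?l (g - ?l)" by (simp add: germ_int_mult_def)
  have ol: "order_ge 1 ?l" by (simp add: order_ge_def cl)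
  have og: "order_ge 2 (g - ?l)"
    unfolding order_ge_def
  proof (intro allI impI)
    fix i j :: nat assume "i + j < 2"
    then consider "i = 0 \<and> j = 0" | "i = 1 \<and> j = 0" | "i = 0 \<and> j = 1" by linarith
    then show "coeff2 (g - ?l) i j = 0"
      using assms by cases (auto simp: cl smooth_germ_def)
  qed
  have "blow ?l $ 1 \<noteq> 0"
  proof
    assume "blow ?l $ 1 = 0"
    then have "coeff (blow ?l $ 1) 0 = 0" "coeff (blow ?l $ 1) 1 = 0" by simp_all
    then show False using assms by (simp add: coeff_blow cl smooth_germ_def)
  qed
  then have "germ_int_mult ?l (g - ?l) = enat (1 * 2) \<longleftrightarrow> \<not> common_zero 1 ?l 2 (g - ?l)"
    using lc gc ol og by (intro int_mult_eq_iff conv_series_intros) auto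
  moreover have "common_zero 1 ?l 2 (g - ?l) \<longleftrightarrow> common_zero 1 g 2 g"
  proof -
    have "line x y ?l $ 1 = line x y g $ 1" for x y by (simp add: line_nth cl)
    moreover have "line x y ?l $ 2 = 0" for x y by (simp add: line_nth cl numeral_2_eq_2)
    ultimately show ?thesis by (simp add: common_zero_def line.hom_diff)
  qed
  ultimately show ?thesis by (simp add: eq numeral_eq_enat)
qed

text \<open>The direction \<open>(x, y)\<close> is tangent to \<open>g\<close>, so in the Leibniz
  rule the terms with \<open>g\<close> undifferentiated drop out, and in the product the part of
  degree \<open>n + 2\<close> begins with the quadratic part of \<open>g\<close>.\<close>

lemma smooth_factor:
  assumes "order_ge 1 g" "order_ge n h" "line x y g $ 1 = 0"
  shows "line x y (fps_deriv (g * h)) $ n = coeff2 g 1 0 * line x y h $ n"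
    and "line x y (deriv_v (g * h)) $ n = coeff2 g 0 1 * line x y h $ n"
    and "line x y (g * h) $ Suc (Suc n) = line x y g $ 2 * line x y h $ n"
proof -
  \<comment> \<open>A derivative of \<open>h\<close> has order \<open>n - 1\<close> only for
    positive \<open>n\<close>; for \<open>n = 0\<close> the vanishing constant term of
    \<open>g\<close> does the work instead.\<close>
  have z: "line x y (g * d) $ n = 0" if "\<And>m. n = Suc m \<Longrightarrow> order_ge m d" for d
  proof (cases n)
    case 0
    then show ?thesis using assms(1) by (simp add: line.hom_mult order_ge_def)
  next
    case (Suc m)
    then show ?thesis using line_mult_leading(1)[OF assms(1) that[OF Suc], of x y] assms(3) by simp
  qed
  have m: "line x y (d * h) $ n = coeff2 d 0 0 * line x y h $ n" for d
    using line_mult_leading(1)[of 0 d n h x y] assms(2) by simp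
  have "line x y (g * fps_deriv h) $ n = 0" "line x y (g * deriv_v h) $ n = 0"
    using assms(2) by (intro z; auto intro: order_ge_deriv_u order_ge_deriv_v)+
  then show "line x y (fps_deriv (g * h)) $ n = coeff2 g 1 0 * line x y h $ n"
    "line x y (deriv_v (g * h)) $ n = coeff2 g 0 1 * line x y h $ n"
    by (simp_all add: deriv_v_mult line.hom_add m coeff2_deriv_v)
  show "line x y (g * h) $ Suc (Suc n) = line x y g $ 2 * line x y h $ n"
    using line_mult_leading(2)[OF assms(1,2), of x y] assms(3) by (simp add: numeral_2_eq_2)
qed

lemma unit_times_smooth:
  assumes "finite S" "\<And>j. j \<in> S \<Longrightarrow> order_ge 1 (g j)"
  shows "order_ge (card S) (e * (\<Prod>j\<in>S. g j)) \<and>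
    line x y (e * (\<Prod>j\<in>S. g j)) $ card S = coeff2 e 0 0 * (\<Prod>j\<in>S. line x y (g j) $ 1)"
  using assms
proof (induction S rule: finite_induct)
  case (insert i S)
  let ?h = "e * (\<Prod>j\<in>S. g j)"
  have eq: "e * (\<Prod>j\<in>insert i S. g j) = g i * ?h"
    using insert.hyps by (simp add: mult_ac)
  have IH: "order_ge (card S) ?h" "line x y ?h $ card S = coeff2 e 0 0 * (\<Prod>j\<in>S. line x y (g j) $ 1)"
    using insert by auto
  have gi: "order_ge 1 (g i)" using insert.prems by simp
  have c: "card (insert i S) = 1 + card S" using insert.hyps by simp
  show ?case
    unfolding eq c using order_ge_mult[OF gi IH(1)] line_mult_leading(1)[OF gi IH(1), of x y] IH(2) insert.hyps
    by (simp add: mult_ac)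
qed simp

text \<open>A zero of the leading form is a simple linear factor precisely when the gradient of the
  form does not vanish there; the derivatives of the leading form live in degree
  \<open>k - 1\<close>.\<close>

definition simple_tangents :: "nat \<Rightarrow> series2 \<Rightarrow> bool" where
  "simple_tangents k f \<longleftrightarrow> (\<forall>x y. (x \<noteq> 0 \<or> y \<noteq> 0) \<and> line x y f $ k = 0 \<longrightarrow>
     line x y (fps_deriv f) $ (k - 1) \<noteq> 0 \<or> line x y (deriv_v f) $ (k - 1) \<noteq> 0)"

lemma same_tangent_iff_common_direction:
  assumes "smooth_germ g" "x \<noteq> 0 \<or> y \<noteq> 0" "line x y g $ 1 = 0"
  shows "same_tangent h g \<longleftrightarrow> line x y h $ 1 = 0"
proof -
  define a b c d where "a = coeff2 g 1 0" and "b = coeff2 g 0 1" and "c = coeff2 h 1 0" and "d = coeff2 h 0 1"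
  have ab: "a \<noteq> 0 \<or> b \<noteq> 0" "a * x + b * y = 0"
    using assms by (auto simp: smooth_germ_def a_def b_def line_nth_1)
  have "c * b = d * a \<longleftrightarrow> c * x + d * y = 0"
  proof
    assume 1: "c * b = d * a"
    have "b * (c * x + d * y) = d * (a * x + b * y)" "a * (c * x + d * y) = c * (a * x + b * y)"
      using 1 by algebra+
    then show "c * x + d * y = 0" using ab by auto
  next
    assume 1: "c * x + d * y = 0"
    have "x * (c * b - d * a) = 0" "y * (c * b - d * a) = 0"
      using ab(2) 1 by algebra+
    then show "c * b = d * a" using assms(2) by auto
  qed
  then show ?thesis by (simp add: same_tangent_def line_nth_1 a_def b_def c_def d_def)
qed

text \<open>As the tangents are distinct, only one branch has its linear part vanishing at
  \<open>(x, y)\<close>; the unit and the other branches make up \<open>h\<close>.\<close>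

lemma branches_at_zero:
  assumes "ordinary_branches k f g" "x \<noteq> 0 \<or> y \<noteq> 0" "line x y f $ k = 0"
  obtains j h where "j < k" "line x y (g j) $ 1 = 0" "f = g j * h" "order_ge (k - 1) h" "line x y h $ (k - 1) \<noteq> 0"
proof -
  obtain e where e: "unit_germ e" "f = e * (\<Prod>j<k. g j)" and sm: "\<And>j. j < k \<Longrightarrow> smooth_germ (g j)"
    and dist: "\<And>i j. i < k \<Longrightarrow> j < k \<Longrightarrow> i \<noteq> j \<Longrightarrow> \<not> same_tangent (g i) (g j)"
    using assms(1) unfolding ordinary_branches_def by blast
  have "line x y f $ k = coeff2 e 0 0 * (\<Prod>j<k. line x y (g j) $ 1)"
    using unit_times_smooth[of "{..<k}" g e x y] sm smooth_germ_order e(2) by auto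
  then obtain j where j: "j < k" "line x y (g j) $ 1 = 0"
    using assms(3) e(1) by (auto simp: unit_germ_def)
  define h where "h = e * (\<Prod>i\<in>{..<k} - {j}. g i)"
  have h: "order_ge (k - 1) h" "line x y h $ (k - 1) = coeff2 e 0 0 * (\<Prod>i\<in>{..<k} - {j}. line x y (g i) $ 1)"
    using unit_times_smooth[of "{..<k} - {j}" g e x y] sm smooth_germ_order j(1) by (auto simp: h_def)
  have "line x y (g i) $ 1 \<noteq> 0" if "i \<in> {..<k} - {j}" for i
    using same_tangent_iff_common_direction[OF sm[OF j(1)] assms(2) j(2), of "g i"] dist[of i j] that j(1) by auto
  then have "line x y h $ (k - 1) \<noteq> 0"
    using e(1) unfolding h(2) by (simp add: unit_germ_def)
  moreover have "f = g j * h"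
    unfolding e(2) h_def using j(1) by (simp add: prod.remove[of "{..<k}" j] mult_ac)
  ultimately show ?thesis using that j h(1) by blast
qed

text \<open>The leading form is a linear form times a form coprime to it, and Hensel's lemma lifts this
  factorization.\<close>

lemma split_branch:
  assumes f: "f \<in> conv_series" "order_ge (Suc k) f" "blow f $ Suc k \<noteq> 0" "simple_tangents (Suc k) f"
  obtains G h x y where "smooth_germ G" "h \<in> conv_series" "order_ge k h" "blow h $ k \<noteq> 0" "f = G * h"
    "simple_tangents k h" "x \<noteq> 0 \<or> y \<noteq> 0" "line x y G $ 1 = 0" "line x y h $ k \<noteq> 0"
proof -
  obtain x0 y0 where xy: "x0 \<noteq> 0 \<or> y0 \<noteq> 0" "line x0 y0 f $ Suc k = 0"
    using form_has_zero[of "Suc k" f] by auto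
  let ?A = "blow f $ Suc k"
  have degA: "degree ?A \<le> Suc k" by (rule degree_blow)
  \<comment> \<open>The factor is the dehomogenized linear form \<open>y0 * u - x0 * v\<close>. For
    \<open>x0 = 0\<close> it is a constant, and the lowered degree of \<open>w\<close> comes from
    the zero of the form at infinity.\<close>
  have "\<exists>w. ?A = [:y0, - x0:] * w \<and> degree w \<le> k"
  proof (cases "x0 = 0")
    case True
    with xy have y0: "y0 \<noteq> 0" by simp
    have "coeff ?A (Suc k) = 0"
      using xy True y0 by (simp add: line_eq_coeff)
    with degA f(3) have "degree ?A \<le> k"
      by (metis le_Suc_eq leading_coeff_0_iff)
    then show ?thesis using True y0 by (intro exI[of _ "smult (inverse y0) ?A"]) auto
  next
    case False
    have "poly ?A (y0 / x0) = 0"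
      using xy False by (simp add: line_eq_poly)
    then obtain w where w: "?A = [:- (y0 / x0), 1:] * w"
      by (metis dvdE poly_eq_0_iff_dvd)
    have "w \<noteq> 0" using w f(3) by auto
    then have "degree ?A = 1 + degree w" unfolding w by (subst degree_mult_eq) auto
    moreover have "[:- (y0 / x0), 1:] * w = [:y0, - x0:] * smult (- inverse x0) w"
      using False by (simp add: field_simps)
    ultimately show ?thesis using w degA False
      by (intro exI[of _ "smult (- inverse x0) w"]) auto
  qed
  then obtain w where w: "?A = [:y0, - x0:] * w" "degree w \<le> k" by blast
  have "forms_below 2 [:y0, - x0:]" "forms_below (Suc k) w"
    using w(2) by (auto simp: forms_below_def coeff_pCons intro!: coeff_eq_0 split: nat.splits)
  then obtain l v where l: "l \<in> conv_series" "\<And>m. blow l $ m = (if Suc m = 2 then [:y0, - x0:] else 0)"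
    and v: "v \<in> conv_series" "\<And>m. blow v $ m = (if Suc m = Suc k then w else 0)"
    using form_series by metis
  have ol: "order_ge 1 l" and ov: "order_ge k v" by (auto simp: order_ge_iff_blow l v)
  have l10: "coeff2 l 1 0 = y0" and l01: "coeff2 l 0 1 = - x0" and l00: "coeff2 l 0 0 = 0"
    using l(2)[of 1] l(2)[of 0] coeff_blow[of l 1 0] coeff_blow[of l 1 1] coeff_blow[of l 0 0] by simp_all
  have lz: "line x0 y0 l $ 1 = 0" using l10 l01 by (simp add: line_nth_1)
  have low: "order_ge (Suc (Suc k)) (f - l * v)"
    unfolding order_ge_iff_blow
  proof (intro allI impI)
    fix m assume "m < Suc (Suc k)"
    show "blow (f - l * v) $ m = 0"
    proof (cases "m = Suc k")
      case True
      have "(blow l * blow v) $ (1 + k) = blow l $ 1 * blow v $ k"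
        by (rule fps_mult_nth_leading) (auto simp: l v)
      then show ?thesis using True w(1) by (simp add: blow.hom_diff blow.hom_mult l v)
    next
      case False
      have "order_ge (1 + k) (l * v)" by (rule order_ge_mult[OF ol ov])
      with f(2) have "order_ge (Suc k) (f - l * v)" by (intro order_ge_diff) auto
      then show ?thesis using False \<open>m < Suc (Suc k)\<close> by (auto simp: order_ge_iff_blow)
    qed
  qed
  have du: "line x y (fps_deriv f) $ k = line x y (fps_deriv (l * v)) $ k"
    and dv: "line x y (deriv_v f) $ k = line x y (deriv_v (l * v)) $ k" for x y
  proof -
    have "f = (f - l * v) + l * v" by simp
    then have "fps_deriv f = fps_deriv (f - l * v) + fps_deriv (l * v)"
      "deriv_v f = deriv_v (f - l * v) + deriv_v (l * v)"
      by (metis fps_deriv_add, metis deriv_v_add)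
    moreover have "line x y (fps_deriv (f - l * v)) $ k = 0" "line x y (deriv_v (f - l * v)) $ k = 0"
      using order_ge_line[OF order_ge_deriv_u[OF low], of k] order_ge_line[OF order_ge_deriv_v[OF low], of k] by auto
    ultimately show "line x y (fps_deriv f) $ k = line x y (fps_deriv (l * v)) $ k"
      "line x y (deriv_v f) $ k = line x y (deriv_v (l * v)) $ k"
      by (simp_all only: line.hom_add fps_add_nth add_0)
  qed
  \<comment> \<open>Otherwise both factors of the leading form vanish at this zero, and so does the
    gradient of their product.\<close>
  have vnz: "line x0 y0 v $ k \<noteq> 0"
  proof
    assume "line x0 y0 v $ k = 0"
    then have "line x0 y0 (fps_deriv f) $ k = 0" "line x0 y0 (deriv_v f) $ k = 0"
      using smooth_factor(1,2)[OF ol ov lz] by (simp_all only: du dv mult_zero_right)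
    then show False using f(4) xy unfolding simple_tangents_def by auto
  qed
  have bl1: "blow l $ 1 \<noteq> 0" using xy(1) by (auto simp: l)
  \<comment> \<open>Up to scaling \<open>(x0, y0)\<close> is the only zero of \<open>l\<close>, and
    \<open>v\<close> does not vanish there.\<close>
  have "\<not> common_zero 1 l k v"
  proof
    assume "common_zero 1 l k v"
    then obtain x y where p: "x \<noteq> 0 \<or> y \<noteq> 0" "line x y l $ 1 = 0" "line x y v $ k = 0"
      by (auto simp: common_zero_def)
    have e: "y0 * x = x0 * y" using p(2) l10 l01 by (simp add: line_nth_1)
    obtain c where "x0 = c * x" "y0 = c * y"
    proof (cases "x = 0")
      case True
      with p e have "x0 = 0" "y \<noteq> 0" by auto
      then show ?thesis using True by (intro that[of "y0 / y"]) auto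
    next
      case False
      then show ?thesis using e by (intro that[of "x0 / x"]) (auto simp: field_simps)
    qed
    then have "line x0 y0 v $ k = 0" using p(3) line_scale[of c x y v k] by simp
    with vnz show False by simp
  qed
  then have cop: "coprime_forms 1 k (blow l $ 1) (blow v $ k)"
    using coprime_forms_iff_common_zero[OF bl1] by simp
  have conv: "f - l * v \<in> conv_series" using f l v by (intro conv_series_intros)
  obtain \<alpha> \<beta> where ab: "\<alpha> \<in> conv_series" "\<beta> \<in> conv_series" "order_ge (k + 1) \<alpha>" "order_ge (1 + 1) \<beta>"
    "l * \<alpha> + v * \<beta> + of_nat 1 * \<alpha> * \<beta> = f - l * v"
    using graded_division[OF l(1) v(1) conv ol ov _ cop, of 1] low by auto
  define G where "G = l + \<beta>"
  define h where "h = v + \<alpha>"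
  have feq: "f = G * h" using ab(5) by (simp add: G_def h_def algebra_simps)
  have G1: "line x y G $ 1 = line x y l $ 1" for x y
    using order_ge_line[OF ab(4), of 1 x y] by (simp add: G_def line.hom_add)
  have hk: "line x y h $ k = line x y v $ k" for x y
    using order_ge_line[OF ab(3), of k x y] by (simp add: h_def line.hom_add)
  have b0: "coeff2 \<beta> i j = 0" if "i + j < 2" for i j using ab(4) that by (simp add: order_ge_def)
  have oG: "order_ge 1 G" unfolding G_def using ol ab(4) order_ge_mono by (intro order_ge_add) auto
  have oh: "order_ge k h" unfolding h_def using ov ab(3) order_ge_mono by (intro order_ge_add) auto
  have sG: "smooth_germ G"
    unfolding smooth_germ_def using xy(1) l ab b0[of 0 0] b0[of 1 0] b0[of 0 1] l10 l01 l00
    by (auto simp: G_def intro: conv_series_intros)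
  have hc: "h \<in> conv_series" unfolding h_def using v ab by (intro conv_series_intros)
  have "blow h $ k = w"
    using ab(3) by (simp add: h_def blow.hom_add v order_ge_iff_blow)
  then have hnz: "blow h $ k \<noteq> 0" using w(1) f(3) by auto
  have "simple_tangents k h"
    unfolding simple_tangents_def
  proof (intro allI impI)
    fix x y assume p: "(x \<noteq> 0 \<or> y \<noteq> 0) \<and> line x y h $ k = 0"
    show "line x y (fps_deriv h) $ (k - 1) \<noteq> 0 \<or> line x y (deriv_v h) $ (k - 1) \<noteq> 0"
    proof (cases k)
      case 0
      then have "coeff2 h 0 0 = 0" using p by simp
      moreover have "poly (blow h $ 0) 0 = coeff2 h 0 0" by (simp only: poly_blow line_nth_0)
      moreover have "blow h $ 0 = [:coeff2 h 0 0:]" by (simp add: blow_nth monom_0)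
      ultimately show ?thesis using hnz 0 by simp
    next
      case (Suc n)
      \<comment> \<open>A zero of the leading form of \<open>h\<close> is one of the leading form of
        \<open>f\<close>. There the Leibniz terms with \<open>h\<close> undifferentiated vanish, so
        the nonzero gradient of \<open>f\<close> is a multiple of that of \<open>h\<close>.\<close>
      have "line x y f $ Suc k = 0"
        using line_mult_leading(1)[OF oG oh, of x y] p feq by simp
      then have nz: "line x y (fps_deriv f) $ k \<noteq> 0 \<or> line x y (deriv_v f) $ k \<noteq> 0"
        using f(4) p unfolding simple_tangents_def by fastforce
      have lead: "line x y (G * d) $ k = line x y G $ 1 * line x y d $ n" if "order_ge n d" for d
        using line_mult_leading(1)[OF oG that, of x y] Suc by simp
      have zero: "line x y (d * h) $ k = 0" for d
        using line_mult_leading(1)[of 0 d k h x y] oh p by simp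
      have od: "order_ge n (fps_deriv h)" "order_ge n (deriv_v h)"
        using oh Suc by (simp_all add: order_ge_deriv_u order_ge_deriv_v)
      have "line x y (fps_deriv f) $ k = line x y G $ 1 * line x y (fps_deriv h) $ n"
        "line x y (deriv_v f) $ k = line x y G $ 1 * line x y (deriv_v h) $ n"
        unfolding feq fps_deriv_mult deriv_v_mult line.hom_add fps_add_nth zero lead[OF od(1)] lead[OF od(2)]
        by simp_all
      with nz Suc show ?thesis by auto
    qed
  qed
  moreover have "line x0 y0 G $ 1 = 0" "line x0 y0 h $ k \<noteq> 0"
    using lz vnz G1 hk by auto
  ultimately show ?thesis using that sG hc oh hnz feq xy(1) by blast
qed

text \<open>Branches are split off one at a time. The direction of the new branch is no zero of the
  remaining leading form, so its tangent differs from all later ones.\<close>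

lemma ordinary_branches_exist:
  assumes "f \<in> conv_series" "order_ge k f" "blow f $ k \<noteq> 0" "simple_tangents k f"
  shows "\<exists>g. ordinary_branches k f g"
  using assms
proof (induction k arbitrary: f)
  case 0
  have "blow f $ 0 = [:coeff2 f 0 0:]" by (simp add: blow_nth monom_0)
  with 0 have "unit_germ f" by (auto simp: unit_germ_def)
  then show ?case by (auto simp: ordinary_branches_def)
next
  case (Suc k)
  obtain G h x y where G: "smooth_germ G" "h \<in> conv_series" "order_ge k h" "blow h $ k \<noteq> 0" "f = G * h"
    "simple_tangents k h" "x \<noteq> 0 \<or> y \<noteq> 0" "line x y G $ 1 = 0" "line x y h $ k \<noteq> 0"
    using split_branch[OF Suc.prems] by metis
  obtain g where "ordinary_branches k h g" using Suc.IH[OF G(2-4) G(6)] by blast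
  then obtain e where e: "unit_germ e" "h = e * (\<Prod>j<k. g j)" and sm: "\<And>j. j < k \<Longrightarrow> smooth_germ (g j)"
    and dist: "\<And>i j. i < k \<Longrightarrow> j < k \<Longrightarrow> i \<noteq> j \<Longrightarrow> \<not> same_tangent (g i) (g j)"
    unfolding ordinary_branches_def by blast
  have "line x y h $ k = coeff2 e 0 0 * (\<Prod>j<k. line x y (g j) $ 1)"
    using unit_times_smooth[of "{..<k}" g e x y] sm smooth_germ_order e(2) by auto
  with G(9) have "line x y (g j) $ 1 \<noteq> 0" if "j < k" for j using that by auto
  then have new: "\<not> same_tangent (g j) G" if "j < k" for j
    using same_tangent_iff_common_direction[OF G(1,7,8)] that by blast
  then have new': "\<not> same_tangent G (g j)" if "j < k" for j
    using new[OF that] unfolding same_tangent_def by (metis mult.commute)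
  define g' where "g' = g(k := G)"
  have "(\<Prod>j<Suc k. g' j) = (\<Prod>j<k. g j) * G"
    by (simp add: g'_def)
  then have "f = e * (\<Prod>j<Suc k. g' j)" using G(5) e(2) by (simp add: mult_ac)
  moreover have "\<forall>j<Suc k. smooth_germ (g' j)" using sm G(1) by (auto simp: g'_def less_Suc_eq)
  moreover have "\<forall>i<Suc k. \<forall>j<Suc k. i \<noteq> j \<longrightarrow> \<not> same_tangent (g' i) (g' j)"
    using dist new new' by (auto simp: g'_def less_Suc_eq)
  ultimately have "ordinary_branches (Suc k) f g'"
    using e(1) unfolding ordinary_branches_def by blast
  then show ?case by blast
qed

text \<open>In the tangent direction of the branch \<open>g j\<close>, write
  \<open>f = g j * h\<close>. The part of degree \<open>k + 1\<close> of \<open>f\<close> is the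
  quadratic part of \<open>g j\<close> times the leading form of \<open>h\<close>, which is nonzero
  there if the tangents are distinct. So the next part of \<open>f\<close> detects inflection of
  each branch separately.\<close>

theorem ordinary_simple_germ_iff:
  assumes "f \<in> conv_series" "order_ge k f" "blow f $ k \<noteq> 0" "k > 0"
  shows "ordinary_simple_germ k f \<longleftrightarrow> simple_tangents k f \<and> \<not> common_zero k f (Suc k) f"
proof
  obtain n where n: "k = Suc n" using assms(4) by (cases k) auto
  {
    assume "ordinary_simple_germ k f"
    then obtain g where g: "ordinary_branches k f g" "\<And>j. j < k \<Longrightarrow> germ_int_mult (g j) (tangent_line (g j)) = 2"
      by (auto simp: ordinary_simple_germ_def)
    have sm: "smooth_germ (g j)" if "j < k" for j using g(1) that by (auto simp: ordinary_branches_def)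
    have "(line x y (fps_deriv f) $ n \<noteq> 0 \<or> line x y (deriv_v f) $ n \<noteq> 0) \<and> line x y f $ Suc k \<noteq> 0"
      if xy: "x \<noteq> 0 \<or> y \<noteq> 0" "line x y f $ k = 0" for x y
    proof -
      obtain j h where j: "j < k" "line x y (g j) $ 1 = 0" "f = g j * h" "order_ge n h" "line x y h $ n \<noteq> 0"
        using branches_at_zero[OF g(1) xy] n by auto
      have "line x y (g j) $ 2 \<noteq> 0"
        using g(2)[OF j(1)] tangent_line_int_mult[OF sm[OF j(1)]] j(2) xy(1) by (auto simp: common_zero_def)
      moreover have "coeff2 (g j) 1 0 \<noteq> 0 \<or> coeff2 (g j) 0 1 \<noteq> 0"
        using sm[OF j(1)] by (auto simp: smooth_germ_def)
      ultimately show ?thesis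
        unfolding j(3) n using smooth_factor[OF smooth_germ_order[OF sm[OF j(1)]] j(4,2)] j(5) by simp
    qed
    then show "simple_tangents k f \<and> \<not> common_zero k f (Suc k) f"
      unfolding simple_tangents_def common_zero_def n by auto
  }
  {
    assume *: "simple_tangents k f \<and> \<not> common_zero k f (Suc k) f"
    then obtain g where g: "ordinary_branches k f g" using ordinary_branches_exist[OF assms(1-3)] by blast
    then obtain e where e: "f = e * (\<Prod>j<k. g j)" and sm: "\<And>j. j < k \<Longrightarrow> smooth_germ (g j)"
      unfolding ordinary_branches_def by blast
    have "germ_int_mult (g j) (tangent_line (g j)) = 2" if "j < k" for j
      unfolding tangent_line_int_mult[OF sm[OF that]]
    proof
      assume "common_zero 1 (g j) 2 (g j)"
      then obtain x y where xy: "x \<noteq> 0 \<or> y \<noteq> 0" "line x y (g j) $ 1 = 0" "line x y (g j) $ 2 = 0"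
        by (auto simp: common_zero_def)
      define h where "h = e * (\<Prod>i\<in>{..<k} - {j}. g i)"
      have h: "order_ge n h"
        using unit_times_smooth[of "{..<k} - {j}" g e x y] sm smooth_germ_order that n by (auto simp: h_def)
      have f: "f = g j * h"
        unfolding e h_def using that by (simp add: prod.remove[of "{..<k}" j] mult_ac)
      have og: "order_ge 1 (g j)" by (rule smooth_germ_order[OF sm[OF that]])
      have "line x y f $ k = 0" using line_mult_leading(1)[OF og h, of x y] xy by (simp add: f n)
      moreover have "line x y f $ Suc k = 0" using smooth_factor(3)[OF og h xy(2)] xy(3) by (simp add: f n)
      ultimately show False using * xy(1) by (auto simp: common_zero_def)
    qed
    with g show "ordinary_simple_germ k f" by (auto simp: ordinary_simple_germ_def)
  }
qed

section \<open>Polynomials in affine charts\<close>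

unbundle vec_syntax
unbundle no fps_syntax

section \<open>The chain rule for polynomial substitution\<close>

lemma poly_map_poly_add:
  assumes "f 0 = 0" "g 0 = 0"
  shows "poly (map_poly (\<lambda>a. f a + g a) p) x = poly (map_poly f p) x + poly (map_poly g p) x"
  using assms by (induction p) (simp_all add: map_poly_pCons algebra_simps)

lemma poly_map_poly_mult_right:
  assumes "\<phi> 0 = 0" "\<theta> 0 = 0"
  shows "poly (map_poly (\<lambda>a. \<phi> (\<theta> a) * c) p) x = poly (map_poly \<phi> (map_poly \<theta> p)) x * c"
  using assms by (induction p) (simp_all add: map_poly_pCons algebra_simps)

text \<open>The derivation \<open>D\<close> may act nontrivially on the coefficients through
  \<open>\<psi>\<close>. This is what iterated polynomial rings require: the coefficients contain
  the inner variables.\<close>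

lemma derivation_poly:
  assumes "ring_hom_map \<phi>" "\<psi> 0 = 0"
    and D: "\<And>f g. D (f + g) = D f + D g" "\<And>f g. D (f * g) = f * D g + D f * g" "\<And>a. D (\<phi> a) = \<psi> a"
  shows "D (poly (map_poly \<phi> p) x) = poly (map_poly \<psi> p) x + poly (map_poly \<phi> (pderiv p)) x * D x"
proof -
  interpret \<phi>: ring_hom_map \<phi> by fact
  interpret ev: ring_hom_map "\<lambda>p. poly (map_poly \<phi> p) x" by (rule poly_map_poly_hom) fact
  have D0: "D 0 = 0" using D(1)[of 0 0] by simp
  show ?thesis
    by (induction p)
      (simp_all add: D0 D map_poly_pCons \<phi>.hom_zero assms(2) pderiv_pCons ev.hom_add algebra_simps)
qed

lemma partial_simps:
  "partial 1 F = pderiv F" "partial 2 F = map_poly pderiv F" "partial 3 F = map_poly (map_poly pderiv) F"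
  by (simp_all add: partial_def)

lemma derivation_peval:
  fixes D :: "series2 \<Rightarrow> series2"
  assumes D: "\<And>f g. D (f + g) = D f + D g" "\<And>f g. D (f * g) = f * D g + D f * g" "\<And>c. D (const2 c) = 0"
  shows "D (peval const2 F X) = (\<Sum>i\<in>UNIV. peval const2 (partial i F) X * D (X $ i))"
proof -
  define \<phi>3 where "\<phi>3 r = poly (map_poly const2 r) (X $ 3)" for r
  define \<phi>2 where "\<phi>2 q = poly (map_poly \<phi>3 q) (X $ 2)" for q
  have pe: "peval const2 G X = poly (map_poly \<phi>2 G) (X $ 1)" for G
    unfolding peval_def \<phi>2_def \<phi>3_def ..
  have h3: "ring_hom_map \<phi>3" unfolding \<phi>3_def by (intro poly_map_poly_hom ring_hom_map_const2)
  then have h2: "ring_hom_map \<phi>2" unfolding \<phi>2_def by (rule poly_map_poly_hom)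
  interpret \<phi>3: ring_hom_map \<phi>3 by (rule h3)
  interpret \<phi>2: ring_hom_map \<phi>2 by (rule h2)
  have zero: "map_poly (\<lambda>_. 0 :: series2) r = 0" for r :: "complex poly"
    by (intro poly_eqI) (simp add: coeff_map_poly)
  have D3: "D (\<phi>3 r) = \<phi>3 (pderiv r) * D (X $ 3)" for r
    unfolding \<phi>3_def using derivation_poly[OF ring_hom_map_const2, of "\<lambda>_. 0" D r "X $ 3"] D
    by (simp add: zero)
  have D2: "D (\<phi>2 q) = \<phi>2 (map_poly pderiv q) * D (X $ 3) + \<phi>2 (pderiv q) * D (X $ 2)" for q
  proof -
    have "D (\<phi>2 q) = poly (map_poly (\<lambda>r. \<phi>3 (pderiv r) * D (X $ 3)) q) (X $ 2) + \<phi>2 (pderiv q) * D (X $ 2)"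
      unfolding \<phi>2_def by (rule derivation_poly[OF h3]) (auto simp: D D3 \<phi>3.hom_zero)
    then show ?thesis
      by (simp add: \<phi>2_def poly_map_poly_mult_right \<phi>3.hom_zero)
  qed
  have "D (poly (map_poly \<phi>2 F) (X $ 1)) =
      poly (map_poly (\<lambda>q. \<phi>2 (map_poly pderiv q) * D (X $ 3) + \<phi>2 (pderiv q) * D (X $ 2)) F) (X $ 1)
      + poly (map_poly \<phi>2 (pderiv F)) (X $ 1) * D (X $ 1)"
    by (rule derivation_poly[OF h2]) (auto simp: D D2 \<phi>2.hom_zero)
  also have "poly (map_poly (\<lambda>q. \<phi>2 (map_poly pderiv q) * D (X $ 3) + \<phi>2 (pderiv q) * D (X $ 2)) F) (X $ 1)
      = poly (map_poly \<phi>2 (map_poly (map_poly pderiv) F)) (X $ 1) * D (X $ 3)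
      + poly (map_poly \<phi>2 (map_poly pderiv F)) (X $ 1) * D (X $ 2)"
    by (simp add: poly_map_poly_add poly_map_poly_mult_right \<phi>2.hom_zero)
  finally show ?thesis
    by (simp add: pe sum_3 partial_simps)
qed

section \<open>Partial derivatives and Euler's relation in three variables\<close>

abbreviation coeff3 :: "poly3 \<Rightarrow> nat \<Rightarrow> nat \<Rightarrow> nat \<Rightarrow> complex" where
  "coeff3 F i j l \<equiv> coeff (coeff (coeff F i) j) l"

lemma poly3_eqI: "(\<And>i j l. coeff3 F i j l = coeff3 G i j l) \<Longrightarrow> F = G"
  by (simp add: poly_eq_iff)

lemma coeff_of_nat_mult: "coeff (of_nat n * p) i = of_nat n * coeff p i"
  for p :: "'a::comm_semiring_1 poly"
  by (induction n) (simp_all add: algebra_simps)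

lemma coeff3_partial:
  "coeff3 (partial 1 F) i j l = of_nat (Suc i) * coeff3 F (Suc i) j l"
  "coeff3 (partial 2 F) i j l = of_nat (Suc j) * coeff3 F i (Suc j) l"
  "coeff3 (partial 3 F) i j l = of_nat (Suc l) * coeff3 F i j (Suc l)"
  by (simp_all only: partial_simps coeff_pderiv coeff_map_poly pderiv_0 map_poly_0 coeff_of_nat_mult)

lemma partial_commute: "partial i (partial j F) = partial j (partial i F)"
proof -
  have "\<forall>i j. partial i (partial j F) = partial j (partial i F)"
    unfolding forall_3
    by (intro conjI refl; rule poly3_eqI; simp only: coeff3_partial mult.left_commute)
  then show ?thesis by blast
qed

text \<open>For \<open>d = 0\<close> all derivatives vanish, so the truncated subtraction
  \<open>d - 1\<close> does no harm.\<close>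

lemma homogeneous_partial:
  assumes "homogeneous d F"
  shows "homogeneous (d - 1) (partial i F)"
proof -
  have *: "i + j + l = d" if "coeff3 F i j l \<noteq> 0" for i j l
    using assms that by (auto simp: homogeneous_def)
  have "\<forall>i. homogeneous (d - 1) (partial i F)"
    unfolding forall_3 homogeneous_def
    by (auto simp: coeff3_partial simp del: of_nat_Suc dest!: *)
  then show ?thesis by blast
qed

definition var3 :: "3 \<Rightarrow> poly3" where
  "var3 i = (if i = 1 then [:0, 1:] else if i = 2 then [:[:0, 1:]:] else [:[:[:0, 1:]:]:])"

lemma euler_poly3:
  assumes "homogeneous d F"
  shows "(\<Sum>i\<in>UNIV. var3 i * partial i F) = of_nat d * F"
proof (rule poly3_eqI)
  fix i j l
  have 1: "coeff3 (var3 1 * partial 1 F) i j l = of_nat i * coeff3 F i j l"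
    by (cases i) (simp_all add: var3_def coeff3_partial del: of_nat_Suc)
  have 2: "coeff3 (var3 2 * partial 2 F) i j l = of_nat j * coeff3 F i j l"
    by (cases j) (simp_all add: var3_def coeff3_partial del: of_nat_Suc)
  have 3: "coeff3 (var3 3 * partial 3 F) i j l = of_nat l * coeff3 F i j l"
    by (cases l) (simp_all add: var3_def coeff3_partial del: of_nat_Suc)
  have "of_nat i * coeff3 F i j l + of_nat j * coeff3 F i j l + of_nat l * coeff3 F i j l = of_nat d * coeff3 F i j l"
  proof (cases "coeff3 F i j l = 0")
    case False
    then have "d = i + j + l" using assms by (auto simp: homogeneous_def)
    then show ?thesis by (simp add: algebra_simps)
  qed simp
  then show "coeff3 (\<Sum>i\<in>UNIV. var3 i * partial i F) i j l = coeff3 (of_nat d * F) i j l"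
    by (simp add: sum_3 1 2 3 coeff_of_nat_mult)
qed

lemma peval_var3: "peval const2 (var3 i) X = X $ i"
proof -
  have "\<forall>i. peval const2 (var3 i) X = X $ i"
    unfolding forall_3 by (simp add: var3_def peval_def map_poly_pCons const2.hom_simps)
  then show ?thesis by blast
qed

interpretation peval: ring_hom_map "\<lambda>F. peval const2 F X" for X
  by (intro peval_hom ring_hom_map_const2)

lemma euler_peval:
  assumes "homogeneous d F"
  shows "(\<Sum>i\<in>UNIV. X $ i * peval const2 (partial i F) X) = of_nat d * peval const2 F X"
  using arg_cong[OF euler_poly3[OF assms], of "\<lambda>F. peval const2 F X"]
  by (simp add: peval.hom_simps peval_var3)

section \<open>The Hessian in an affine chart\<close>

definition chart_point :: "complex^3 \<Rightarrow> complex^3 \<Rightarrow> complex^3 \<Rightarrow> series2^3" where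
  "chart_point p a b = (\<chi> i. const2 (p $ i) + const2 (a $ i) * var_u + const2 (b $ i) * var_v)"

definition frame :: "'a^3 \<Rightarrow> 'a^3 \<Rightarrow> 'a^3 \<Rightarrow> 'a^3^3" where
  "frame p a b = (\<chi> i j. if j = 1 then p $ i else if j = 2 then a $ i else b $ i)"

definition const_vec :: "complex^3 \<Rightarrow> series2^3" where
  "const_vec a = (\<chi> i. const2 (a $ i))"

text \<open>The moving point differs from \<open>p\<close> by a combination of the other two
  columns, so the determinant does not depend on \<open>u\<close> and \<open>v\<close>.\<close>

lemma det_frame_chart_point:
  "det (frame (chart_point p a b) (const_vec a) (const_vec b)) = const2 (det (frame p a b))"
  by (simp add: det_3 frame_def chart_point_def const_vec_def const2.hom_simps) algebra

lemma deriv_u_const2 [simp]: "fps_deriv (const2 c) = 0"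
  by (simp add: const2_def)

lemma deriv_v_const2 [simp]: "deriv_v (const2 c) = 0"
  by (rule series2_eqI) (simp add: coeff2_deriv_v coeff2_const2)

lemma deriv_v_var: "deriv_v var_u = 0" "deriv_v var_v = 1"
  by (rule series2_eqI, simp add: coeff2_deriv_v coeff2_var_u,
      rule series2_eqI, auto simp: coeff2_deriv_v coeff2_var_v)

lemma deriv_u_var: "fps_deriv var_u = 1" "fps_deriv var_v = 0"
  by (simp_all add: var_u_def var_v_def)

context
  fixes p a b :: "complex^3"
begin

abbreviation "ev G \<equiv> peval const2 G (chart_point p a b)"

lemma deriv_u_ev: "fps_deriv (ev G) = (\<Sum>i\<in>UNIV. const2 (a $ i) * ev (partial i G))"
proof -
  have "fps_deriv (chart_point p a b $ i) = const2 (a $ i)" for i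
    by (simp add: chart_point_def deriv_u_var)
  then show ?thesis
    using derivation_peval[of fps_deriv G "chart_point p a b"] by (simp add: mult.commute)
qed

lemma deriv_v_ev: "deriv_v (ev G) = (\<Sum>i\<in>UNIV. const2 (b $ i) * ev (partial i G))"
proof -
  have "deriv_v (chart_point p a b $ i) = const2 (b $ i)" for i
    by (simp add: chart_point_def deriv_v_add deriv_v_mult deriv_v_var)
  then show ?thesis
    using derivation_peval[of deriv_v G "chart_point p a b"] by (simp add: mult.commute deriv_v_add deriv_v_mult)
qed

lemma euler_ev:
  "homogeneous d G \<Longrightarrow> (\<Sum>i\<in>UNIV. chart_point p a b $ i * ev (partial i G)) = of_nat d * ev G"
  by (rule euler_peval)

lemma conv_ev: "ev G \<in> conv_series"
proof -
  have X: "chart_point p a b $ i \<in> conv_series" for i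
    by (simp add: chart_point_def) (intro conv_series_intros)
  have level: "poly (map_poly \<phi> q) x \<in> conv_series"
    if "\<And>a. \<phi> a \<in> conv_series" "x \<in> conv_series" "\<phi> 0 = 0" for \<phi> :: "'a::zero \<Rightarrow> series2" and q x
    using that by (induction q) (auto simp: map_poly_pCons intro!: conv_series_intros)
  show ?thesis
    unfolding peval_def by (intro level X conv_series_const2) (simp_all add: const2.hom_zero)
qed

text \<open>Conjugate the matrix \<open>H\<close> of second derivatives by the frame
  \<open>N\<close> with columns the moving point and its derivatives in \<open>u\<close> and
  \<open>v\<close>. Contracting with the derivative columns differentiates in the chart, contracting
  with the point is Euler's relation. So \<open>transpose N ** H ** N\<close> has corner
  \<open>d * (d - 1) * f\<close>, border \<open>(d - 1) * fu\<close> and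
  \<open>(d - 1) * fv\<close>, and the affine second derivatives as its block; the claim expands
  this determinant.\<close>

lemma hessian_frame:
  assumes "homogeneous d F" "d > 0"
  defines "f \<equiv> ev F"
  defines "fu \<equiv> fps_deriv f" and "fv \<equiv> deriv_v f"
  defines "fuu \<equiv> fps_deriv fu" and "fuv \<equiv> fps_deriv fv" and "fvv \<equiv> deriv_v fv"
  shows "const2 (det (frame p a b)) ^ 2 * ev (hessian F) =
    of_nat (d * (d - 1)) * f * (fuu * fvv - fuv * fuv)
    - of_nat ((d - 1) ^ 2) * (fu * fu * fvv - 2 * (fu * fv * fuv) + fv * fv * fuu)"
proof -
  define X where "X = chart_point p a b"
  define A where "A = const_vec a"
  define B where "B = const_vec b"
  define N where "N = frame X A B"
  define u where "u j = ev (partial j F)" for j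
  define H where "H = (\<chi> i j. ev (partial i (partial j F)))"
  have sym: "H $ i $ j = H $ j $ i" for i j by (simp add: H_def partial_commute)
  have XH: "(\<Sum>i\<in>UNIV. X $ i * H $ i $ j) = of_nat (d - 1) * u j" for j
    using euler_peval[OF homogeneous_partial[OF assms(1)], of X j] by (simp add: X_def H_def u_def)
  have Xu: "(\<Sum>i\<in>UNIV. X $ i * u i) = of_nat d * f"
    using euler_peval[OF assms(1), of X] by (simp add: X_def u_def f_def)
  have AH: "(\<Sum>i\<in>UNIV. A $ i * H $ i $ j) = fps_deriv (u j)" for j
    using deriv_u_ev[of "partial j F"] by (simp add: A_def const_vec_def H_def u_def)
  have BH: "(\<Sum>i\<in>UNIV. B $ i * H $ i $ j) = deriv_v (u j)" for j
    using deriv_v_ev[of "partial j F"] by (simp add: B_def const_vec_def H_def u_def)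
  have Au: "(\<Sum>i\<in>UNIV. A $ i * u i) = fu"
    using deriv_u_ev[of F] by (simp add: A_def const_vec_def u_def fu_def f_def)
  have Bu: "(\<Sum>i\<in>UNIV. B $ i * u i) = fv"
    using deriv_v_ev[of F] by (simp add: B_def const_vec_def u_def fv_def f_def)
  have fuu: "fuu = (\<Sum>j\<in>UNIV. fps_deriv (u j) * A $ j)"
    unfolding fuu_def Au[symmetric] by (simp add: sum_3 A_def const_vec_def mult.commute)
  have fuv: "fuv = (\<Sum>j\<in>UNIV. fps_deriv (u j) * B $ j)"
    unfolding fuv_def Bu[symmetric] by (simp add: sum_3 B_def const_vec_def mult.commute)
  have fvv: "fvv = (\<Sum>j\<in>UNIV. deriv_v (u j) * B $ j)"
    unfolding fvv_def Bu[symmetric] by (simp add: sum_3 B_def const_vec_def mult.commute deriv_v_add deriv_v_mult)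
  define Q where "Q = transpose N ** H ** N"
  have Q: "Q $ k $ l = (\<Sum>j\<in>UNIV. (\<Sum>i\<in>UNIV. N $ i $ k * H $ i $ j) * N $ j $ l)" for k l
    by (simp add: Q_def matrix_matrix_mult_def transpose_def)
  have symQ: "Q $ k $ l = Q $ l $ k" for k l
  proof -
    have "Q $ k $ l = (\<Sum>j\<in>UNIV. \<Sum>i\<in>UNIV. N $ i $ k * H $ i $ j * N $ j $ l)"
      unfolding Q sum_distrib_right ..
    also have "\<dots> = (\<Sum>i\<in>UNIV. \<Sum>j\<in>UNIV. N $ i $ k * H $ i $ j * N $ j $ l)"
      by (rule sum.swap)
    also have "\<dots> = (\<Sum>i\<in>UNIV. \<Sum>j\<in>UNIV. N $ j $ l * H $ j $ i * N $ i $ k)"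
      using sym by (intro sum.cong refl) (simp add: mult_ac)
    also have "\<dots> = Q $ l $ k"
      unfolding Q sum_distrib_right ..
    finally show ?thesis .
  qed
  have N: "N $ i $ 1 = X $ i" "N $ i $ 2 = A $ i" "N $ i $ 3 = B $ i" for i
    by (simp_all add: N_def frame_def)
  have pull: "(\<Sum>j\<in>UNIV. of_nat (d - 1) * u j * Y j) = of_nat (d - 1) * (\<Sum>j\<in>UNIV. Y j * u j)" for Y
    by (simp add: sum_distrib_left mult_ac)
  have "Q $ 1 $ 1 = of_nat (d - 1) * (of_nat d * f)"
    unfolding Q N XH pull Xu ..
  moreover have "Q $ 1 $ 2 = of_nat (d - 1) * fu"
    unfolding Q N XH pull Au ..
  moreover have "Q $ 1 $ 3 = of_nat (d - 1) * fv"
    unfolding Q N XH pull Bu ..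
  moreover have "Q $ 2 $ 2 = fuu" unfolding Q N AH fuu ..
  moreover have "Q $ 2 $ 3 = fuv" unfolding Q N AH fuv ..
  moreover have "Q $ 3 $ 3 = fvv" unfolding Q N BH fvv ..
  moreover note symQ[of 2 1] symQ[of 3 1] symQ[of 3 2]
  ultimately have "det Q = of_nat (d - 1) * (of_nat d * f) * fuu * fvv
      + of_nat (d - 1) * fu * fuv * (of_nat (d - 1) * fv)
      + of_nat (d - 1) * fv * (of_nat (d - 1) * fu) * fuv
      - of_nat (d - 1) * (of_nat d * f) * fuv * fuv
      - of_nat (d - 1) * fu * (of_nat (d - 1) * fu) * fvv
      - of_nat (d - 1) * fv * fuu * (of_nat (d - 1) * fv)"
    unfolding det_3 by (simp only:)
  moreover have "det Q = det N * det H * det N"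
    by (simp add: Q_def det_mul det_transpose)
  moreover have "det N = const2 (det (frame p a b))"
    unfolding N_def X_def A_def B_def by (rule det_frame_chart_point)
  moreover have "ev (hessian F) = det H"
    unfolding hessian_def H_def det_3 by (simp add: peval.hom_simps)
  ultimately show ?thesis
    by (simp only: of_nat_mult of_nat_power power2_eq_square) algebra
qed

text \<open>Euler's relation and the two chart derivatives give three linear equations for the
  partial derivatives, whose determinant is a nonzero constant.\<close>

lemma ev_partials_0:
  assumes "det (frame p a b) \<noteq> 0" "homogeneous d G" "ev G = 0"
  shows "ev (partial i G) = 0"
proof -
  define N where "N = frame (chart_point p a b) (const_vec a) (const_vec b)"
  define w where "w i = ev (partial i G)" for i
  have "(\<Sum>i\<in>UNIV. N $ i $ j * w i) = 0" for j
  proof -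
    have z: "fps_deriv (ev G) = 0" "deriv_v (ev G) = 0" "of_nat d * ev G = 0"
      by (simp_all add: assms(3) deriv_v_def fps_eq_iff)
    have "\<forall>j. (\<Sum>i\<in>UNIV. N $ i $ j * w i) = 0"
      using z unfolding deriv_u_ev deriv_v_ev euler_ev[OF assms(2), symmetric] forall_3
      by (simp add: N_def frame_def w_def const_vec_def)
    then show ?thesis by blast
  qed
  then have w: "N $ 1 $ j * w 1 + N $ 2 $ j * w 2 + N $ 3 $ j * w 3 = 0" for j
    by (simp add: sum_3)
  have cramer: "det N * w 1 = 0" "det N * w 2 = 0" "det N * w 3 = 0"
    using w[of 1] w[of 2] w[of 3] unfolding det_3 by algebra+
  have "\<forall>i. w i = 0"
    using cramer assms(1) unfolding forall_3 by (simp add: N_def det_frame_chart_point)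
  then show ?thesis by (simp add: w_def)
qed

end

text \<open>Induction on the degree: if the germ vanishes, so do those of the partial derivatives,
  hence these are zero and Euler's relation leaves no room for \<open>G\<close>. Its use is that the
  local equation of a nonzero form is nonzero, so the minimum in \<open>germ_mult\<close> is
  attained.\<close>

lemma ev_eq_0_imp:
  assumes "det (frame p a b) \<noteq> 0" "homogeneous d G" "peval const2 G (chart_point p a b) = 0"
  shows "G = 0"
  using assms(2,3)
proof (induction d arbitrary: G)
  case 0
  then have c: "coeff3 G i j l = 0" if "i + j + l \<noteq> 0" for i j l
    using that by (auto simp: homogeneous_def)
  have "G = [:[:[:coeff3 G 0 0 0:]:]:]"
  proof (rule poly3_eqI)
    fix i j l show "coeff3 G i j l = coeff3 [:[:[:coeff3 G 0 0 0:]:]:] i j l"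
      using c[of i j l] by (auto simp: coeff_pCons split: nat.splits)
  qed
  moreover from this have "peval const2 G X = const2 (coeff3 G 0 0 0)" for X
  proof -
    have "peval const2 [:[:[:c:]:]:] X = const2 c" for c
      by (simp add: peval_def map_poly_pCons const2.hom_simps)
    with \<open>G = _\<close> show ?thesis by metis
  qed
  ultimately show ?case using 0(2) by simp
next
  case (Suc d)
  have "partial i G = 0" for i
    using Suc.IH[of "partial i G"] homogeneous_partial[OF Suc.prems(1), of i]
      ev_partials_0[OF assms(1) Suc.prems] by simp
  then have "of_nat (Suc d) * G = 0" using euler_poly3[OF Suc.prems(1)] by simp
  then have "of_nat (Suc d) * coeff3 G i j l = 0" for i j l
    by (metis coeff_of_nat_mult coeff_0)
  then show ?case by (intro poly3_eqI) (simp del: of_nat_Suc)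
qed

lemma chart_dirs_frame:
  assumes "p \<noteq> 0"
  shows "det (frame p (fst (chart_dirs p)) (snd (chart_dirs p))) \<noteq> 0"
proof -
  have "p $ 1 \<noteq> 0 \<or> p $ 2 \<noteq> 0 \<or> p $ 3 \<noteq> 0"
    using assms by (auto simp: vec_eq_iff forall_3)
  then show ?thesis
    by (auto simp: chart_dirs_def det_3 frame_def axis_def)
qed

lemma germ_at_eq:
  "germ_at F p = peval const2 F (chart_point p (fst (chart_dirs p)) (snd (chart_dirs p)))"
  by (simp add: germ_at_def chart_point_def split: prod.splits)

lemma coeff2_peval_chart_point: "coeff2 (peval const2 G (chart_point p a b)) 0 0 = peval id G p"
proof -
  have hom: "ring_hom_map (\<lambda>f. coeff2 f 0 0)"
    by unfold_locales auto
  interpret h: ring_hom_map "\<lambda>f. coeff2 f 0 0" by (rule hom)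
  have level: "coeff2 (poly (map_poly \<phi> q) x) 0 0 = poly (map_poly \<psi> q) (coeff2 x 0 0)"
    if "\<And>a. coeff2 (\<phi> a) 0 0 = \<psi> a" "\<phi> 0 = 0" "\<psi> 0 = 0" for \<phi> \<psi> and q :: "'b::zero poly" and x
    using that by (induction q) (auto simp: map_poly_pCons)
  have X: "coeff2 (chart_point p a b $ i) 0 0 = p $ i" for i
    by (simp add: chart_point_def coeff2_const2 coeff2_var_u coeff2_var_v)
  show ?thesis
    unfolding peval_def X[symmetric]
    by (intro level) (auto simp: const2.hom_zero coeff2_const2)
qed

section \<open>The reduced Hessian\<close>

unbundle no vec_syntax
unbundle fps_syntax

text \<open>The linear factor produced by differentiation is bounded by a power of 2 and absorbed by
  halving the radius; the index shift \<open>(a, b)\<close> costs a constant power of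
  \<open>r\<close>.\<close>

lemma conv_series_deriv_bound:
  assumes "f \<in> conv_series" "\<And>i j. norm (coeff2 g i j) \<le> real (Suc (i + j)) * norm (coeff2 f (i + a) (j + b))"
  shows "g \<in> conv_series"
proof -
  obtain r M where r: "r > 0" and M: "\<And>i j. norm (coeff2 f i j) * r ^ (i + j) \<le> M"
    using assms(1) unfolding conv_series_def by blast
  have "norm (coeff2 g i j) * (r / 2) ^ (i + j) \<le> M / r ^ (a + b)" for i j
  proof -
    have "norm (coeff2 g i j) * (r / 2) ^ (i + j)
        \<le> real (Suc (i + j)) * norm (coeff2 f (i + a) (j + b)) * (r / 2) ^ (i + j)"
      using assms(2)[of i j] r by (intro mult_right_mono) auto
    also have "\<dots> \<le> 2 ^ (i + j) * norm (coeff2 f (i + a) (j + b)) * (r / 2) ^ (i + j)"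
      using real_Suc_le_two_power[of "i + j"] r by (intro mult_right_mono) auto
    also have "\<dots> = norm (coeff2 f (i + a) (j + b)) * r ^ ((i + a) + (j + b)) / r ^ (a + b)"
      using r by (simp add: power_divide power_add)
    also have "\<dots> \<le> M / r ^ (a + b)"
      using M[of "i + a" "j + b"] r by (intro divide_right_mono) auto
    finally show ?thesis .
  qed
  with r show ?thesis
    unfolding conv_series_def mem_Collect_eq
    by (intro exI[of _ "r / 2"] conjI exI[of _ "M / r ^ (a + b)"] allI) auto
qed

lemma conv_series_deriv_u: "f \<in> conv_series \<Longrightarrow> fps_deriv f \<in> conv_series"
  by (rule conv_series_deriv_bound[of f _ 1 0])
    (auto simp: coeff2_deriv_u norm_mult simp del: fps_deriv_nth of_nat_Suc intro!: mult_right_mono)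

lemma conv_series_deriv_v: "f \<in> conv_series \<Longrightarrow> deriv_v f \<in> conv_series"
  by (rule conv_series_deriv_bound[of f _ 0 1])
    (auto simp: coeff2_deriv_v norm_mult simp del: of_nat_Suc intro!: mult_right_mono)

lemma line_mult3_leading:
  assumes "order_ge l f" "order_ge m g" "order_ge n h"
  shows "line x y (f * g * h) $ (l + m + n) = line x y f $ l * line x y g $ m * line x y h $ n"
    and "line x y (f * g * h) $ Suc (l + m + n) =
      line x y f $ l * line x y g $ m * line x y h $ Suc n + line x y f $ l * line x y g $ Suc m * line x y h $ n
      + line x y f $ Suc l * line x y g $ m * line x y h $ n"
  using line_mult_leading[OF order_ge_mult[OF assms(1,2)] assms(3), of x y]
    line_mult_leading[OF assms(1,2), of x y]
  by (simp_all add: algebra_simps)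

text \<open>\<open>bordered f\<close> agrees with the Hessian up to a unit modulo \<open>f\<close>. Its leading form is a multiple
  of the leading form of \<open>f\<close>, which \<open>reduced_hessian\<close> removes.\<close>

definition hess2 :: "series2 \<Rightarrow> series2" where
  "hess2 f = fps_deriv (fps_deriv f) * deriv_v (deriv_v f) - fps_deriv (deriv_v f) * fps_deriv (deriv_v f)"

definition bordered :: "series2 \<Rightarrow> series2" where
  "bordered f = fps_deriv f * fps_deriv f * deriv_v (deriv_v f)
     - 2 * (fps_deriv f * deriv_v f * fps_deriv (deriv_v f))
     + deriv_v f * deriv_v f * fps_deriv (fps_deriv f)"

definition reduced_hessian :: "nat \<Rightarrow> series2 \<Rightarrow> series2" where
  "reduced_hessian k f = bordered f - const2 (of_nat k / of_nat (k - 1)) * (f * hess2 f)"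

lemma conv_series_hess2: "f \<in> conv_series \<Longrightarrow> hess2 f \<in> conv_series"
  unfolding hess2_def by (intro conv_series_intros conv_series_deriv_u conv_series_deriv_v)

lemma conv_series_reduced_hessian: "f \<in> conv_series \<Longrightarrow> reduced_hessian k f \<in> conv_series"
proof -
  assume f: "f \<in> conv_series"
  have "bordered f = fps_deriv f * fps_deriv f * deriv_v (deriv_v f)
     - const2 2 * (fps_deriv f * deriv_v f * fps_deriv (deriv_v f))
     + deriv_v f * deriv_v f * fps_deriv (fps_deriv f)"
    using const2.hom_of_nat[of 2] by (simp add: bordered_def)
  then show ?thesis
    unfolding reduced_hessian_def
    using f by (auto intro!: conv_series_intros conv_series_deriv_u conv_series_deriv_v conv_series_hess2)
qed

section \<open>The lowest homogeneous parts of the reduced Hessian\<close>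

context
  fixes f :: series2 and n :: nat
  assumes ord: "order_ge (Suc (Suc n)) f"
begin

lemma orders:
  "order_ge (Suc n) (fps_deriv f)" "order_ge (Suc n) (deriv_v f)"
  "order_ge n (fps_deriv (fps_deriv f))" "order_ge n (fps_deriv (deriv_v f))" "order_ge n (deriv_v (deriv_v f))"
  using ord order_ge_deriv_u order_ge_deriv_v by blast+

text \<open>With \<open>k = n + 2\<close> the two degrees are \<open>3 * k - 4\<close> and
  \<open>3 * k - 3\<close>. Unprimed letters are the lowest parts of \<open>f\<close> and its
  derivatives at \<open>(x, y)\<close>, primed letters the next ones; in the higher degree every
  product contains exactly one primed factor.\<close>

lemma line_reduced_hessian:
  fixes x y :: complex
  defines "A \<equiv> line x y f $ Suc (Suc n)" and "A' \<equiv> line x y f $ Suc (Suc (Suc n))"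
    and "U \<equiv> line x y (fps_deriv f) $ Suc n" and "U' \<equiv> line x y (fps_deriv f) $ Suc (Suc n)"
    and "V \<equiv> line x y (deriv_v f) $ Suc n" and "V' \<equiv> line x y (deriv_v f) $ Suc (Suc n)"
    and "P \<equiv> line x y (fps_deriv (fps_deriv f)) $ n" and "P' \<equiv> line x y (fps_deriv (fps_deriv f)) $ Suc n"
    and "W \<equiv> line x y (fps_deriv (deriv_v f)) $ n" and "W' \<equiv> line x y (fps_deriv (deriv_v f)) $ Suc n"
    and "S \<equiv> line x y (deriv_v (deriv_v f)) $ n" and "S' \<equiv> line x y (deriv_v (deriv_v f)) $ Suc n"
    and "c \<equiv> of_nat (Suc (Suc n)) / of_nat (Suc n) :: complex"
  shows "line x y (reduced_hessian (Suc (Suc n)) f) $ (3 * n + 2) =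
      U * U * S - 2 * (U * V * W) + V * V * P - c * (A * (P * S - W * W))"
    and "line x y (reduced_hessian (Suc (Suc n)) f) $ (3 * n + 3) =
      (U * U * S' + 2 * U * U' * S) - 2 * (U * V * W' + U * V' * W + U' * V * W) + (V * V * P' + 2 * V * V' * P)
      - c * (A * (P * S' + P' * S - 2 * W * W') + A' * (P * S - W * W))"
proof -
  note o = orders
  have two: "line x y 2 = 2" using line.hom_of_nat[of x y 2] by simp
  have twon: "(2 * Q) $ m = 2 * Q $ m" for Q :: "complex fps" and m
    by (simp only: mult_2 fps_add_nth)
  have cst: "(fps_const z * Q) $ m = z * Q $ m" for z and Q :: "complex fps" and m by simp
  have i1: "Suc n + Suc n + n = 3 * n + 2" "n + n + Suc (Suc n) = 3 * n + 2" "Suc (3 * n + 2) = 3 * n + 3"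
    by simp_all
  have d: "line x y (reduced_hessian (Suc (Suc n)) f) $ m =
    line x y (fps_deriv f * fps_deriv f * deriv_v (deriv_v f)) $ m
    - 2 * line x y (fps_deriv f * deriv_v f * fps_deriv (deriv_v f)) $ m
    + line x y (deriv_v f * deriv_v f * fps_deriv (fps_deriv f)) $ m
    - c * (line x y (fps_deriv (fps_deriv f) * deriv_v (deriv_v f) * f) $ m
         - line x y (fps_deriv (deriv_v f) * fps_deriv (deriv_v f) * f) $ m)" for m
  proof -
    have "reduced_hessian (Suc (Suc n)) f = fps_deriv f * fps_deriv f * deriv_v (deriv_v f)
      - 2 * (fps_deriv f * deriv_v f * fps_deriv (deriv_v f))
      + deriv_v f * deriv_v f * fps_deriv (fps_deriv f)
      - const2 c * (fps_deriv (fps_deriv f) * deriv_v (deriv_v f) * f - fps_deriv (deriv_v f) * fps_deriv (deriv_v f) * f)"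
      by (simp add: reduced_hessian_def bordered_def hess2_def c_def algebra_simps)
    then show ?thesis
      by (simp only: line.hom_diff line.hom_add line.hom_mult[of _ _ 2] line.hom_mult[of _ _ "const2 c"] two twon line_const2
          fps_sub_nth fps_add_nth cst)
  qed
  note L = line_mult3_leading[OF o(1,1,5), of x y] line_mult3_leading[OF o(1,2,4), of x y]
    line_mult3_leading[OF o(2,2,3), of x y] line_mult3_leading[OF o(3,5) ord, of x y]
    line_mult3_leading[OF o(4,4) ord, of x y]
  note L' = L[unfolded i1]
  show "line x y (reduced_hessian (Suc (Suc n)) f) $ (3 * n + 2) =
      U * U * S - 2 * (U * V * W) + V * V * P - c * (A * (P * S - W * W))"
    unfolding d L' by (simp add: A_def U_def V_def P_def W_def S_def algebra_simps)
  show "line x y (reduced_hessian (Suc (Suc n)) f) $ (3 * n + 3) =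
      (U * U * S' + 2 * U * U' * S) - 2 * (U * V * W' + U * V' * W + U' * V * W) + (V * V * P' + 2 * V * V' * P)
      - c * (A * (P * S' + P' * S - 2 * W * W') + A' * (P * S - W * W))"
    unfolding d L'
    by (simp add: A_def U_def V_def P_def W_def S_def A'_def U'_def V'_def P'_def W'_def S'_def algebra_simps)
qed

lemma euler_relations:
  "x * line x y (fps_deriv f) $ m + y * line x y (deriv_v f) $ m = of_nat (Suc m) * line x y f $ Suc m"
  "x * line x y (fps_deriv (fps_deriv f)) $ m + y * line x y (fps_deriv (deriv_v f)) $ m
     = of_nat (Suc m) * line x y (fps_deriv f) $ Suc m"
  "x * line x y (fps_deriv (deriv_v f)) $ m + y * line x y (deriv_v (deriv_v f)) $ m
     = of_nat (Suc m) * line x y (deriv_v f) $ Suc m"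
  using line_euler[of x y f m] line_euler[of x y "fps_deriv f" m] line_euler[of x y "deriv_v f" m]
  by (simp_all only: deriv_u_deriv_v)

text \<open>The orders of the factors leave only degree \<open>3 * n + 2\<close> to be killed. At
  \<open>(1, t)\<close> Euler's relations express \<open>U\<close>, \<open>P\<close>,
  \<open>W\<close> through \<open>A\<close>, \<open>V\<close>, \<open>S\<close>, and the claim
  becomes a polynomial identity that holds because \<open>c * (k - 1) = k\<close>. Directions with
  \<open>x = 1\<close> suffice, as they determine the polynomial.\<close>

lemma order_reduced_hessian: "order_ge (3 * n + 3) (reduced_hessian (Suc (Suc n)) f)"
proof -
  have low: "order_ge (3 * n + 2) (reduced_hessian (Suc (Suc n)) f)"
  proof -
    note o = orders
    have "order_ge (Suc n + Suc n + n) (fps_deriv f * fps_deriv f * deriv_v (deriv_v f))"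
      "order_ge (Suc n + Suc n + n) (fps_deriv f * deriv_v f * fps_deriv (deriv_v f))"
      "order_ge (Suc n + Suc n + n) (deriv_v f * deriv_v f * fps_deriv (fps_deriv f))"
      by (intro order_ge_mult o)+
    moreover have "order_ge (Suc (Suc n) + (n + n)) (f * hess2 f)"
      unfolding hess2_def by (intro order_ge_mult order_ge_diff ord o)
    moreover have "order_ge m (g * h)" if "order_ge m h" for m g h
      using order_ge_mult[of 0 g m h] that by simp
    moreover have "Suc n + Suc n + n = 3 * n + 2" "Suc (Suc n) + (n + n) = 3 * n + 2" by simp_all
    ultimately show ?thesis
      unfolding reduced_hessian_def bordered_def by (simp only: order_ge_add order_ge_diff)
  qed
  have "line 1 t (reduced_hessian (Suc (Suc n)) f) $ (3 * n + 2) = 0" for t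
  proof -
    define A where "A = line 1 t f $ Suc (Suc n)"
    define U where "U = line 1 t (fps_deriv f) $ Suc n"
    define V where "V = line 1 t (deriv_v f) $ Suc n"
    define P where "P = line 1 t (fps_deriv (fps_deriv f)) $ n"
    define W where "W = line 1 t (fps_deriv (deriv_v f)) $ n"
    define S where "S = line 1 t (deriv_v (deriv_v f)) $ n"
    define m where "m = (of_nat (Suc n) :: complex)"
    define c where "c = (of_nat (Suc (Suc n)) / of_nat (Suc n) :: complex)"
    have m0: "m \<noteq> 0" unfolding m_def by (simp del: of_nat_Suc)
    have mc: "c * m = m + 1" using m0 unfolding c_def m_def by (simp add: field_simps)
    have U: "U = (m + 1) * A - t * V"
      using euler_relations(1)[of 1 t "Suc n"] by (simp add: U_def V_def A_def m_def algebra_simps)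
    have P: "P = m * U - t * W"
      using euler_relations(2)[of 1 t n] by (simp add: U_def P_def W_def m_def algebra_simps)
    have W: "W = m * V - t * S"
      using euler_relations(3)[of 1 t n] by (simp add: V_def S_def W_def m_def algebra_simps)
    have "U * U * S - 2 * (U * V * W) + V * V * P - c * (A * (P * S - W * W)) = 0"
      using mc unfolding P W U by algebra
    then show ?thesis
      unfolding line_reduced_hessian(1) by (simp only: A_def U_def V_def P_def W_def S_def c_def)
  qed
  then have "blow (reduced_hessian (Suc (Suc n)) f) $ (3 * n + 2) = 0"
    by (simp add: blow_eq_0_iff_line)
  moreover have "m < 3 * n + 2 \<or> m = 3 * n + 2" if "m < 3 * n + 3" for m using that by linarith
  ultimately show ?thesis
    using low unfolding order_ge_iff_blow by metis
qed

text \<open>At a zero of the leading form Euler's relation makes its gradient orthogonal to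
  \<open>(x, y)\<close>, hence a multiple of \<open>(y, - x)\<close>. After this substitution the
  remaining expressions are contractions with \<open>(x, y)\<close>, which Euler's relations reduce
  to the next part of \<open>f\<close>.\<close>

lemma reduced_hessian_at_zero:
  assumes xy: "x \<noteq> 0 \<or> y \<noteq> 0" and zero: "line x y f $ Suc (Suc n) = 0"
  obtains \<mu> where "line x y (fps_deriv f) $ Suc n = \<mu> * y" "line x y (deriv_v f) $ Suc n = - \<mu> * x"
    "line x y (reduced_hessian (Suc (Suc n)) f) $ (3 * n + 3) = 2 * \<mu> ^ 2 * line x y f $ Suc (Suc (Suc n))"
proof -
  define A' where "A' = line x y f $ Suc (Suc (Suc n))"
  define U where "U = line x y (fps_deriv f) $ Suc n"
  define V where "V = line x y (deriv_v f) $ Suc n"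
  define P where "P = line x y (fps_deriv (fps_deriv f)) $ n"
  define W where "W = line x y (fps_deriv (deriv_v f)) $ n"
  define S where "S = line x y (deriv_v (deriv_v f)) $ n"
  define U' where "U' = line x y (fps_deriv f) $ Suc (Suc n)"
  define V' where "V' = line x y (deriv_v f) $ Suc (Suc n)"
  define P' where "P' = line x y (fps_deriv (fps_deriv f)) $ Suc n"
  define W' where "W' = line x y (fps_deriv (deriv_v f)) $ Suc n"
  define S' where "S' = line x y (deriv_v (deriv_v f)) $ Suc n"
  define m where "m = (of_nat (Suc n) :: complex)"
  define c where "c = (of_nat (Suc (Suc n)) / of_nat (Suc n) :: complex)"
  have m0: "m \<noteq> 0" unfolding m_def by (simp del: of_nat_Suc)
  have mc: "c * m = m + 1" using m0 unfolding c_def m_def by (simp add: field_simps)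
  have e1: "x * U + y * V = 0"
    using euler_relations(1)[of x y "Suc n"] zero by (simp add: U_def V_def)
  have e2: "x * P + y * W = m * U" and e3: "x * W + y * S = m * V"
    using euler_relations(2,3)[of x y n] by (simp_all only: U_def V_def P_def W_def S_def m_def)
  have e1': "x * U' + y * V' = (m + 2) * A'"
    using euler_relations(1)[of x y "Suc (Suc n)"] by (simp add: U'_def V'_def A'_def m_def algebra_simps)
  have e2': "x * P' + y * W' = (m + 1) * U'" and e3': "x * W' + y * S' = (m + 1) * V'"
    using euler_relations(2,3)[of x y "Suc n"] by (simp_all add: U'_def V'_def P'_def W'_def S'_def m_def algebra_simps)
  obtain \<mu> where mu: "U = \<mu> * y" "V = - \<mu> * x"
  proof (cases "y = 0")
    case True
    with xy e1 show ?thesis by (intro that[of "- V / x"]) auto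
  next
    case False
    with e1 show ?thesis by (intro that[of "U / y"]) (auto simp: field_simps eq_neg_iff_add_eq_0)
  qed
  have T1: "V * V * P' - 2 * (U * V * W') + U * U * S' = \<mu> ^ 2 * (m + 1) * (m + 2) * A'"
  proof -
    have "V * V * P' - 2 * (U * V * W') + U * U * S' = \<mu> ^ 2 * (x * (x * P' + y * W') + y * (x * W' + y * S'))"
      unfolding mu by (simp add: power2_eq_square algebra_simps)
    also have "\<dots> = \<mu> ^ 2 * (m + 1) * (x * U' + y * V')"
      unfolding e2' e3' by (simp add: algebra_simps)
    finally show ?thesis unfolding e1' by (simp add: mult.assoc)
  qed
  have T2: "U * U' * S - U' * V * W - U * V' * W + V * V' * P = - (\<mu> ^ 2 * m * (m + 2) * A')"
  proof -
    have "U * U' * S - U' * V * W - U * V' * W + V * V' * P = \<mu> * (U' * (x * W + y * S) - V' * (x * P + y * W))"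
      unfolding mu by (simp add: algebra_simps)
    also have "\<dots> = - (\<mu> ^ 2 * m * (x * U' + y * V'))"
      unfolding e2 e3 mu by (simp add: power2_eq_square algebra_simps)
    finally show ?thesis unfolding e1' by (simp add: mult.assoc)
  qed
  have T3: "P * S - W * W = - (m ^ 2 * \<mu> ^ 2)"
  proof -
    \<comment> \<open>Multiplying by the squares of both coordinates avoids a division; one of them
      is nonzero.\<close>
    have "x * x * (P * S - W * W + m ^ 2 * \<mu> ^ 2) = 0" "y * y * (P * S - W * W + m ^ 2 * \<mu> ^ 2) = 0"
      using e2 e3 mu by algebra+
    with xy have "P * S - W * W + m ^ 2 * \<mu> ^ 2 = 0" by auto
    then show ?thesis by (simp add: eq_neg_iff_add_eq_0)
  qed
  have "line x y (reduced_hessian (Suc (Suc n)) f) $ (3 * n + 3) =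
      (U * U * S' + 2 * U * U' * S) - 2 * (U * V * W' + U * V' * W + U' * V * W) + (V * V * P' + 2 * V * V' * P)
      - c * (A' * (P * S - W * W))"
    unfolding line_reduced_hessian(2) zero
    by (simp only: A'_def U_def V_def P_def W_def S_def U'_def V'_def P'_def W'_def S'_def c_def mult_zero_left add_0)
  also have "\<dots> = (V * V * P' - 2 * (U * V * W') + U * U * S')
      + 2 * (U * U' * S - U' * V * W - U * V' * W + V * V' * P) - c * (A' * (P * S - W * W))"
    by (simp add: algebra_simps)
  \<comment> \<open>Since \<open>c * m = m + 1\<close>, the three contributions add up to
    \<open>(m + 1) * (m + 2) - 2 * m * (m + 2) + m * (m + 1) = 2\<close>.\<close>
  also have "\<dots> = 2 * \<mu> ^ 2 * A'"
    unfolding T1 T2 T3 using mc by algebra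
  finally show ?thesis
    using that[of \<mu>] mu by (simp add: U_def V_def A'_def)
qed

end

text \<open>The orders are \<open>k\<close> and \<open>3 * k - 3\<close>. At a tangent direction the
  second leading form is \<open>2 * \<mu> ^ 2\<close> times the next part of \<open>f\<close>; it
  vanishes if the gradient does or if the next part does, and these are the two ways in which the
  germ fails to be ordinary and simple.\<close>

theorem int_mult_reduced_hessian:
  assumes "f \<in> conv_series" "order_ge k f" "blow f $ k \<noteq> 0" "k \<ge> 2"
  shows "enat (3 * k * (k - 1)) \<le> germ_int_mult f (reduced_hessian k f)"
    and "germ_int_mult f (reduced_hessian k f) = enat (3 * k * (k - 1)) \<longleftrightarrow> ordinary_simple_germ k f"
proof -
  define n where "n = k - 2"
  have n: "k = Suc (Suc n)" using assms(4) by (simp add: n_def)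
  have ord: "order_ge (Suc (Suc n)) f" using assms(2) n by simp
  let ?h = "reduced_hessian k f"
  have oh: "order_ge (3 * n + 3) ?h" using order_reduced_hessian[OF ord] n by simp
  have num: "k * (3 * n + 3) = 3 * k * (k - 1)" by (simp add: n algebra_simps)
  show "enat (3 * k * (k - 1)) \<le> germ_int_mult f ?h"
    using int_mult_ge[OF assms(2) oh] by (simp only: num)
  have "common_zero k f (3 * n + 3) ?h \<longleftrightarrow> \<not> (simple_tangents k f \<and> \<not> common_zero k f (Suc k) f)"
  proof
    assume "common_zero k f (3 * n + 3) ?h"
    then obtain x y where xy: "x \<noteq> 0 \<or> y \<noteq> 0" "line x y f $ k = 0" "line x y ?h $ (3 * n + 3) = 0"
      by (auto simp: common_zero_def)
    have z: "line x y f $ Suc (Suc n) = 0" using xy(2) n by simp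
    obtain \<mu> where mu: "line x y (fps_deriv f) $ Suc n = \<mu> * y" "line x y (deriv_v f) $ Suc n = - \<mu> * x"
      "line x y ?h $ (3 * n + 3) = 2 * \<mu> ^ 2 * line x y f $ Suc k"
      using reduced_hessian_at_zero[OF ord xy(1) z] unfolding n by metis
    then have "\<mu> = 0 \<or> line x y f $ Suc k = 0" using xy(3) by simp
    then show "\<not> (simple_tangents k f \<and> \<not> common_zero k f (Suc k) f)"
    proof
      assume "\<mu> = 0"
      then have "\<not> simple_tangents k f"
        using mu xy unfolding simple_tangents_def n by auto
      then show ?thesis by simp
    qed (use xy in \<open>auto simp: common_zero_def\<close>)
  next
    assume "\<not> (simple_tangents k f \<and> \<not> common_zero k f (Suc k) f)"
    then obtain x y where xy: "x \<noteq> 0 \<or> y \<noteq> 0" "line x y f $ k = 0"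
      "line x y (fps_deriv f) $ Suc n = 0 \<and> line x y (deriv_v f) $ Suc n = 0 \<or> line x y f $ Suc k = 0"
      unfolding simple_tangents_def common_zero_def n by auto
    have z: "line x y f $ Suc (Suc n) = 0" using xy(2) n by simp
    obtain \<mu> where mu: "line x y (fps_deriv f) $ Suc n = \<mu> * y" "line x y (deriv_v f) $ Suc n = - \<mu> * x"
      "line x y ?h $ (3 * n + 3) = 2 * \<mu> ^ 2 * line x y f $ Suc k"
      using reduced_hessian_at_zero[OF ord xy(1) z] unfolding n by metis
    then have "line x y ?h $ (3 * n + 3) = 0" using xy by auto
    then show "common_zero k f (3 * n + 3) ?h" using xy by (auto simp: common_zero_def)
  qed
  moreover have "germ_int_mult f ?h = enat (k * (3 * n + 3)) \<longleftrightarrow> \<not> common_zero k f (3 * n + 3) ?h"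
    using assms oh by (intro int_mult_eq_iff conv_series_reduced_hessian) auto
  moreover have "ordinary_simple_germ k f \<longleftrightarrow> simple_tangents k f \<and> \<not> common_zero k f (Suc k) f"
    using assms by (intro ordinary_simple_germ_iff) auto
  ultimately show "germ_int_mult f ?h = enat (3 * k * (k - 1)) \<longleftrightarrow> ordinary_simple_germ k f"
    by (simp only: num) blast
qed

section \<open>From the Hessian of the curve to the reduced Hessian of the germ\<close>

lemma germ_ideal_cong:
  assumes "g = const2 c * g' + a * f" "c \<noteq> 0" "a \<in> conv_series"
  shows "germ_ideal f g = germ_ideal f g'"
proof (intro set_eqI iffI)
  fix x assume "x \<in> germ_ideal f g"
  then obtain s t where st: "x = s * f + t * g" "s \<in> conv_series" "t \<in> conv_series" by (auto simp: germ_ideal_def)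
  have "x = (s + t * a) * f + (t * const2 c) * g'" unfolding st(1) assms(1) by (simp add: algebra_simps)
  moreover have "s + t * a \<in> conv_series" "t * const2 c \<in> conv_series" using st assms(3) by (auto intro!: conv_series_intros)
  ultimately show "x \<in> germ_ideal f g'" using germ_idealI by metis
next
  fix x assume "x \<in> germ_ideal f g'"
  then obtain s t where st: "x = s * f + t * g'" "s \<in> conv_series" "t \<in> conv_series" by (auto simp: germ_ideal_def)
  have "const2 (inverse c) * const2 c = 1"
    using assms(2) by (simp add: const2.hom_one flip: const2.hom_mult)
  then have "x = (s - t * const2 (inverse c) * a) * f + (t * const2 (inverse c)) * g"
    using st(1) assms(1) by algebra
  moreover have "s - t * const2 (inverse c) * a \<in> conv_series" "t * const2 (inverse c) \<in> conv_series"
    using st assms(3) by (auto intro!: conv_series_intros)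
  ultimately show "x \<in> germ_ideal f g" using germ_idealI by metis
qed

lemma germ_mult_leading:
  assumes "f \<noteq> 0"
  shows "order_ge (germ_mult f) f" "blow f $ germ_mult f \<noteq> 0"
proof -
  let ?P = "\<lambda>n. \<exists>i j. i + j = n \<and> coeff2 f i j \<noteq> 0"
  obtain i j where "coeff2 f i j \<noteq> 0"
    using assms by (metis series2_eqI fps_zero_nth)
  then have "?P (i + j)" by blast
  then have P: "?P (germ_mult f)" unfolding germ_mult_def by (rule LeastI)
  show "order_ge (germ_mult f) f"
    unfolding order_ge_def germ_mult_def using not_less_Least by blast
  obtain i j where ij: "i + j = germ_mult f" "coeff2 f i j \<noteq> 0" using P by blast
  then have "coeff (blow f $ germ_mult f) j \<noteq> 0"
    using coeff2_eq_coeff_blow[of f i j] by simp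
  then show "blow f $ germ_mult f \<noteq> 0" by auto
qed

theorem theorem1p3:
  fixes F :: poly3 and d k :: nat and p :: "complex^3"
  assumes "homogeneous d F" and "d \<ge> 3"
    and reduced: "squarefree F"
    and no_line: "\<not> (\<exists>L. irreducible L \<and> L dvd F \<and> homogeneous 1 L)"
    and sing: "singular_point F p"
    and mult: "mult_at F p = k"
  shows "int_mult_at F (hessian F) p \<ge> enat (3 * k * (k - 1)) \<and>
         (int_mult_at F (hessian F) p = enat (3 * k * (k - 1)) \<longleftrightarrow> ordinary_simple_point k F p)"
proof -
  define a where "a = fst (chart_dirs p)"
  define b where "b = snd (chart_dirs p)"
  define f where "f = germ_at F p"
  have germ: "germ_at G p = peval const2 G (chart_point p a b)" for G
    unfolding a_def b_def by (rule germ_at_eq)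
  have det: "det (frame p a b) \<noteq> 0"
    using chart_dirs_frame[of p] sing by (simp add: a_def b_def singular_point_def)
  have "F \<noteq> 0" using reduced by auto
  then have f0: "f \<noteq> 0" using ev_eq_0_imp[OF det assms(1)] by (auto simp: f_def germ)
  have fc: "f \<in> conv_series" unfolding f_def germ by (rule conv_ev)
  have k: "k = germ_mult f" using mult by (simp add: mult_at_def f_def)
  have lead: "order_ge k f" "blow f $ k \<noteq> 0" using germ_mult_leading[OF f0] k by auto
  have at0: "coeff2 (peval const2 (partial i F) (chart_point p a b)) 0 0 = 0" for i
    using sing by (simp add: coeff2_peval_chart_point singular_point_def)
  have "coeff2 f 0 0 = 0"
    using sing by (simp add: f_def germ coeff2_peval_chart_point singular_point_def)
  moreover have "coeff2 (fps_deriv f) 0 0 = 0"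
    unfolding f_def germ deriv_u_ev coeff2_sum coeff2_const2_mult at0 by simp
  then have "coeff2 f 1 0 = 0" unfolding coeff2_deriv_u by simp
  moreover have "coeff2 (deriv_v f) 0 0 = 0"
    unfolding f_def germ deriv_v_ev coeff2_sum coeff2_const2_mult at0 by simp
  then have "coeff2 f 0 1 = 0" unfolding coeff2_deriv_v by simp
  ultimately have "blow f $ 0 = 0" "blow f $ 1 = 0" by (simp_all add: blow_nth)
  \<comment> \<open>Singularity removes the constant and linear parts, so the denominator
    \<open>k - 1\<close> in the reduced Hessian is nonzero.\<close>
  with lead(2) have k2: "k \<ge> 2" by (metis One_nat_def Suc_1 less_2_cases not_le)
  define D where "D = (det (frame p a b))\<^sup>2"
  have D0: "D \<noteq> 0" using det by (simp add: D_def)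
  define m where "m = (of_nat ((d - 1)\<^sup>2) :: complex)"
  have m0: "m \<noteq> 0" using assms(2) by (simp add: m_def)
  define r where "r = (of_nat (d * (d - 1)) :: complex)"
  define c where "c = (of_nat k / of_nat (k - 1) :: complex)"
  have "const2 D * germ_at (hessian F) p = const2 r * f * hess2 f - const2 m * bordered f"
    unfolding D_def m_def r_def const2.hom_power const2.hom_of_nat f_def germ hess2_def bordered_def
    by (rule hessian_frame[OF assms(1)]) (use assms(2) in simp)
  also have "bordered f = reduced_hessian k f + const2 c * (f * hess2 f)"
    by (simp add: reduced_hessian_def c_def)
  finally have H: "const2 D * germ_at (hessian F) p
      = const2 r * f * hess2 f - const2 m * (reduced_hessian k f + const2 c * (f * hess2 f))" .
  have "germ_at (hessian F) p = const2 (inverse D) * (const2 D * germ_at (hessian F) p)"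
    using D0 by (simp add: const2.hom_one flip: mult.assoc const2.hom_mult)
  also have "\<dots> = const2 (- (inverse D * m)) * reduced_hessian k f
      + const2 (inverse D) * (const2 r - const2 m * const2 c) * hess2 f * f"
    unfolding H const2.hom_uminus const2.hom_mult by (simp add: algebra_simps)
  finally have E: "germ_at (hessian F) p = const2 (- (inverse D * m)) * reduced_hessian k f
      + const2 (inverse D) * (const2 r - const2 m * const2 c) * hess2 f * f" .
  \<comment> \<open>Modulo \<open>f\<close> only the scalar in front of the reduced Hessian matters,
    and it is nonzero because the frame is invertible and \<open>d\<close> exceeds 1.\<close>
  have "germ_ideal f (germ_at (hessian F) p) = germ_ideal f (reduced_hessian k f)"
  proof (rule germ_ideal_cong[OF E])
    show "- (inverse D * m) \<noteq> 0" using D0 m0 by simp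
    show "const2 (inverse D) * (const2 r - const2 m * const2 c) * hess2 f \<in> conv_series"
      by (intro conv_series_intros conv_series_hess2 fc)
  qed
  then have "int_mult_at F (hessian F) p = germ_int_mult f (reduced_hessian k f)"
    by (simp add: int_mult_at_def germ_int_mult_def f_def)
  then show ?thesis
    using int_mult_reduced_hessian[OF fc lead k2] by (simp add: ordinary_simple_point_def f_def)
qed

end
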